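(* Let $(M,\mathcal D,J)$ be a 5-dimensional girdled CR manifold and let $(Q,\varpi)$ be a canonical Cartan connection of $(M,\mathcal D,J)$, modelled on $\mathrm{SO}^o_{3,2}/H$ (in the sense recalled in the context). Let $(\vartheta^A,\omega^B)$ be the components of $\varpi$ in the standard CR basis of $\mathfrak{so}_{3,2}$ and let $T^A_{BC}$, $R^D_{BC}$ be the curvature components (all defined in the context). Then the following structure equations hold on $Q$, together with the equations obtained from them by complex conjugation: $$d\vartheta^{-2}+\tfrac i2\,\vartheta^{-1(10)}\wedge\vartheta^{-1(01)}-(\omega^{0(10)}+\omega^{0(01)})\wedge\vartheta^{-2}=0,$$ $$d\vartheta^{-1(10)}-\vartheta^{0(10)}\wedge\vartheta^{-1(01)}-\omega^{0(10)}\wedge\vartheta^{-1(10)}+i\,\omega^{1(10)}\wedge\vartheta^{-2}=T^{-1(10)}_{-2\,0(10)}\vartheta^{-2}\wedge\vartheta^{0(10)}+T^{-1(10)}_{-2\,0(01)}\vartheta^{-2}\wedge\vartheta^{0(01)},$$ $$d\vartheta^{0(10)}-(\omega^{0(10)}-\omega^{0(01)})\wedge\vartheta^{0(10)}+\tfrac12\omega^{1(10)}\wedge\vartheta^{-1(10)}=T^{0(10)}_{-2\,-1(10)}\vartheta^{-2}\wedge\vartheta^{-1(10)}+T^{0(10)}_{-2\,-1(01)}\vartheta^{-2}\wedge\vartheta^{-1(01)}+T^{0(10)}_{-2\,0(10)}\vartheta^{-2}\wedge\vartheta^{0(10)}+T^{0(10)}_{-2\,0(01)}\vartheta^{-2}\wedge\vartheta^{0(01)}+T^{0(10)}_{-1(01)\,0(10)}\vartheta^{-1(01)}\wedge\vartheta^{0(10)}+T^{0(10)}_{0(10)\,0(01)}\vartheta^{0(10)}\wedge\vartheta^{0(01)},$$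 $$d\omega^{0(10)}-\vartheta^{0(10)}\wedge\vartheta^{0(01)}+\tfrac12\omega^{1(01)}\wedge\vartheta^{-1(10)}+\omega^2\wedge\vartheta^{-2}=R^{0(10)}_{-2\,-1(10)}\vartheta^{-2}\wedge\vartheta^{-1(10)}+R^{0(10)}_{-2\,-1(01)}\vartheta^{-2}\wedge\vartheta^{-1(01)}+R^{0(10)}_{-1(10)\,0(10)}\vartheta^{-1(10)}\wedge\vartheta^{0(10)}+R^{0(10)}_{-1(10)\,0(01)}\vartheta^{-1(10)}\wedge\vartheta^{0(01)}+R^{0(10)}_{-1(01)\,0(10)}\vartheta^{-1(01)}\wedge\vartheta^{0(10)}+R^{0(10)}_{-1(01)\,0(01)}\vartheta^{-1(01)}\wedge\vartheta^{0(01)}+R^{0(10)}_{0(10)\,0(01)}\vartheta^{0(10)}\wedge\vartheta^{0(01)},$$ $$d\omega^{1(10)}-\omega^{1(01)}\wedge\vartheta^{0(10)}-\omega^{1(10)}\wedge\omega^{0(01)}+i\,\omega^2\wedge\vartheta^{-1(10)}=\sum_{B<C}R^{1(10)}_{BC}\,\vartheta^B\wedge\vartheta^C,$$ $$d\omega^2-\tfrac i2\,\omega^{1(10)}\wedge\omega^{1(01)}+(\omega^{0(10)}+\omega^{0(01)})\wedge\omega^2=\sum_{B<C}R^{2}_{BC}\,\vartheta^B\wedge\vartheta^C,$$ where in the last two equations $B<C$ range over the ten pairs of indices in the ordered list $(-2,-1(10),-1(01),0(10),0(01))$, and where $$\overline{R^{0(10)}_{-2\,-1(10)}}=-\tfrac12T^{0(10)}_{-2\,-1(10)}-\tfrac12R^{0(10)}_{-2\,-1(01)},\qquad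 R^{1(10)}_{-1(10)\,-1(01)}=\tfrac i2\,T^{0(10)}_{-2\,-1(10)}-\tfrac i2\,R^{0(10)}_{-2\,-1(01)}.$$
   Context: **Girdled CR manifolds.** A 5-dimensional CR hypersurface is a 5-manifold $M$ with a codimension-one distribution $\mathcal D\subset TM$ and a smooth family $J$ of complex structures $J_x$ on $\mathcal D_x$ such that the $(+i)$-eigenbundle $\mathcal D^{10}\subset\mathcal D^{\mathbb C}$ is involutive; $\mathcal D^{01}=\overline{\mathcal D^{10}}$. If $\vartheta$ is a local 1-form with kernel $\mathcal D$, the Levi form is $\mathcal L_x(v,w)=d\vartheta_x(v,Jw)$ on $\mathcal D_x$. $(M,\mathcal D,J)$ is *girdled* if (i) it is of uniform type ($\dim\ker\mathcal L_x$ is constant) and uniformly Levi degenerate, with $\mathcal E:=\ker\mathcal L\subset\mathcal D$ of real rank 2 (it is $J$-invariant and involutive; $\mathcal E^{\mathbb C}=\mathcal E^{10}\oplus\mathcal E^{01}$ with $\mathcal E^{10}=\mathcal E^{\mathbb C}\cap\mathcal D^{10}$), and (ii) it is Levi 2-nondegenerate: at each $x$, the only $v\in\mathcal E^{10}_x$ such that, for a section $X$ of $\mathcal E^{10}$ with $X_x=v$, $[X,\overline Y]_x\in\mathcal E^{10}_x+\mathcal D^{01}_x$ for all sections $Y$ of $\mathcal D^{10}$, is $v=0$. **The Lie algebra.** Let $\mathcal I$ be the $5\times5$ matrix with ones on the antidiagonal and zeros elsewhere, $\mathfrak g=\mathfrak{so}_{3,2}=\{A\in\mathfrak{gl}_5(\mathbb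 R):A^T\mathcal I+\mathcal IA=0\}$, and $\mathrm{SO}^o_{3,2}$ the identity component of the group of real matrices of determinant one preserving $\mathcal I$. With $\epsilon_{ij}$ the elementary matrices, put $e^o_{-2}=\epsilon_{41}-\epsilon_{52}$, $e^o_{-1|1}=\epsilon_{31}-\epsilon_{53}$, $e^o_{-1|2}=\epsilon_{32}-\epsilon_{43}$, $e^o_{0|1}=\epsilon_{11}-\epsilon_{22}+\epsilon_{44}-\epsilon_{55}$, $e^o_{0|2}=\epsilon_{12}+\epsilon_{21}-\epsilon_{45}-\epsilon_{54}$, $E^o_{0|1}=\epsilon_{11}+\epsilon_{22}-\epsilon_{44}-\epsilon_{55}$, $E^o_{0|2}=\epsilon_{12}-\epsilon_{21}-\epsilon_{45}+\epsilon_{54}$, $E^o_{1|1}=\epsilon_{13}-\epsilon_{35}$, $E^o_{1|2}=\epsilon_{23}-\epsilon_{34}$, $E^o_2=\epsilon_{14}-\epsilon_{25}$. These form a basis of $\mathfrak g$. $\mathfrak g$ is graded, $\mathfrak g=\bigoplus_{k=-2}^2\mathfrak g_k$, where $\mathfrak g_k$ is the eigenspace of $\mathrm{ad}_{E^o_{0|1}}$ of eigenvalue $k$; $\mathfrak m_-:=\mathfrak g_{-2}+\mathfrak g_{-1}$, $\mathfrak g_+:=\mathfrak g_1+\mathfrak g_2$. $H\subset\mathrm{SO}^o_{3,2}$ is the isotropy subgroup of the point $[1:i:0:0:0]\in\mathbb CP^4$, with Lie algebra $\mathfrak h=\langle E^o_{0|1},E^o_{0|2},E^o_{1|1},E^o_{1|2},E^o_2\rangle$.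 For $\ell=0,1$ set $e^o_{-\ell(10)}=\frac12(e^o_{-\ell|1}-i\,e^o_{-\ell|2})$, $E^o_{\ell(10)}=\frac12(E^o_{\ell|1}-i\,E^o_{\ell|2})$, $e^o_{-\ell(01)}=\overline{e^o_{-\ell(10)}}$, $E^o_{\ell(01)}=\overline{E^o_{\ell(10)}}$. The *standard CR basis* of $\mathfrak g^{\mathbb C}$ is $(e^o_A,E^o_B)$ with $A\in\{-2,-1(10),-1(01),0(10),0(01)\}$, $B\in\{0(10),0(01),1(10),1(01),2\}$. **Cartan connections.** A Cartan connection on $M$ modelled on $\mathrm{SO}^o_{3,2}/H$ is a principal $H$-bundle $\pi:Q\to M$ with a $\mathfrak g$-valued 1-form $\varpi$ such that each $\varpi_y:T_yQ\to\mathfrak g$ is a linear isomorphism, $\varpi_y^{-1}|_{\mathfrak h}$ is the standard isomorphism of $\mathfrak h$ with the vertical space given by the right $H$-action, and $R_h^*\varpi=\mathrm{Ad}_{h^{-1}}\circ\varpi$ for $h\in H$. Write $\varpi=\sum_Ae^o_A\otimes\vartheta^A+\sum_BE^o_B\otimes\omega^B$ (complex conjugation exchanges the indices $(10)$ and $(01)$), and let $(e_A,E_B)$ be the dual (complex) frame field, i.e. $\varpi(e_A)=e^o_A$, $\varpi(E_B)=E^o_B$. The curvature $\kappa=d\varpi+\frac12[\varpi,\varpi]$ vanishes when one argument is vertical; define $T^A_{BC},R^D_{BC}$ by $\kappa(e_B,e_C)=\sum_AT^A_{BC}e^o_A+\sum_DR^D_{BC}E^o_D$, so that $\kappa=\sum_{B<C}(\sum_A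 T^A_{BC}e^o_A+\sum_D R^D_{BC}E^o_D)\otimes\vartheta^B\wedge\vartheta^C$. **Codifferential.** For linear $A:\mathfrak g_+\to\mathfrak g$ let $\partial A(X,Y)=[X,A(Y)]-[Y,A(X)]-A([X,Y])$, $X,Y\in\mathfrak g_+$. For $\tau\in\mathrm{Hom}(\Lambda^2\mathfrak m_-,\mathfrak g)$ say $\tau\in\ker\partial^*$ if for all such $A$ one has $\sum_{i<j}\langle\tau(x_i,x_j),\partial A(x^i,x^j)\rangle=0$, where $\langle\cdot,\cdot\rangle$ is the Cartan–Killing form of $\mathfrak g$, $(x_i)$ is a basis of $\mathfrak m_-$ and $(x^i)$ the dual basis of $\mathfrak g_+$ with respect to $\langle\cdot,\cdot\rangle$. The component of $\tau$ of shifting degree $d$ is the part mapping $\mathfrak g_i\wedge\mathfrak g_j$ into $\mathfrak g_{i+j+d}$. **Canonical Cartan connection.** The canonical Cartan connection of a girdled CR manifold (Medori–Spiro) is a Cartan connection $(Q,\varpi)$ on $M$ modelled on $\mathrm{SO}^o_{3,2}/H$ satisfying the following properties, which are the only ones needed here: 1. for each $u\in Q$, $\pi_*$ maps $\langle e_{-1(10)}|_u,e_{0(10)}|_u\rangle$ isomorphically onto $\mathcal D^{10}_{\pi(u)}$ and $\langle e_{0(10)}|_u\rangle$ isomorphically onto $\mathcal E^{10}_{\pi(u)}$ (and similarly for the conjugates); 2. the following components, and their complex conjugates, vanish identically: $T^A_{0(10)\,0(01)}$ for $A\in\{-2,-1(10),-1(01)\}$; $T^A_{i(10)\,j(10)}$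 for $i,j\in\{-1,0\}$ and $A\in\{-2,-1(01),0(01)\}$; $T^{-2}_{-1(01)\,0(10)}$; $T^{-2}_{-1(10)\,-1(01)}$; $T^{-1(10)}_{-1(01)\,0(10)}$; $T^{-1(10)}_{-1(10)\,0(10)}$; $T^{-1(10)}_{-1(10)\,0(01)}$; $T^{0(10)}_{-1(01)\,0(01)}$; $T^{-2}_{-2\,0(10)}$; $T^{0(10)}_{-1(10)\,0(10)}$; $T^{0(10)}_{-1(10)\,0(01)}$; $R^{0(10)}_{-2\,0(10)}$; $R^{0(10)}_{-2\,0(01)}$; 3. for each $u\in Q$ and $d=1,2,3$, the component of shifting degree $d$ of the map $\tau_u\in\mathrm{Hom}(\Lambda^2\mathfrak m_-,\mathfrak g)$, $\tau_u(x,y)=\kappa_u(\varpi_u^{-1}(x),\varpi_u^{-1}(y))$, lies in $\ker\partial^*$. *)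

theory Defs
  imports "HOL-Analysis.Analysis" "HOL-Library.Function_Algebras"
begin

section \<open>Smooth manifolds\<close>

primrec Ck_on :: "nat \<Rightarrow> ('a::euclidean_space \<Rightarrow> 'b::real_normed_vector) \<Rightarrow> 'a set \<Rightarrow> bool" where
  "Ck_on 0 f W \<longleftrightarrow> continuous_on W f"
| "Ck_on (Suc k) f W \<longleftrightarrow>
     (\<forall>x\<in>W. f differentiable (at x)) \<and> (\<forall>v. Ck_on k (\<lambda>x. frechet_derivative f (at x) v) W)"

text \<open>Smoothness on an arbitrary subset of a Euclidean space, through local smooth extensions.
  For open \<open>S\<close> this is ordinary smoothness; for \<open>S\<close> an embedded submanifold (such as an open
  set times a closed matrix group) it is smoothness in the sense of manifolds.\<close>

definition smooth_on :: "'a::euclidean_space set \<Rightarrow> ('a \<Rightarrow> 'b::real_normed_vector) \<Rightarrow> bool" where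
  "smooth_on S f \<longleftrightarrow>
     (\<forall>p\<in>S. \<exists>W g. open W \<and> p \<in> W \<and> (\<forall>k. Ck_on k g W) \<and> (\<forall>q\<in>S \<inter> W. g q = f q))"

type_synonym ('m, 'e) chart = "'m set \<times> ('m \<Rightarrow> 'e)"

definition inv_chart :: "('m, 'e) chart \<Rightarrow> 'e \<Rightarrow> 'm" where
  "inv_chart c = inv_into (fst c) (snd c)"

text \<open>The atlas need not be maximal.\<close>

definition smooth_atlas ::
  "('m::{t2_space, second_countable_topology}, 'e::euclidean_space) chart set \<Rightarrow> bool" where
  "smooth_atlas A \<longleftrightarrow>
     (\<forall>c\<in>A. open (fst c) \<and> open (snd c ` fst c)
        \<and> homeomorphism (fst c) (snd c ` fst c) (snd c) (inv_chart c)) \<and>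
     (\<Union>c\<in>A. fst c) = UNIV \<and>
     (\<forall>c\<in>A. \<forall>c'\<in>A. smooth_on (snd c ` (fst c \<inter> fst c')) (snd c' \<circ> inv_chart c))"

text \<open>As each tangent vector at \<open>x\<close> is determined by its coordinates in any one chart around
  \<open>x\<close>, the tangent space at \<open>x\<close> is taken to be the model space \<open>'e\<close> itself, by means of the
  coordinates in the chosen chart \<open>chart_at A x\<close>.  The next two functions convert between
  these coordinates and those in another chart \<open>c\<close> around \<open>x\<close>.\<close>

definition chart_at :: "('m, 'e) chart set \<Rightarrow> 'm \<Rightarrow> ('m, 'e) chart" where
  "chart_at A x = (SOME c. c \<in> A \<and> x \<in> fst c)"

definition to_coord ::
  "('m, 'e::euclidean_space) chart set \<Rightarrow> ('m, 'e) chart \<Rightarrow> 'm \<Rightarrow> 'e \<Rightarrow> 'e" where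
  "to_coord A c x =
     frechet_derivative (snd c \<circ> inv_chart (chart_at A x)) (at (snd (chart_at A x) x))"

definition from_coord ::
  "('m, 'e::euclidean_space) chart set \<Rightarrow> ('m, 'e) chart \<Rightarrow> 'm \<Rightarrow> 'e \<Rightarrow> 'e" where
  "from_coord A c x = frechet_derivative (snd (chart_at A x) \<circ> inv_chart c) (at (snd c x))"

definition smooth_map_on ::
  "('m::topological_space, 'e::euclidean_space) chart set
    \<Rightarrow> ('n::topological_space, 'f::euclidean_space) chart set \<Rightarrow> 'm set \<Rightarrow> ('m \<Rightarrow> 'n) \<Rightarrow> bool" where
  "smooth_map_on A B N f \<longleftrightarrow> continuous_on N f \<and>
     (\<forall>c\<in>A. \<forall>c'\<in>B. smooth_on (snd c ` (N \<inter> fst c \<inter> f -` fst c')) (snd c' \<circ> f \<circ> inv_chart c))"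

definition smooth_fun_on ::
  "('m, 'e::euclidean_space) chart set \<Rightarrow> 'm set \<Rightarrow> ('m \<Rightarrow> 'b::real_normed_vector) \<Rightarrow> bool" where
  "smooth_fun_on A N f \<longleftrightarrow> (\<forall>c\<in>A. smooth_on (snd c ` (N \<inter> fst c)) (f \<circ> inv_chart c))"

definition differential ::
  "('m, 'e::euclidean_space) chart set \<Rightarrow> ('n, 'f::euclidean_space) chart set
    \<Rightarrow> ('m \<Rightarrow> 'n) \<Rightarrow> 'm \<Rightarrow> 'e \<Rightarrow> 'f" where
  "differential A B f x =
     frechet_derivative (snd (chart_at B (f x)) \<circ> f \<circ> inv_chart (chart_at A x))
       (at (snd (chart_at A x) x))"

definition velocity ::
  "('m, 'e::euclidean_space) chart set \<Rightarrow> (real \<Rightarrow> 'm) \<Rightarrow> 'e" where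
  "velocity A \<gamma> = vector_derivative (snd (chart_at A (\<gamma> 0)) \<circ> \<gamma>) (at 0)"

definition vf_rep ::
  "('m, 'e::euclidean_space) chart set \<Rightarrow> ('m, 'e) chart \<Rightarrow> ('m \<Rightarrow> 'e) \<Rightarrow> 'e \<Rightarrow> 'e" where
  "vf_rep A c X p = to_coord A c (inv_chart c p) (X (inv_chart c p))"

definition smooth_vf_on ::
  "('m, 'e::euclidean_space) chart set \<Rightarrow> 'm set \<Rightarrow> ('m \<Rightarrow> 'e) \<Rightarrow> bool" where
  "smooth_vf_on A N X \<longleftrightarrow> (\<forall>c\<in>A. smooth_on (snd c ` (N \<inter> fst c)) (vf_rep A c X))"

definition vf_bracket ::
  "('m, 'e::euclidean_space) chart set \<Rightarrow> ('m \<Rightarrow> 'e) \<Rightarrow> ('m \<Rightarrow> 'e) \<Rightarrow> 'm \<Rightarrow> 'e" where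
  "vf_bracket A X Y x =
     (let c = chart_at A x; p = snd c x in
        frechet_derivative (vf_rep A c Y) (at p) (X x)
          - frechet_derivative (vf_rep A c X) (at p) (Y x))"

definition form_rep ::
  "('m, 'e::euclidean_space) chart set \<Rightarrow> ('m, 'e) chart \<Rightarrow> ('m \<Rightarrow> 'e \<Rightarrow> 'b) \<Rightarrow> 'e \<Rightarrow> 'e \<Rightarrow> 'b" where
  "form_rep A c \<theta> p v = \<theta> (inv_chart c p) (from_coord A c (inv_chart c p) v)"

definition smooth_form_on ::
  "('m, 'e::euclidean_space) chart set \<Rightarrow> 'm set \<Rightarrow> ('m \<Rightarrow> 'e \<Rightarrow> 'b::real_normed_vector) \<Rightarrow> bool" where
  "smooth_form_on A N \<theta> \<longleftrightarrow> (\<forall>x\<in>N. linear (\<theta> x)) \<and>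
     (\<forall>c\<in>A. \<forall>v. smooth_on (snd c ` (N \<inter> fst c)) (\<lambda>p. form_rep A c \<theta> p v))"

text \<open>Exterior derivative of a vector-valued 1-form, normalised by
  \<open>d\<theta>(X,Y) = X \<theta>(Y) - Y \<theta>(X) - \<theta>([X,Y])\<close>; the wedge product is normalised accordingly.\<close>

definition ext_d ::
  "('m, 'e::euclidean_space) chart set \<Rightarrow> ('m \<Rightarrow> 'e \<Rightarrow> 'b::real_normed_vector)
    \<Rightarrow> 'm \<Rightarrow> 'e \<Rightarrow> 'e \<Rightarrow> 'b" where
  "ext_d A \<theta> x v w =
     (let c = chart_at A x; p = snd c x in
        frechet_derivative (\<lambda>q. form_rep A c \<theta> q w) (at p) v
          - frechet_derivative (\<lambda>q. form_rep A c \<theta> q v) (at p) w)"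

definition wedge ::
  "('m \<Rightarrow> 'e \<Rightarrow> complex) \<Rightarrow> ('m \<Rightarrow> 'e \<Rightarrow> complex) \<Rightarrow> 'm \<Rightarrow> 'e \<Rightarrow> 'e \<Rightarrow> complex"
    (infixl "\<curlywedge>" 77) where
  "\<alpha> \<curlywedge> \<beta> = (\<lambda>x v w. \<alpha> x v * \<beta> x w - \<alpha> x w * \<beta> x v)"

definition const_scale ::
  "complex \<Rightarrow> ('m \<Rightarrow> 'e \<Rightarrow> 'e \<Rightarrow> complex) \<Rightarrow> 'm \<Rightarrow> 'e \<Rightarrow> 'e \<Rightarrow> complex" (infixr "\<cdot>" 75) where
  "c \<cdot> \<Omega> = (\<lambda>x v w. c * \<Omega> x v w)"

definition fun_scale ::
  "('m \<Rightarrow> complex) \<Rightarrow> ('m \<Rightarrow> 'e \<Rightarrow> 'e \<Rightarrow> complex) \<Rightarrow> 'm \<Rightarrow> 'e \<Rightarrow> 'e \<Rightarrow> complex"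
    (infixr "\<odot>" 75) where
  "f \<odot> \<Omega> = (\<lambda>x v w. f x * \<Omega> x v w)"


section \<open>Complex tangent vectors\<close>

text \<open>The complex tangent vector \<open>v + iw\<close> is represented by the pair \<open>(v, w)\<close>.\<close>

definition cscale :: "complex \<Rightarrow> 'e::real_vector \<times> 'e \<Rightarrow> 'e \<times> 'e" where
  "cscale z V = (Re z *\<^sub>R fst V - Im z *\<^sub>R snd V, Re z *\<^sub>R snd V + Im z *\<^sub>R fst V)"

definition ccnj :: "'e::real_vector \<times> 'e \<Rightarrow> 'e \<times> 'e" where
  "ccnj V = (fst V, - snd V)"

definition cspan2 :: "'e::real_vector \<times> 'e \<Rightarrow> 'e \<times> 'e \<Rightarrow> ('e \<times> 'e) set" where
  "cspan2 V W = {cscale z V + cscale w W | z w. True}"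

definition csection_on ::
  "('m, 'e::euclidean_space) chart set \<Rightarrow> 'm set \<Rightarrow> ('m \<Rightarrow> ('e \<times> 'e) set) \<Rightarrow> ('m \<Rightarrow> 'e \<times> 'e) \<Rightarrow> bool" where
  "csection_on A N F X \<longleftrightarrow>
     smooth_vf_on A N (fst \<circ> X) \<and> smooth_vf_on A N (snd \<circ> X) \<and> (\<forall>y\<in>N. X y \<in> F y)"

definition cbracket ::
  "('m, 'e::euclidean_space) chart set \<Rightarrow> ('m \<Rightarrow> 'e \<times> 'e) \<Rightarrow> ('m \<Rightarrow> 'e \<times> 'e) \<Rightarrow> 'm \<Rightarrow> 'e \<times> 'e" where
  "cbracket A X Y x =
     (vf_bracket A (fst \<circ> X) (fst \<circ> Y) x - vf_bracket A (snd \<circ> X) (snd \<circ> Y) x,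
      vf_bracket A (fst \<circ> X) (snd \<circ> Y) x + vf_bracket A (snd \<circ> X) (fst \<circ> Y) x)"


section \<open>Girdled CR manifolds\<close>

definition D10 :: "('m \<Rightarrow> 'e::real_vector set) \<Rightarrow> ('m \<Rightarrow> 'e \<Rightarrow> 'e) \<Rightarrow> 'm \<Rightarrow> ('e \<times> 'e) set" where
  "D10 D J x = {V. fst V \<in> D x \<and> snd V \<in> D x \<and> (J x (fst V), J x (snd V)) = cscale \<i> V}"

definition D01 :: "('m \<Rightarrow> 'e::real_vector set) \<Rightarrow> ('m \<Rightarrow> 'e \<Rightarrow> 'e) \<Rightarrow> 'm \<Rightarrow> ('e \<times> 'e) set" where
  "D01 D J x = ccnj ` D10 D J x"

definition distribution ::
  "('m::topological_space, 'e::euclidean_space) chart set \<Rightarrow> nat \<Rightarrow> ('m \<Rightarrow> 'e set) \<Rightarrow> bool" where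
  "distribution A k D \<longleftrightarrow> (\<forall>x. subspace (D x) \<and> dim (D x) = k) \<and>
     (\<forall>x. \<exists>N X. open N \<and> x \<in> N \<and> (\<forall>i<k. smooth_vf_on A N (X i))
        \<and> (\<forall>y\<in>N. D y = span ((\<lambda>i. X i y) ` {..<k})))"

text \<open>\<open>J x\<close> is only meaningful on \<open>D x\<close>.\<close>

definition complex_structure_on ::
  "('m::topological_space, 'e::euclidean_space) chart set \<Rightarrow> ('m \<Rightarrow> 'e set) \<Rightarrow> ('m \<Rightarrow> 'e \<Rightarrow> 'e) \<Rightarrow> bool" where
  "complex_structure_on A D J \<longleftrightarrow>
     (\<forall>x. \<forall>v\<in>D x. J x v \<in> D x \<and> J x (J x v) = - v \<and> (\<forall>a. J x (a *\<^sub>R v) = a *\<^sub>R J x v)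
        \<and> (\<forall>w\<in>D x. J x (v + w) = J x v + J x w)) \<and>
     (\<forall>N X. open N \<and> smooth_vf_on A N X \<and> (\<forall>y\<in>N. X y \<in> D y)
        \<longrightarrow> smooth_vf_on A N (\<lambda>y. J y (X y)))"

definition CR_hypersurface ::
  "('m::{t2_space, second_countable_topology}, real^5) chart set
    \<Rightarrow> ('m \<Rightarrow> (real^5) set) \<Rightarrow> ('m \<Rightarrow> real^5 \<Rightarrow> real^5) \<Rightarrow> bool" where
  "CR_hypersurface A D J \<longleftrightarrow>
     smooth_atlas A \<and> distribution A 4 D \<and> complex_structure_on A D J \<and>
     (\<forall>N X Y. open N \<and> csection_on A N (D10 D J) X \<and> csection_on A N (D10 D J) Y
        \<longrightarrow> (\<forall>x\<in>N. cbracket A X Y x \<in> D10 D J x))"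

definition defining_form ::
  "('m::topological_space, 'e::euclidean_space) chart set \<Rightarrow> ('m \<Rightarrow> 'e set) \<Rightarrow> 'm set
    \<Rightarrow> ('m \<Rightarrow> 'e \<Rightarrow> real) \<Rightarrow> bool" where
  "defining_form A D N \<theta> \<longleftrightarrow>
     open N \<and> smooth_form_on A N \<theta> \<and> (\<forall>y\<in>N. D y = {v. \<theta> y v = 0})"

definition levi_form ::
  "('m, 'e::euclidean_space) chart set \<Rightarrow> ('m \<Rightarrow> 'e \<Rightarrow> 'e) \<Rightarrow> ('m \<Rightarrow> 'e \<Rightarrow> real)
    \<Rightarrow> 'm \<Rightarrow> 'e \<Rightarrow> 'e \<Rightarrow> real" where
  "levi_form A J \<theta> x v w = ext_d A \<theta> x v (J x w)"

text \<open>Local defining forms exist and any two are proportional, with proportional Levi forms on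
  \<open>D x\<close>; so the kernel below is that of the Levi form of any single one of them.\<close>

definition levi_kernel ::
  "('m::topological_space, 'e::euclidean_space) chart set \<Rightarrow> ('m \<Rightarrow> 'e set) \<Rightarrow> ('m \<Rightarrow> 'e \<Rightarrow> 'e)
    \<Rightarrow> 'm \<Rightarrow> 'e set" where
  "levi_kernel A D J x =
     {v \<in> D x. \<forall>N \<theta>. x \<in> N \<and> defining_form A D N \<theta> \<longrightarrow> (\<forall>w\<in>D x. levi_form A J \<theta> x v w = 0)}"

definition E10 ::
  "('m::topological_space, 'e::euclidean_space) chart set \<Rightarrow> ('m \<Rightarrow> 'e set) \<Rightarrow> ('m \<Rightarrow> 'e \<Rightarrow> 'e)
    \<Rightarrow> 'm \<Rightarrow> ('e \<times> 'e) set" where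
  "E10 A D J x = (levi_kernel A D J x \<times> levi_kernel A D J x) \<inter> D10 D J x"

definition E01 ::
  "('m::topological_space, 'e::euclidean_space) chart set \<Rightarrow> ('m \<Rightarrow> 'e set) \<Rightarrow> ('m \<Rightarrow> 'e \<Rightarrow> 'e)
    \<Rightarrow> 'm \<Rightarrow> ('e \<times> 'e) set" where
  "E01 A D J x = ccnj ` E10 A D J x"

definition levi_2_nondegenerate ::
  "('m::topological_space, 'e::euclidean_space) chart set \<Rightarrow> ('m \<Rightarrow> 'e set) \<Rightarrow> ('m \<Rightarrow> 'e \<Rightarrow> 'e) \<Rightarrow> bool" where
  "levi_2_nondegenerate A D J \<longleftrightarrow>
     (\<forall>x. \<forall>V\<in>E10 A D J x.
        (\<exists>N X. open N \<and> x \<in> N \<and> csection_on A N (E10 A D J) X \<and> X x = V \<and>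
           (\<forall>N' Y. open N' \<and> x \<in> N' \<and> csection_on A N' (D10 D J) Y \<longrightarrow>
              cbracket A X (ccnj \<circ> Y) x \<in> {a + b | a b. a \<in> E10 A D J x \<and> b \<in> D01 D J x}))
        \<longrightarrow> V = 0)"

definition girdled_CR_manifold ::
  "('m::{t2_space, second_countable_topology}, real^5) chart set
    \<Rightarrow> ('m \<Rightarrow> (real^5) set) \<Rightarrow> ('m \<Rightarrow> real^5 \<Rightarrow> real^5) \<Rightarrow> bool" where
  "girdled_CR_manifold A D J \<longleftrightarrow>
     CR_hypersurface A D J \<and> (\<forall>x. dim (levi_kernel A D J x) = 2) \<and> levi_2_nondegenerate A D J"


section \<open>The Lie algebra \<open>so(3,2)\<close> and the group \<open>H\<close>\<close>

type_synonym rmat = "real^5^5"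
type_synonym cmat = "complex^5^5"

definition elem :: "5 \<Rightarrow> 5 \<Rightarrow> rmat" (\<open>\<epsilon>\<close>) where
  "elem i j = (\<chi> a b. if a = i \<and> b = j then 1 else 0)"

definition antidiag :: rmat where
  "antidiag = \<epsilon> 1 5 + \<epsilon> 2 4 + \<epsilon> 3 3 + \<epsilon> 4 2 + \<epsilon> 5 1"

definition mbracket :: "rmat \<Rightarrow> rmat \<Rightarrow> rmat" where
  "mbracket X Y = X ** Y - Y ** X"

definition so32 :: "rmat set" where
  "so32 = {X. transpose X ** antidiag + antidiag ** X = 0}"

definition SO32o :: "rmat set" where
  "SO32o = connected_component_set
     {X. det X = 1 \<and> transpose X ** antidiag ** X = antidiag} (mat 1)"

definition cmat_of :: "rmat \<Rightarrow> cmat" where "cmat_of X = map_matrix complex_of_real X"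
definition re_mat :: "cmat \<Rightarrow> rmat" where "re_mat Z = map_matrix Re Z"
definition im_mat :: "cmat \<Rightarrow> rmat" where "im_mat Z = map_matrix Im Z"
definition cmat_scale :: "complex \<Rightarrow> cmat \<Rightarrow> cmat" where "cmat_scale c Z = map_matrix ((*) c) Z"

definition base_point :: "complex^5" where
  "base_point = (\<chi> a. if a = 1 then 1 else if a = 2 then \<i> else 0)"

definition grp_H :: "rmat set" where
  "grp_H = {X \<in> SO32o. \<exists>z. cmat_of X *v base_point = z *s base_point}"

definition e_m2 :: rmat where "e_m2 = \<epsilon> 4 1 - \<epsilon> 5 2"
definition e_m1_1 :: rmat where "e_m1_1 = \<epsilon> 3 1 - \<epsilon> 5 3"
definition e_m1_2 :: rmat where "e_m1_2 = \<epsilon> 3 2 - \<epsilon> 4 3"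
definition e_0_1 :: rmat where "e_0_1 = \<epsilon> 1 1 - \<epsilon> 2 2 + \<epsilon> 4 4 - \<epsilon> 5 5"
definition e_0_2 :: rmat where "e_0_2 = \<epsilon> 1 2 + \<epsilon> 2 1 - \<epsilon> 4 5 - \<epsilon> 5 4"
definition E_0_1 :: rmat where "E_0_1 = \<epsilon> 1 1 + \<epsilon> 2 2 - \<epsilon> 4 4 - \<epsilon> 5 5"
definition E_0_2 :: rmat where "E_0_2 = \<epsilon> 1 2 - \<epsilon> 2 1 - \<epsilon> 4 5 + \<epsilon> 5 4"
definition E_1_1 :: rmat where "E_1_1 = \<epsilon> 1 3 - \<epsilon> 3 5"
definition E_1_2 :: rmat where "E_1_2 = \<epsilon> 2 3 - \<epsilon> 3 4"
definition E_2 :: rmat where "E_2 = \<epsilon> 1 4 - \<epsilon> 2 5"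

definition so32_basis :: "rmat set" where
  "so32_basis = {e_m2, e_m1_1, e_m1_2, e_0_1, e_0_2, E_0_1, E_0_2, E_1_1, E_1_2, E_2}"

definition lie_H :: "rmat set" where
  "lie_H = span {E_0_1, E_0_2, E_1_1, E_1_2, E_2}"

definition mexp :: "rmat \<Rightarrow> rmat" where
  "mexp X = (\<Sum>n. (1 / fact n) *\<^sub>R (((**) X) ^^ n) (mat 1))"

definition killing :: "rmat \<Rightarrow> rmat \<Rightarrow> real" where
  "killing X Y = (\<Sum>b\<in>so32_basis. representation so32_basis (mbracket X (mbracket Y b)) b)"

definition grade :: "int \<Rightarrow> rmat set" where
  "grade k = {X \<in> so32. mbracket E_0_1 X = of_int k *\<^sub>R X}"

definition grade_proj :: "int \<Rightarrow> rmat \<Rightarrow> rmat" where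
  "grade_proj k X = (THE f. (\<forall>j. f j \<in> grade j) \<and> X = (\<Sum>j\<in>{-2..2}. f j)) k"

definition m_minus :: "rmat set" where
  "m_minus = {x + y | x y. x \<in> grade (-2) \<and> y \<in> grade (-1)}"

definition g_plus :: "rmat set" where
  "g_plus = {x + y | x y. x \<in> grade 1 \<and> y \<in> grade 2}"

text \<open>The index \<open>(10)\<close> or \<open>(01)\<close> is the second part of the name; \<open>m\<close> stands for minus.\<close>

datatype tidx = Tm2 | Tm1_10 | Tm1_01 | T0_10 | T0_01
datatype ridx = R0_10 | R0_01 | R1_10 | R1_01 | R2

fun tbar :: "tidx \<Rightarrow> tidx" where
  "tbar Tm2 = Tm2"
| "tbar Tm1_10 = Tm1_01"
| "tbar Tm1_01 = Tm1_10"
| "tbar T0_10 = T0_01"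
| "tbar T0_01 = T0_10"

fun rbar :: "ridx \<Rightarrow> ridx" where
  "rbar R0_10 = R0_01"
| "rbar R0_01 = R0_10"
| "rbar R1_10 = R1_01"
| "rbar R1_01 = R1_10"
| "rbar R2 = R2"

definition tlist :: "tidx list" where
  "tlist = [Tm2, Tm1_10, Tm1_01, T0_10, T0_01]"

definition tpairs :: "(tidx \<times> tidx) set" where
  "tpairs = {(tlist ! i, tlist ! j) | i j. i < j \<and> j < length tlist}"

definition holo :: "rmat \<Rightarrow> rmat \<Rightarrow> cmat" where
  "holo X Y = cmat_scale (1/2) (cmat_of X - cmat_scale \<i> (cmat_of Y))"

definition antiholo :: "rmat \<Rightarrow> rmat \<Rightarrow> cmat" where
  "antiholo X Y = map_matrix cnj (holo X Y)"

fun eo :: "tidx \<Rightarrow> cmat" where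
  "eo Tm2 = cmat_of e_m2"
| "eo Tm1_10 = holo e_m1_1 e_m1_2"
| "eo Tm1_01 = antiholo e_m1_1 e_m1_2"
| "eo T0_10 = holo e_0_1 e_0_2"
| "eo T0_01 = antiholo e_0_1 e_0_2"

fun Eo :: "ridx \<Rightarrow> cmat" where
  "Eo R0_10 = holo E_0_1 E_0_2"
| "Eo R0_01 = antiholo E_0_1 E_0_2"
| "Eo R1_10 = holo E_1_1 E_1_2"
| "Eo R1_01 = antiholo E_1_1 E_1_2"
| "Eo R2 = cmat_of E_2"

definition cr_coords :: "cmat \<Rightarrow> (tidx \<Rightarrow> complex) \<times> (ridx \<Rightarrow> complex)" where
  "cr_coords Z = (THE (a, b).
     Z = (\<Sum>A\<in>{Tm2, Tm1_10, Tm1_01, T0_10, T0_01}. cmat_scale (a A) (eo A))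
       + (\<Sum>B\<in>{R0_10, R0_01, R1_10, R1_01, R2}. cmat_scale (b B) (Eo B)))"


section \<open>Codifferential\<close>

definition bdry :: "(rmat \<Rightarrow> rmat) \<Rightarrow> rmat \<Rightarrow> rmat \<Rightarrow> rmat" where
  "bdry A X Y = mbracket X (A Y) - mbracket Y (A X) - A (mbracket X Y)"

text \<open>The elements \<open>x i\<close>, \<open>i < 3\<close>, form a basis of \<open>m_minus\<close> and the \<open>y i\<close> are the dual basis of
  \<open>g_plus\<close>.\<close>

definition dual_bases :: "(nat \<Rightarrow> rmat) \<Rightarrow> (nat \<Rightarrow> rmat) \<Rightarrow> bool" where
  "dual_bases x y \<longleftrightarrow>
     inj_on x {..<3} \<and> independent (x ` {..<3}) \<and> span (x ` {..<3}) = m_minus \<and>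
     (\<forall>i<3. y i \<in> g_plus) \<and> (\<forall>i<3. \<forall>j<3. killing (x i) (y j) = (if i = j then 1 else 0))"

text \<open>Every linear map from \<open>g_plus\<close> to \<open>so32\<close> is the restriction of a map \<open>A\<close> as below.\<close>

definition in_ker_codiff :: "(rmat \<Rightarrow> rmat \<Rightarrow> rmat) \<Rightarrow> bool" where
  "in_ker_codiff \<tau> \<longleftrightarrow>
     (\<forall>A x y. linear A \<and> (\<forall>X\<in>g_plus. A X \<in> so32) \<and> dual_bases x y \<longrightarrow>
        (\<Sum>(i, j)\<in>{(i, j). i < j \<and> j < 3}. killing (\<tau> (x i) (x j)) (bdry A (y i) (y j))) = 0)"

text \<open>A map on \<open>m_minus\<close> only; hence the degrees \<open>i\<close> and \<open>j\<close> are \<open>-2\<close> or \<open>-1\<close>.\<close>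

definition degree_comp :: "int \<Rightarrow> (rmat \<Rightarrow> rmat \<Rightarrow> rmat) \<Rightarrow> rmat \<Rightarrow> rmat \<Rightarrow> rmat" where
  "degree_comp d \<tau> x y =
     (\<Sum>i\<in>{-2, -1}. \<Sum>j\<in>{-2, -1}. grade_proj (i + j + d) (\<tau> (grade_proj i x) (grade_proj j y)))"


section \<open>Cartan connections\<close>

text \<open>A principal \<open>H\<close>-bundle, with local triviality expressed by local sections \<open>s\<close>:
  the inverse of the trivialization \<open>(y, h) \<mapsto> act (s y) h\<close> is \<open>u \<mapsto> (\<pi> u, g u)\<close>.  Maps with
  values in \<open>H\<close> are smooth iff they are smooth as maps into matrices, as \<open>H\<close> is closed.\<close>

definition principal_H_bundle ::
  "('m::{t2_space, second_countable_topology}, real^5) chart set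
    \<Rightarrow> ('q::{t2_space, second_countable_topology}, real^10) chart set
    \<Rightarrow> ('q \<Rightarrow> 'm) \<Rightarrow> ('q \<Rightarrow> rmat \<Rightarrow> 'q) \<Rightarrow> bool" where
  "principal_H_bundle A B \<pi> act \<longleftrightarrow>
     smooth_atlas A \<and> smooth_atlas B \<and> smooth_map_on B A UNIV \<pi> \<and>
     (\<forall>u. act u (mat 1) = u) \<and>
     (\<forall>u. \<forall>h\<in>grp_H. \<forall>k\<in>grp_H. act (act u h) k = act u (h ** k)) \<and>
     continuous_on (UNIV \<times> grp_H) (\<lambda>(u, h). act u h) \<and>
     (\<forall>c\<in>B. \<forall>c'\<in>B.
        smooth_on {(p, h). p \<in> snd c ` fst c \<and> h \<in> grp_H \<and> act (inv_chart c p) h \<in> fst c'}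
          (\<lambda>(p, h). snd c' (act (inv_chart c p) h))) \<and>
     (\<forall>u. \<forall>h\<in>grp_H. act u h = u \<longrightarrow> h = mat 1) \<and>
     (\<forall>u w. \<pi> u = \<pi> w \<longleftrightarrow> (\<exists>h\<in>grp_H. w = act u h)) \<and>
     (\<forall>x. \<exists>N s g. open N \<and> x \<in> N \<and> smooth_map_on A B N s \<and> (\<forall>y\<in>N. \<pi> (s y) = y) \<and>
        smooth_fun_on B (\<pi> -` N) g \<and> (\<forall>u\<in>\<pi> -` N. g u \<in> grp_H \<and> u = act (s (\<pi> u)) (g u)))"

definition cartan_connection ::
  "('m::{t2_space, second_countable_topology}, real^5) chart set
    \<Rightarrow> ('q::{t2_space, second_countable_topology}, real^10) chart set
    \<Rightarrow> ('q \<Rightarrow> 'm) \<Rightarrow> ('q \<Rightarrow> rmat \<Rightarrow> 'q) \<Rightarrow> ('q \<Rightarrow> real^10 \<Rightarrow> rmat) \<Rightarrow> bool" where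
  "cartan_connection A B \<pi> act \<omega> \<longleftrightarrow>
     principal_H_bundle A B \<pi> act \<and> smooth_form_on B UNIV \<omega> \<and>
     (\<forall>u. bij_betw (\<omega> u) UNIV so32) \<and>
     (\<forall>u. \<forall>X\<in>lie_H. \<omega> u (velocity B (\<lambda>t. act u (mexp (t *\<^sub>R X)))) = X) \<and>
     (\<forall>u v. \<forall>h\<in>grp_H.
        \<omega> (act u h) (differential B B (\<lambda>w. act w h) u v) = matrix_inv h ** \<omega> u v ** h)"

text \<open>With the above normalisation \<open>[\<omega>, \<omega>](v, w) = 2 [\<omega> v, \<omega> w]\<close>.\<close>

definition curvature ::
  "('q, real^10) chart set \<Rightarrow> ('q \<Rightarrow> real^10 \<Rightarrow> rmat) \<Rightarrow> 'q \<Rightarrow> real^10 \<Rightarrow> real^10 \<Rightarrow> rmat" where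
  "curvature B \<omega> u v w = ext_d B \<omega> u v w + mbracket (\<omega> u v) (\<omega> u w)"

text \<open>Complex bilinear extension to complex tangent vectors.\<close>

definition curvatureC ::
  "('q, real^10) chart set \<Rightarrow> ('q \<Rightarrow> real^10 \<Rightarrow> rmat)
    \<Rightarrow> 'q \<Rightarrow> (real^10) \<times> (real^10) \<Rightarrow> (real^10) \<times> (real^10) \<Rightarrow> cmat" where
  "curvatureC B \<omega> u V W =
     cmat_of (curvature B \<omega> u (fst V) (fst W) - curvature B \<omega> u (snd V) (snd W))
     + cmat_scale \<i> (cmat_of (curvature B \<omega> u (fst V) (snd W) + curvature B \<omega> u (snd V) (fst W)))"

text \<open>The complex tangent vector at \<open>u\<close> on which (the complexification of) \<open>\<omega>\<close> takes the value
  \<open>Z\<close>.\<close>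

definition frame_vec ::
  "('q \<Rightarrow> real^10 \<Rightarrow> rmat) \<Rightarrow> 'q \<Rightarrow> cmat \<Rightarrow> (real^10) \<times> (real^10)" where
  "frame_vec \<omega> u Z = (inv (\<omega> u) (re_mat Z), inv (\<omega> u) (im_mat Z))"

definition theta_comp :: "('q \<Rightarrow> real^10 \<Rightarrow> rmat) \<Rightarrow> tidx \<Rightarrow> 'q \<Rightarrow> real^10 \<Rightarrow> complex" where
  "theta_comp \<omega> A u v = fst (cr_coords (cmat_of (\<omega> u v))) A"

definition omega_comp :: "('q \<Rightarrow> real^10 \<Rightarrow> rmat) \<Rightarrow> ridx \<Rightarrow> 'q \<Rightarrow> real^10 \<Rightarrow> complex" where
  "omega_comp \<omega> D u v = snd (cr_coords (cmat_of (\<omega> u v))) D"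

text \<open>\<open>T_comp B \<omega> a b c\<close> and \<open>R_comp B \<omega> d b c\<close> have the upper index first.\<close>

definition T_comp ::
  "('q, real^10) chart set \<Rightarrow> ('q \<Rightarrow> real^10 \<Rightarrow> rmat) \<Rightarrow> tidx \<Rightarrow> tidx \<Rightarrow> tidx \<Rightarrow> 'q \<Rightarrow> complex" where
  "T_comp B \<omega> a b c u =
     fst (cr_coords (curvatureC B \<omega> u (frame_vec \<omega> u (eo b)) (frame_vec \<omega> u (eo c)))) a"

definition R_comp ::
  "('q, real^10) chart set \<Rightarrow> ('q \<Rightarrow> real^10 \<Rightarrow> rmat) \<Rightarrow> ridx \<Rightarrow> tidx \<Rightarrow> tidx \<Rightarrow> 'q \<Rightarrow> complex" where
  "R_comp B \<omega> d b c u =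
     snd (cr_coords (curvatureC B \<omega> u (frame_vec \<omega> u (eo b)) (frame_vec \<omega> u (eo c)))) d"

definition vanishing_T :: "(tidx \<times> tidx \<times> tidx) set" where
  "vanishing_T =
     {(a, T0_10, T0_01) | a. a \<in> {Tm2, Tm1_10, Tm1_01}} \<union>
     {(a, b, c) | a b c. a \<in> {Tm2, Tm1_01, T0_01} \<and> b \<in> {Tm1_10, T0_10} \<and> c \<in> {Tm1_10, T0_10}} \<union>
     {(Tm2, Tm1_01, T0_10), (Tm2, Tm1_10, Tm1_01), (Tm1_10, Tm1_01, T0_10),
      (Tm1_10, Tm1_10, T0_10), (Tm1_10, Tm1_10, T0_01), (T0_10, Tm1_01, T0_01),
      (Tm2, Tm2, T0_10), (T0_10, Tm1_10, T0_10), (T0_10, Tm1_10, T0_01)}"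

definition vanishing_R :: "(ridx \<times> tidx \<times> tidx) set" where
  "vanishing_R = {(R0_10, Tm2, T0_10), (R0_10, Tm2, T0_01)}"

definition canonical_cartan_connection ::
  "('m::{t2_space, second_countable_topology}, real^5) chart set
    \<Rightarrow> ('m \<Rightarrow> (real^5) set) \<Rightarrow> ('m \<Rightarrow> real^5 \<Rightarrow> real^5)
    \<Rightarrow> ('q::{t2_space, second_countable_topology}, real^10) chart set
    \<Rightarrow> ('q \<Rightarrow> 'm) \<Rightarrow> ('q \<Rightarrow> rmat \<Rightarrow> 'q) \<Rightarrow> ('q \<Rightarrow> real^10 \<Rightarrow> rmat) \<Rightarrow> bool" where
  "canonical_cartan_connection A D J B \<pi> act \<omega> \<longleftrightarrow>
     cartan_connection A B \<pi> act \<omega> \<and>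
     (\<forall>u. let push = map_prod (differential B A \<pi> u) (differential B A \<pi> u);
              e = (\<lambda>a. frame_vec \<omega> u (eo a)) in
        bij_betw push (cspan2 (e Tm1_10) (e T0_10)) (D10 D J (\<pi> u)) \<and>
        bij_betw push (cspan2 (e T0_10) (e T0_10)) (E10 A D J (\<pi> u)) \<and>
        bij_betw push (cspan2 (e Tm1_01) (e T0_01)) (D01 D J (\<pi> u)) \<and>
        bij_betw push (cspan2 (e T0_01) (e T0_01)) (E01 A D J (\<pi> u))) \<and>
     (\<forall>(a, b, c)\<in>vanishing_T. \<forall>u.
        T_comp B \<omega> a b c u = 0 \<and> T_comp B \<omega> (tbar a) (tbar b) (tbar c) u = 0) \<and>
     (\<forall>(d, b, c)\<in>vanishing_R. \<forall>u.
        R_comp B \<omega> d b c u = 0 \<and> R_comp B \<omega> (rbar d) (tbar b) (tbar c) u = 0) \<and>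
     (\<forall>u. \<forall>d\<in>{1, 2, 3}.
        in_ker_codiff (degree_comp d (\<lambda>x y. curvature B \<omega> u (inv (\<omega> u) x) (inv (\<omega> u) y))))"

end

theory Submission
  imports Defs
begin

text \<open>Differentiating the equivariance of the connection form along \<open>t \<mapsto> exp (t X)\<close>, \<open>X\<close> in the Lie
  algebra of \<open>H\<close>, shows that the curvature is horizontal; hence \<open>d\<theta>\<close> and \<open>d\<omega>\<close> are given by the bracket
  and the ten components of the curvature.  Testing the condition on the codifferential against the maps
  \<open>A\<close> of rank one turns it into linear equations: in degree 1 they annihilate all components, in degree
  3 they are equivalent to the two relations between curvature components.  In degree 2 they leave a
  one-dimensional space, which is annihilated by the identity \<open>d (d \<theta>) = 0\<close> for the \<open>-2\<close> component
  \<open>\<theta>\<close>, whose structure equation only needs the degree 1 step.\<close>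

section \<open>Smooth functions on open sets\<close>

text \<open>Two obstacles shape the proof. Tangent spaces are read in a chart selected anew at each
  point, so the values of \<open>ext_d\<close> at neighbouring points refer to different charts. To
  differentiate the structure equation of \<theta> once more, the exterior derivative must first be
  shown natural under chart transitions, which rests on the symmetry of second derivatives.
  Moreover, the action is smooth only in the sense of local extensions, because \<open>grp_H\<close>
  has no interior among the matrices. Such an extension to an open set of pairs makes the mixed
  second derivative in the point and the group direction available, and its symmetry turns
  equivariance into a bracket.

  The codifferential is needed for the components whose two lower indices are -2 and -1, or -1(10)
  and -1(01): of these, the list of vanishing components settles only the one with upper index -2 on
  the latter pair.\<close>

lemma frechet_derivative_cong_open:
  assumes "open U" "x \<in> U" "\<And>y. y \<in> U \<Longrightarrow> f y = g y"
  shows "frechet_derivative f (at x) = frechet_derivative g (at x)"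
proof -
  have "(f has_derivative D) (at x) \<longleftrightarrow> (g has_derivative D) (at x)" for D
    using has_derivative_transform_within_open[of f D x UNIV U g]
      has_derivative_transform_within_open[of g D x UNIV U f] assms by auto
  then show ?thesis by (simp add: frechet_derivative_def)
qed

lemma differentiable_cong_open:
  assumes "f differentiable at x" "open U" "x \<in> U" "\<And>y. y \<in> U \<Longrightarrow> f y = g y"
  shows "g differentiable at x"
  using assms has_derivative_transform_within_open[of f _ x UNIV U g]
  by (auto simp: differentiable_def)

lemma smooth_on_differentiable:
  assumes "open S" "smooth_on S f" "x \<in> S"
  shows "f differentiable at x"
proof -
  obtain W g where W: "open W" "x \<in> W" "\<And>k. Ck_on k g W" "\<And>q. q \<in> S \<inter> W \<Longrightarrow> g q = f q"
    using assms unfolding smooth_on_def by meson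
  have "g differentiable at x" using W(3)[of 1] W(2) by simp
  then show ?thesis
    by (rule differentiable_cong_open[of _ _ "S \<inter> W"]) (use assms W in auto)
qed

lemma smooth_on_has_derivative:
  assumes "open S" "smooth_on S f" "x \<in> S"
  shows "(f has_derivative frechet_derivative f (at x)) (at x)"
  using smooth_on_differentiable[OF assms] frechet_derivative_works by blast

text \<open>Openness of \<open>S\<close> makes a local extension \<open>g\<close> agree with
  \<open>f\<close> near each point of \<open>S \<inter> W\<close>, so their derivatives agree there;
  that \<open>g\<close> is of every order \<open>Ck_on\<close> passes to its directional derivatives
  by the recursion.\<close>

lemma smooth_on_frechet_derivative:
  assumes "open S" "smooth_on S f"
  shows "smooth_on S (\<lambda>x. frechet_derivative f (at x) v)"
  unfolding smooth_on_def
proof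
  fix p assume "p \<in> S"
  then obtain W g where W: "open W" "p \<in> W" "\<forall>k. Ck_on k g W" "\<forall>q\<in>S \<inter> W. g q = f q"
    using assms unfolding smooth_on_def by meson
  have "\<forall>k. Ck_on k (\<lambda>x. frechet_derivative g (at x) v) W"
    using W(3) Ck_on.simps(2) by blast
  moreover have "frechet_derivative g (at q) v = frechet_derivative f (at q) v" if "q \<in> S \<inter> W" for q
    using frechet_derivative_cong_open[OF open_Int[OF assms(1) W(1)] that, of g f] W(4) by simp
  ultimately show "\<exists>W g. open W \<and> p \<in> W \<and> (\<forall>k. Ck_on k g W) \<and>
      (\<forall>q\<in>S \<inter> W. g q = frechet_derivative f (at q) v)"
    using W by blast
qed

section \<open>Symmetry of second derivatives\<close>

lemma smooth_on_continuous_on: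
  assumes "open S" "smooth_on S f"
  shows "continuous_on S f"
  using smooth_on_differentiable[OF assms]
  by (simp add: continuous_on_eq_continuous_at[OF assms(1)] differentiable_imp_continuous_within)

text \<open>The mean value theorem is applied twice: along v to the difference of f over two
  parallel segments, then along w to the directional derivative in v. The left-hand side is
  symmetric in v and w while the right-hand side differentiates along v before w, and this is the
  source of the symmetry below.\<close>

lemma second_difference_mvt:
  fixes f :: "'a::real_normed_vector \<Rightarrow> real"
  assumes S: "\<And>s t. \<bar>s\<bar> \<le> h \<Longrightarrow> \<bar>t\<bar> \<le> h \<Longrightarrow> x + s *\<^sub>R v + t *\<^sub>R w \<in> S" and h: "0 < h"
    and f: "\<And>y. y \<in> S \<Longrightarrow> (f has_derivative f' y) (at y)"
    and f': "\<And>y. y \<in> S \<Longrightarrow> ((\<lambda>z. f' z v) has_derivative f'' y) (at y)"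
  shows "\<exists>s t. 0 \<le> s \<and> s \<le> h \<and> 0 \<le> t \<and> t \<le> h \<and>
    f (x + h *\<^sub>R v + h *\<^sub>R w) - f (x + h *\<^sub>R v) - f (x + h *\<^sub>R w) + f x
      = h * h * f'' (x + s *\<^sub>R v + t *\<^sub>R w) w"
proof -
  define g where "g s = f (x + s *\<^sub>R v + h *\<^sub>R w) - f (x + s *\<^sub>R v)" for s
  have line1: "((\<lambda>s. f (x + s *\<^sub>R v + t *\<^sub>R w)) has_derivative (\<lambda>r. f' (x + s *\<^sub>R v + t *\<^sub>R w) (r *\<^sub>R v))) (at s)"
    if "\<bar>s\<bar> \<le> h" "\<bar>t\<bar> \<le> h" for s t
    by (rule has_derivative_compose[of "\<lambda>s. x + s *\<^sub>R v + t *\<^sub>R w"]) (auto intro!: derivative_eq_intros f S that)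
  have lin1: "f' y (r *\<^sub>R z) = r * f' y z" if "y \<in> S" for y r z
    using linear_cmul[OF has_derivative_linear[OF f[OF that]]] by simp
  have lin2: "f'' y (r *\<^sub>R z) = r * f'' y z" if "y \<in> S" for y r z
    using linear_cmul[OF has_derivative_linear[OF f'[OF that]]] by simp
  have D1: "((\<lambda>s. f (x + s *\<^sub>R v + t *\<^sub>R w)) has_real_derivative f' (x + s *\<^sub>R v + t *\<^sub>R w) v) (at s)"
    if "\<bar>s\<bar> \<le> h" "\<bar>t\<bar> \<le> h" for s t
    using line1[OF that] lin1[OF S[OF that]]
    by (simp add: has_field_derivative_def mult.commute[of _ "f' _ v"])
  have "\<exists>s>0. s < h \<and> g h - g 0 = (h - 0) * (f' (x + s *\<^sub>R v + h *\<^sub>R w) v - f' (x + s *\<^sub>R v) v)"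
    unfolding g_def
    using D1[of _ h] D1[of _ 0] h by (intro MVT2) (auto intro!: DERIV_diff)
  then obtain s where s: "0 < s" "s < h"
    "g h - g 0 = h * (f' (x + s *\<^sub>R v + h *\<^sub>R w) v - f' (x + s *\<^sub>R v) v)" by auto
  have line2: "((\<lambda>t. f' (x + s *\<^sub>R v + t *\<^sub>R w) v) has_derivative (\<lambda>r. f'' (x + s *\<^sub>R v + t *\<^sub>R w) (r *\<^sub>R w))) (at t)"
    if "\<bar>t\<bar> \<le> h" for t
    by (rule has_derivative_compose[of "\<lambda>t. x + s *\<^sub>R v + t *\<^sub>R w" _ _ _ "\<lambda>z. f' z v"])
      (use s in \<open>auto intro!: derivative_eq_intros f' S that\<close>)
  have D2: "((\<lambda>t. f' (x + s *\<^sub>R v + t *\<^sub>R w) v) has_real_derivative f'' (x + s *\<^sub>R v + t *\<^sub>R w) w) (at t)"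
    if "\<bar>t\<bar> \<le> h" for t
    using line2[OF that] lin2[OF S[of s t]] s that
    by (simp add: has_field_derivative_def mult.commute[of _ "f'' _ w"])
  have "\<exists>t>0. t < h \<and> f' (x + s *\<^sub>R v + h *\<^sub>R w) v - f' (x + s *\<^sub>R v + 0 *\<^sub>R w) v
      = (h - 0) * f'' (x + s *\<^sub>R v + t *\<^sub>R w) w"
    using D2 h by (intro MVT2) auto
  then obtain t where t: "0 < t" "t < h"
    "f' (x + s *\<^sub>R v + h *\<^sub>R w) v - f' (x + s *\<^sub>R v) v = h * f'' (x + s *\<^sub>R v + t *\<^sub>R w) w" by auto
  have "g h - g 0 = h * h * f'' (x + s *\<^sub>R v + t *\<^sub>R w) w" using s(3) t(3) by simp
  then show ?thesis using s t unfolding g_def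
    by (intro exI[of _ s] exI[of _ t]) (auto simp: algebra_simps)
qed

text \<open>Writing the second difference in both orders gives two intermediate points at which the
  mixed derivatives take the same value. Both points lie close to x, so continuity at x contradicts
  a gap between the two values there; half the gap serves as tolerance.\<close>

lemma symmetric_second_derivative_real:
  fixes f :: "'a::real_normed_vector \<Rightarrow> real"
  assumes S: "open S" "x \<in> S"
    and f: "\<And>y. y \<in> S \<Longrightarrow> (f has_derivative f' y) (at y)"
    and fv: "\<And>y. y \<in> S \<Longrightarrow> ((\<lambda>z. f' z v) has_derivative fv y) (at y)"
    and fw: "\<And>y. y \<in> S \<Longrightarrow> ((\<lambda>z. f' z w) has_derivative fw y) (at y)"
    and cont: "isCont (\<lambda>y. fv y w) x" "isCont (\<lambda>y. fw y v) x"
  shows "fv x w = fw x v"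
proof (rule ccontr)
  assume ne: "fv x w \<noteq> fw x v"
  define e where "e = \<bar>fv x w - fw x v\<bar> / 2"
  have e: "e > 0" using ne by (simp add: e_def)
  obtain d1 where d1: "d1 > 0" "\<And>y. dist y x < d1 \<Longrightarrow> dist (fv y w) (fv x w) < e"
    using cont(1) e unfolding continuous_at_eps_delta by (metis dist_norm real_norm_def)
  obtain d2 where d2: "d2 > 0" "\<And>y. dist y x < d2 \<Longrightarrow> dist (fw y v) (fw x v) < e"
    using cont(2) e unfolding continuous_at_eps_delta by (metis dist_norm real_norm_def)
  obtain d3 where d3: "d3 > 0" "\<And>y. dist y x < d3 \<Longrightarrow> y \<in> S"
    using S by (auto simp: open_dist)
  define d where "d = min d1 (min d2 d3)"
  have d: "d > 0" using d1 d2 d3 by (simp add: d_def)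
  \<comment> \<open>The parallelogram of the points with |s|, |t| \<le> h then lies in the ball of
    radius d; the summand 1 keeps the quotient meaningful for v = w = 0 and makes the bound
    strict.\<close>
  define h where "h = d / (norm v + norm w + 1)"
  have np: "norm v + norm w + 1 > 0" using norm_ge_zero[of v] norm_ge_zero[of w] by linarith
  have h: "h > 0" using d np by (simp add: h_def)
  have hd: "h * (norm v + norm w) < d"
  proof -
    have "h * (norm v + norm w + 1) = d" using np by (simp add: h_def)
    then show ?thesis using h by (simp add: algebra_simps)
  qed
  have near: "dist (x + s *\<^sub>R v + t *\<^sub>R w) x < d" if "\<bar>s\<bar> \<le> h" "\<bar>t\<bar> \<le> h" for s t
  proof -
    have "dist (x + s *\<^sub>R v + t *\<^sub>R w) x = norm (s *\<^sub>R v + t *\<^sub>R w)" by (simp add: dist_norm)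
    also have "\<dots> \<le> \<bar>s\<bar> * norm v + \<bar>t\<bar> * norm w" by (metis norm_scaleR norm_triangle_ineq)
    also have "\<dots> \<le> h * norm v + h * norm w"
      using that by (intro add_mono mult_right_mono) auto
    finally show ?thesis using hd by (simp add: algebra_simps)
  qed
  have inS: "x + s *\<^sub>R v + t *\<^sub>R w \<in> S" if "\<bar>s\<bar> \<le> h" "\<bar>t\<bar> \<le> h" for s t
    using near[OF that] d3(2) by (auto simp: d_def)
  obtain s t where st: "0 \<le> s" "s \<le> h" "0 \<le> t" "t \<le> h"
    "f (x + h *\<^sub>R v + h *\<^sub>R w) - f (x + h *\<^sub>R v) - f (x + h *\<^sub>R w) + f x
      = h * h * fv (x + s *\<^sub>R v + t *\<^sub>R w) w"
    using second_difference_mvt[of h x v w S f f' fv, OF inS h f fv] by auto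
  have inS': "x + s *\<^sub>R w + t *\<^sub>R v \<in> S" if "\<bar>s\<bar> \<le> h" "\<bar>t\<bar> \<le> h" for s t
    using inS[OF that(2,1)] by (simp add: algebra_simps)
  obtain t' s' where st': "0 \<le> t'" "t' \<le> h" "0 \<le> s'" "s' \<le> h"
    "f (x + h *\<^sub>R w + h *\<^sub>R v) - f (x + h *\<^sub>R w) - f (x + h *\<^sub>R v) + f x
      = h * h * fw (x + t' *\<^sub>R w + s' *\<^sub>R v) v"
    using second_difference_mvt[of h x w v S f f' fw, OF inS' h f fw] by auto
  have "h * h * fv (x + s *\<^sub>R v + t *\<^sub>R w) w = h * h * fw (x + s' *\<^sub>R v + t' *\<^sub>R w) v"
    using st(5) st'(5) by (simp add: algebra_simps)
  then have eq: "fv (x + s *\<^sub>R v + t *\<^sub>R w) w = fw (x + s' *\<^sub>R v + t' *\<^sub>R w) v" using h by simp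
  have "dist (fv (x + s *\<^sub>R v + t *\<^sub>R w) w) (fv x w) < e"
    using near[of s t] st d1(2) by (auto simp: d_def)
  moreover have "dist (fw (x + s' *\<^sub>R v + t' *\<^sub>R w) v) (fw x v) < e"
    using near[of s' t'] st' d2(2) by (auto simp: d_def)
  ultimately have "dist (fv x w) (fw x v) < e + e"
    using dist_triangle3[of "fv x w" "fw x v" "fv (x + s *\<^sub>R v + t *\<^sub>R w) w"] unfolding eq by linarith
  then show False by (simp add: e_def dist_real_def)
qed

lemma smooth_on_symmetric_second_derivative:
  fixes f :: "'a::euclidean_space \<Rightarrow> 'b::euclidean_space"
  assumes S: "open S" "x \<in> S" and f: "smooth_on S f"
  shows "frechet_derivative (\<lambda>y. frechet_derivative f (at y) v) (at x) w =
    frechet_derivative (\<lambda>y. frechet_derivative f (at y) w) (at x) v"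
proof (rule euclidean_eqI)
  fix b :: 'b
  have D: "((\<lambda>y. frechet_derivative f (at y) v) has_derivative
      frechet_derivative (\<lambda>y. frechet_derivative f (at y) v) (at y)) (at y)" if "y \<in> S" for y v
    by (rule smooth_on_has_derivative[OF S(1) smooth_on_frechet_derivative[OF S(1) f] that])
  have C: "isCont (\<lambda>y. frechet_derivative (\<lambda>y. frechet_derivative f (at y) v) (at y) w \<bullet> b) x" for v w
    using smooth_on_continuous_on[OF S(1) smooth_on_frechet_derivative[OF S(1)
        smooth_on_frechet_derivative[OF S(1) f]]] S
    by (auto simp: continuous_on_eq_continuous_at intro!: continuous_intros)
  show "frechet_derivative (\<lambda>y. frechet_derivative f (at y) v) (at x) w \<bullet> b =
    frechet_derivative (\<lambda>y. frechet_derivative f (at y) w) (at x) v \<bullet> b"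
    by (rule symmetric_second_derivative_real[OF S, where f = "\<lambda>y. f y \<bullet> b"
          and f' = "\<lambda>y v. frechet_derivative f (at y) v \<bullet> b" and v = v and w = w
          and fv = "\<lambda>y w. frechet_derivative (\<lambda>y. frechet_derivative f (at y) v) (at y) w \<bullet> b"
          and fw = "\<lambda>y u. frechet_derivative (\<lambda>y. frechet_derivative f (at y) w) (at y) u \<bullet> b"])
      (auto intro!: has_derivative_inner_left D C smooth_on_has_derivative[OF S(1) f])
qed

text \<open>A product rule for a form evaluated on a moving vector at a moving point.
  Differentiability of \<open>F\<close> in the base point is given only for each fixed vector, but
  linearity of the fibres allows an expansion in the basis, so only the finitely many functions
  \<open>F y b\<close> have to be differentiated. It serves for pull-backs along transition maps and
  along the action.\<close>

lemma has_derivative_fibrewise_linear: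
  fixes F :: "'a::euclidean_space \<Rightarrow> 'b::euclidean_space \<Rightarrow> 'c::real_normed_vector"
    and \<psi> :: "'d::real_normed_vector \<Rightarrow> 'a"
  assumes N: "open N" "\<psi> x \<in> N" "\<And>y. y \<in> N \<Longrightarrow> linear (F y)"
    and F: "\<And>v. ((\<lambda>y. F y v) has_derivative F' v) (at (\<psi> x))"
    and \<psi>: "(\<psi> has_derivative \<psi>') (at x)" and \<nu>: "(\<nu> has_derivative \<nu>') (at x)"
  shows "((\<lambda>z. F (\<psi> z) (\<nu> z)) has_derivative (\<lambda>h. F' (\<nu> x) (\<psi>' h) + F (\<psi> x) (\<nu>' h))) (at x)"
proof -
  have expand: "F y v = (\<Sum>b\<in>Basis. (v \<bullet> b) *\<^sub>R F y b)" if "y \<in> N" for y v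
  proof -
    have "F y v = F y (\<Sum>b\<in>Basis. (v \<bullet> b) *\<^sub>R b)" by (simp add: euclidean_representation)
    also have "\<dots> = (\<Sum>b\<in>Basis. (v \<bullet> b) *\<^sub>R F y b)"
      using N(3)[OF that] by (simp add: linear_sum linear_cmul)
    finally show ?thesis .
  qed
  \<comment> \<open>The derivatives are given for each v separately; that they depend linearly on v
    follows from uniqueness.\<close>
  have F'sum: "F' v = (\<lambda>h. \<Sum>b\<in>Basis. (v \<bullet> b) *\<^sub>R F' b h)" for v
  proof (rule has_derivative_unique[OF F])
    have "((\<lambda>y. \<Sum>b\<in>Basis. (v \<bullet> b) *\<^sub>R F y b) has_derivative
      (\<lambda>h. \<Sum>b\<in>Basis. (v \<bullet> b) *\<^sub>R F' b h)) (at (\<psi> x))"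
      by (auto intro!: derivative_eq_intros F)
    then show "((\<lambda>y. F y v) has_derivative (\<lambda>h. \<Sum>b\<in>Basis. (v \<bullet> b) *\<^sub>R F' b h)) (at (\<psi> x))"
      by (rule has_derivative_transform_within_open[OF _ N(1,2)]) (rule expand[symmetric])
  qed
  have F\<psi>: "((\<lambda>z. F (\<psi> z) b) has_derivative (\<lambda>h. F' b (\<psi>' h))) (at x)" for b
    by (rule has_derivative_compose[OF \<psi> F])
  have "((\<lambda>z. \<Sum>b\<in>Basis. (\<nu> z \<bullet> b) *\<^sub>R F (\<psi> z) b) has_derivative
      (\<lambda>h. \<Sum>b\<in>Basis. (\<nu> x \<bullet> b) *\<^sub>R F' b (\<psi>' h) + (\<nu>' h \<bullet> b) *\<^sub>R F (\<psi> x) b)) (at x)"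
    by (intro has_derivative_sum has_derivative_scaleR has_derivative_inner_left \<nu> F\<psi>)
  also have "(\<lambda>h. \<Sum>b\<in>Basis. (\<nu> x \<bullet> b) *\<^sub>R F' b (\<psi>' h) + (\<nu>' h \<bullet> b) *\<^sub>R F (\<psi> x) b)
      = (\<lambda>h. F' (\<nu> x) (\<psi>' h) + F (\<psi> x) (\<nu>' h))"
    by (simp add: sum.distrib F'sum[of "\<nu> x"] expand[OF N(2), symmetric])
  finally have D: "((\<lambda>z. \<Sum>b\<in>Basis. (\<nu> z \<bullet> b) *\<^sub>R F (\<psi> z) b) has_derivative
      (\<lambda>h. F' (\<nu> x) (\<psi>' h) + F (\<psi> x) (\<nu>' h))) (at x)" .
  have "isCont \<psi> x" using \<psi> has_derivative_continuous by blast
  then obtain U where U: "open U" "x \<in> U" "\<And>z. z \<in> U \<Longrightarrow> \<psi> z \<in> N"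
    using continuous_at_open[THEN iffD1, rule_format, of x \<psi> N] N(1,2) by auto
  show ?thesis
    by (rule has_derivative_transform_within_open[OF D U(1,2)]) (rule expand[OF U(3), symmetric])
qed

section \<open>Forms in charts\<close>

lemma smooth_atlas_chartD:
  assumes "smooth_atlas A" "c \<in> A"
  shows "open (fst c)" "open (snd c ` fst c)"
    "homeomorphism (fst c) (snd c ` fst c) (snd c) (inv_chart c)"
  using assms unfolding smooth_atlas_def by auto

lemma inv_chart_chart:
  assumes "smooth_atlas A" "c \<in> A" "x \<in> fst c"
  shows "inv_chart c (snd c x) = x"
  using smooth_atlas_chartD(3)[OF assms(1,2)] assms(3) by (simp add: homeomorphism_apply1)

lemma chart_inv_chart:
  assumes "smooth_atlas A" "c \<in> A" "p \<in> snd c ` fst c"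
  shows "snd c (inv_chart c p) = p" "inv_chart c p \<in> fst c"
  using smooth_atlas_chartD(3)[OF assms(1,2)] assms(3) by (auto simp: homeomorphism_def)

lemma chart_at_in_atlas:
  assumes "smooth_atlas A"
  shows "chart_at A x \<in> A" "x \<in> fst (chart_at A x)"
proof -
  have "\<exists>c. c \<in> A \<and> x \<in> fst c" using assms unfolding smooth_atlas_def by blast
  then have "chart_at A x \<in> A \<and> x \<in> fst (chart_at A x)"
    unfolding chart_at_def by (rule someI_ex)
  then show "chart_at A x \<in> A" "x \<in> fst (chart_at A x)" by auto
qed

lemma open_chart_image:
  assumes A: "smooth_atlas A" "c \<in> A" and V: "open V"
  shows "open (snd c ` (fst c \<inter> V))"
proof -
  have "snd c ` (fst c \<inter> V) = snd c ` fst c \<inter> inv_chart c -` V"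
    using chart_inv_chart[OF A] inv_chart_chart[OF A] by (auto simp: image_iff)
  moreover have "continuous_on (snd c ` fst c) (inv_chart c)"
    using smooth_atlas_chartD(3)[OF A] homeomorphism_cont2 by blast
  ultimately show ?thesis
    using smooth_atlas_chartD(2)[OF A] V by (metis continuous_open_preimage)
qed

lemma smooth_on_transition:
  assumes "smooth_atlas A" "c \<in> A" "c' \<in> A"
  shows "smooth_on (snd c ` (fst c \<inter> fst c')) (snd c' \<circ> inv_chart c)"
  using assms unfolding smooth_atlas_def by blast

lemma open_transition_domain:
  assumes "smooth_atlas A" "c \<in> A" "c' \<in> A"
  shows "open (snd c ` (fst c \<inter> fst c'))"
  using open_chart_image[OF assms(1,2)] smooth_atlas_chartD(1)[OF assms(1,3)] by blast

lemma transition_has_derivative: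
  assumes "smooth_atlas A" "c \<in> A" "c' \<in> A" "p \<in> snd c ` (fst c \<inter> fst c')"
  shows "(snd c' \<circ> inv_chart c has_derivative frechet_derivative (snd c' \<circ> inv_chart c) (at p)) (at p)"
  by (rule smooth_on_has_derivative[OF open_transition_domain smooth_on_transition]) (use assms in auto)

lemma from_coord_has_derivative:
  assumes A: "smooth_atlas A" "c \<in> A" and x: "x \<in> fst c"
  shows "(snd (chart_at A x) \<circ> inv_chart c has_derivative from_coord A c x) (at (snd c x))"
  unfolding from_coord_def
  by (rule transition_has_derivative[OF A]) (use x chart_at_in_atlas[OF A(1)] in auto)

lemma linear_from_coord:
  assumes "smooth_atlas A" "c \<in> A" "x \<in> fst c"
  shows "linear (from_coord A c x)"
  using from_coord_has_derivative[OF assms] has_derivative_linear by blast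

lemma from_coord_chart_at:
  assumes A: "smooth_atlas A"
  shows "from_coord A (chart_at A x) x v = v"
proof -
  let ?c = "chart_at A x"
  note c = chart_at_in_atlas[OF A, of x]
  have "frechet_derivative (snd ?c \<circ> inv_chart ?c) (at (snd ?c x)) = frechet_derivative id (at (snd ?c x))"
    by (rule frechet_derivative_cong_open[OF smooth_atlas_chartD(2)[OF A c(1)]])
      (use c chart_inv_chart[OF A c(1)] in auto)
  then show ?thesis by (simp add: from_coord_def)
qed

lemma transition_compose:
  assumes A: "smooth_atlas A" "c \<in> A" "c' \<in> A" and p: "p \<in> snd c ` (fst c \<inter> fst c')"
  shows "inv_chart c' ((snd c' \<circ> inv_chart c) p) = inv_chart c p"
    "(snd c' \<circ> inv_chart c) p \<in> snd c' ` fst c'"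
proof -
  obtain x where x: "x \<in> fst c" "x \<in> fst c'" "p = snd c x" using p by auto
  then have "inv_chart c p = x" using inv_chart_chart[OF A(1,2)] by simp
  then show "inv_chart c' ((snd c' \<circ> inv_chart c) p) = inv_chart c p"
    "(snd c' \<circ> inv_chart c) p \<in> snd c' ` fst c'"
    using x inv_chart_chart[OF A(1,3)] by auto
qed

lemma from_coord_transition:
  assumes A: "smooth_atlas A" "c \<in> A" "c' \<in> A" and x: "x \<in> fst c" "x \<in> fst c'"
  shows "from_coord A c x v =
    from_coord A c' x (frechet_derivative (snd c' \<circ> inv_chart c) (at (snd c x)) v)"
proof -
  let ?k = "snd (chart_at A x)" and ?\<tau> = "snd c' \<circ> inv_chart c"
  have x': "?\<tau> (snd c x) = snd c' x" using inv_chart_chart[OF A(1,2) x(1)] by simp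
  have k: "(?k \<circ> inv_chart c' has_derivative from_coord A c' x) (at (?\<tau> (snd c x)))"
    unfolding x' by (rule from_coord_has_derivative[OF A(1,3) x(2)])
  have "((\<lambda>p. (?k \<circ> inv_chart c') (?\<tau> p)) has_derivative
      (\<lambda>v. from_coord A c' x (frechet_derivative ?\<tau> (at (snd c x)) v))) (at (snd c x))"
    by (rule has_derivative_compose[OF transition_has_derivative[OF A] k]) (use x in auto)
  then have "(?k \<circ> inv_chart c has_derivative
      (\<lambda>v. from_coord A c' x (frechet_derivative ?\<tau> (at (snd c x)) v))) (at (snd c x))"
    by (rule has_derivative_transform_within_open[OF _ open_transition_domain[OF A]])
      (use x transition_compose(1)[OF A] in auto)
  from has_derivative_unique[OF this from_coord_has_derivative[OF A(1,2) x(1)]]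
  show ?thesis by metis
qed

lemma linear_form_rep:
  assumes A: "smooth_atlas A" "c \<in> A" and p: "p \<in> snd c ` fst c"
    and lin: "linear (\<theta> (inv_chart c p))"
  shows "linear (form_rep A c \<theta> p)"
  using linear_compose[OF linear_from_coord[OF A chart_inv_chart(2)[OF A p]] lin]
  by (simp add: form_rep_def[abs_def] comp_def)

lemma form_rep_transition:
  assumes A: "smooth_atlas A" "c \<in> A" "c' \<in> A" and p: "p \<in> snd c ` (fst c \<inter> fst c')"
  shows "form_rep A c \<theta> p v = form_rep A c' \<theta> ((snd c' \<circ> inv_chart c) p)
    (frechet_derivative (snd c' \<circ> inv_chart c) (at p) v)"
proof -
  obtain x where x: "x \<in> fst c" "x \<in> fst c'" "p = snd c x" using p by auto
  then show ?thesis
    using from_coord_transition[OF A x(1,2), of v] transition_compose(1)[OF A p]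
      inv_chart_chart[OF A(1,2) x(1)]
    by (simp add: form_rep_def)
qed

lemma form_rep_chart_at:
  assumes A: "smooth_atlas A"
  shows "form_rep A (chart_at A x) \<theta> (snd (chart_at A x) x) v = \<theta> x v"
  using chart_at_in_atlas[OF A, of x]
  by (simp add: form_rep_def inv_chart_chart[OF A] from_coord_chart_at[OF A])

lemma smooth_on_form_rep:
  assumes "smooth_form_on A UNIV \<theta>" "c \<in> A"
  shows "smooth_on (snd c ` fst c) (\<lambda>p. form_rep A c \<theta> p v)"
  using assms unfolding smooth_form_on_def by auto

lemma form_rep_has_derivative:
  assumes "smooth_atlas A" "c \<in> A" "smooth_form_on A UNIV \<theta>" "p \<in> snd c ` fst c"
  shows "((\<lambda>q. form_rep A c \<theta> q v) has_derivative
    frechet_derivative (\<lambda>q. form_rep A c \<theta> q v) (at p)) (at p)"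
  by (rule smooth_on_has_derivative[OF smooth_atlas_chartD(2) smooth_on_form_rep]) (use assms in auto)

section \<open>Naturality of the exterior derivative, and d d = 0\<close>

definition chart_d where
  "chart_d A c \<theta> p v w = frechet_derivative (\<lambda>q. form_rep A c \<theta> q w) (at p) v
    - frechet_derivative (\<lambda>q. form_rep A c \<theta> q v) (at p) w"

lemma ext_d_eq_chart_d:
  "ext_d A \<theta> x v w = chart_d A (chart_at A x) \<theta> (snd (chart_at A x) x) v w"
  by (simp add: ext_d_def chart_d_def Let_def)

text \<open>Differentiating \<open>form_rep_transition\<close> produces, besides the expected term,
  the form evaluated on the second derivative of the transition map. This is symmetric in v and w
  and cancels in the antisymmetrisation.\<close>

lemma chart_d_transition:
  fixes A :: "('m::{t2_space, second_countable_topology}, 'e::euclidean_space) chart set"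
    and \<theta> :: "'m \<Rightarrow> 'e \<Rightarrow> 'b::euclidean_space"
  assumes A: "smooth_atlas A" "c \<in> A" "c' \<in> A" and p: "p \<in> snd c ` (fst c \<inter> fst c')"
    and \<theta>: "smooth_form_on A UNIV \<theta>"
  defines "\<tau> \<equiv> snd c' \<circ> inv_chart c"
  shows "chart_d A c \<theta> p v w = chart_d A c' \<theta> (\<tau> p)
    (frechet_derivative \<tau> (at p) v) (frechet_derivative \<tau> (at p) w)"
proof -
  let ?S = "snd c ` (fst c \<inter> fst c')"
  note S = open_transition_domain[OF A]
  have \<tau>p: "\<tau> p \<in> snd c' ` fst c'" unfolding \<tau>_def by (rule transition_compose(2)[OF A p])
  have \<tau>: "smooth_on ?S \<tau>" unfolding \<tau>_def by (rule smooth_on_transition[OF A])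
  define D2 where "D2 v w = frechet_derivative (\<lambda>q. frechet_derivative \<tau> (at q) v) (at p) w" for v w
  have D: "frechet_derivative (\<lambda>q. form_rep A c \<theta> q v) (at p) w =
      frechet_derivative (\<lambda>q. form_rep A c' \<theta> q (frechet_derivative \<tau> (at p) v)) (at (\<tau> p))
        (frechet_derivative \<tau> (at p) w) + form_rep A c' \<theta> (\<tau> p) (D2 v w)" for v w
  proof -
    have "((\<lambda>q. form_rep A c' \<theta> (\<tau> q) (frechet_derivative \<tau> (at q) v)) has_derivative
      (\<lambda>h. frechet_derivative (\<lambda>q. form_rep A c' \<theta> q (frechet_derivative \<tau> (at p) v)) (at (\<tau> p))
        (frechet_derivative \<tau> (at p) h) + form_rep A c' \<theta> (\<tau> p) (D2 v h))) (at p)"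
      unfolding D2_def
    proof (rule has_derivative_fibrewise_linear[where F = "form_rep A c' \<theta>" and \<psi> = \<tau>
          and \<nu> = "\<lambda>q. frechet_derivative \<tau> (at q) v", OF smooth_atlas_chartD(2)[OF A(1,3)] \<tau>p])
      show "linear (form_rep A c' \<theta> y)" if "y \<in> snd c' ` fst c'" for y
        by (rule linear_form_rep[OF A(1,3) that]) (use \<theta> in \<open>simp add: smooth_form_on_def\<close>)
      show "((\<lambda>y. form_rep A c' \<theta> y v) has_derivative
          frechet_derivative (\<lambda>q. form_rep A c' \<theta> q v) (at (\<tau> p))) (at (\<tau> p))" for v
        by (rule form_rep_has_derivative[OF A(1,3) \<theta> \<tau>p])
    qed (auto intro!: smooth_on_has_derivative[OF S _ p] smooth_on_frechet_derivative[OF S] \<tau>)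
    then have "((\<lambda>q. form_rep A c \<theta> q v) has_derivative
      (\<lambda>h. frechet_derivative (\<lambda>q. form_rep A c' \<theta> q (frechet_derivative \<tau> (at p) v)) (at (\<tau> p))
        (frechet_derivative \<tau> (at p) h) + form_rep A c' \<theta> (\<tau> p) (D2 v h))) (at p)"
      by (rule has_derivative_transform_within_open[OF _ S p])
        (simp add: form_rep_transition[OF A] \<tau>_def)
    from frechet_derivative_at[OF this] show ?thesis by metis
  qed
  have "D2 v w = D2 w v" unfolding D2_def
    by (rule smooth_on_symmetric_second_derivative[OF S p \<tau>])
  then show ?thesis unfolding chart_d_def D by simp
qed

text \<open>In one fixed chart this identifies \<open>ext_d\<close> at all points of the chart
  domain with a function of the coordinates, which can then be differentiated.\<close>

lemma chart_d_eq_ext_d: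
  fixes A :: "('m::{t2_space, second_countable_topology}, 'e::euclidean_space) chart set"
    and \<theta> :: "'m \<Rightarrow> 'e \<Rightarrow> 'b::euclidean_space"
  assumes A: "smooth_atlas A" "c \<in> A" and x: "x \<in> fst c" and \<theta>: "smooth_form_on A UNIV \<theta>"
  shows "chart_d A c \<theta> (snd c x) v w = ext_d A \<theta> x (from_coord A c x v) (from_coord A c x w)"
  using chart_d_transition[OF A chart_at_in_atlas(1)[OF A(1)] _ \<theta>, of "snd c x" x v w]
    x chart_at_in_atlas[OF A(1), of x] inv_chart_chart[OF A x]
  by (simp add: ext_d_eq_chart_d from_coord_def)

text \<open>The identity d d = 0 in coordinates, evaluated on constant vectors. The middle argument
  of \<open>H\<close> is the slot of the form, the outer two are directions of differentiation;
  exchanging these cancels the six terms in pairs.\<close>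

lemma cyclic_sum_derivative_of_exterior_derivative:
  fixes F :: "'a::euclidean_space \<Rightarrow> 'a \<Rightarrow> 'b::euclidean_space"
  assumes S: "open S" "p \<in> S" and F: "\<And>v. smooth_on S (\<lambda>q. F q v)"
  defines "dF v w q \<equiv> frechet_derivative (\<lambda>q. F q w) (at q) v
      - frechet_derivative (\<lambda>q. F q v) (at q) w"
  shows "frechet_derivative (dF v w) (at p) z + frechet_derivative (dF w z) (at p) v
    + frechet_derivative (dF z v) (at p) w = 0"
proof -
  define H where "H v w z = frechet_derivative (\<lambda>q. frechet_derivative (\<lambda>q. F q w) (at q) v) (at p) z" for v w z
  have "frechet_derivative (dF v w) (at p) z = H v w z - H w v z" for v w z
  proof -
    have "(dF v w has_derivative (\<lambda>h. frechet_derivative (\<lambda>q. frechet_derivative (\<lambda>q. F q w) (at q) v) (at p) h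
        - frechet_derivative (\<lambda>q. frechet_derivative (\<lambda>q. F q v) (at q) w) (at p) h)) (at p)"
      unfolding dF_def
      by (intro has_derivative_diff smooth_on_has_derivative[OF S(1) _ S(2)]
          smooth_on_frechet_derivative[OF S(1)] F)
    from fun_cong[OF frechet_derivative_at[OF this], of z] show ?thesis unfolding H_def by (rule sym)
  qed
  moreover have "H v w z = H z w v" for v w z
    unfolding H_def by (rule smooth_on_symmetric_second_derivative[OF S F])
  from this[of v w z] this[of w z v] this[of z v w]
  have "H v w z = H z w v" "H w z v = H v z w" "H z v w = H w v z" .
  ultimately show ?thesis by simp
qed

section \<open>Coordinates on the Lie algebra\<close>

lemma exhaust_5: fixes x :: 5 shows "x = 1 \<or> x = 2 \<or> x = 3 \<or> x = 4 \<or> x = 5"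
proof (induct x)
  case (of_int z)
  then have "z = 0 \<or> z = 1 \<or> z = 2 \<or> z = 3 \<or> z = 4" by simp arith
  then show ?case by auto
qed

lemma forall_5: "(\<forall>i::5. P i) \<longleftrightarrow> P 1 \<and> P 2 \<and> P 3 \<and> P 4 \<and> P 5"
  by (metis exhaust_5)

lemma UNIV_5: "UNIV = {1, 2, 3, 4, 5::5}"
  using exhaust_5 by auto

lemma sum_5: "sum f (UNIV::5 set) = f 1 + f 2 + f 3 + f 4 + f 5"
  unfolding UNIV_5 by (simp add: ac_simps)

lemma elem_nth: "\<epsilon> i j $ a $ b = (if a = i \<and> b = j then 1 else 0)"
  by (simp add: elem_def)

lemmas so32_basis_defs = e_m2_def e_m1_1_def e_m1_2_def e_0_1_def e_0_2_def
  E_0_1_def E_0_2_def E_1_1_def E_1_2_def E_2_def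

text \<open>Polymorphic, so that on complex matrices it describes the complexification of \<open>so32\<close>.\<close>

definition antisym_rel :: "'a::ring_1^5^5 \<Rightarrow> bool" where
  "antisym_rel X \<longleftrightarrow> X$1$5 = 0 \<and> X$2$4 = 0 \<and> X$3$3 = 0 \<and> X$4$2 = 0 \<and> X$5$1 = 0
    \<and> X$5$5 = - X$1$1 \<and> X$4$4 = - X$2$2 \<and> X$4$5 = - X$1$2 \<and> X$5$4 = - X$2$1
    \<and> X$5$3 = - X$3$1 \<and> X$4$3 = - X$3$2 \<and> X$5$2 = - X$4$1
    \<and> X$3$5 = - X$1$3 \<and> X$3$4 = - X$2$3 \<and> X$2$5 = - X$1$4"

lemma so32_iff: "X \<in> so32 \<longleftrightarrow> antisym_rel X"
  unfolding so32_def antisym_rel_def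
  by (simp add: vec_eq_iff forall_5 matrix_matrix_mult_def sum_5 antidiag_def elem_nth transpose_def
     add_eq_0_iff) (metis add.inverse_inverse add.inverse_neutral)

lemma so32_entries:
  assumes "X \<in> so32"
  shows "X$1$5 = 0" "X$2$4 = 0" "X$3$3 = 0" "X$4$2 = 0" "X$5$1 = 0"
    "X$5$5 = - X$1$1" "X$4$4 = - X$2$2" "X$4$5 = - X$1$2" "X$5$4 = - X$2$1"
    "X$5$3 = - X$3$1" "X$4$3 = - X$3$2" "X$5$2 = - X$4$1"
    "X$3$5 = - X$1$3" "X$3$4 = - X$2$3" "X$2$5 = - X$1$4"
  using assms by (auto simp: so32_iff antisym_rel_def)

lemma subspace_so32: "subspace so32"
  by (auto simp: subspace_def so32_iff antisym_rel_def)

lemma mbracket_nth: "mbracket X Y $ i $ j = (\<Sum>k\<in>UNIV. X$i$k * Y$k$j - Y$i$k * X$k$j)"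
  by (simp add: mbracket_def matrix_matrix_mult_def sum_subtractf)

lemma mbracket_in_so32: "X \<in> so32 \<Longrightarrow> Y \<in> so32 \<Longrightarrow> mbracket X Y \<in> so32"
  unfolding so32_iff[of "mbracket X Y"] antisym_rel_def
  by (simp add: mbracket_nth sum_5 so32_entries algebra_simps)

lemma basis_in_so32:
  "e_m2 \<in> so32" "e_m1_1 \<in> so32" "e_m1_2 \<in> so32" "e_0_1 \<in> so32" "e_0_2 \<in> so32"
  "E_0_1 \<in> so32" "E_0_2 \<in> so32" "E_1_1 \<in> so32" "E_1_2 \<in> so32" "E_2 \<in> so32"
  by (simp_all add: so32_iff antisym_rel_def so32_basis_defs elem_nth)

lemma so32_expand:
  assumes "X \<in> so32"
  shows "X = X$4$1 *\<^sub>R e_m2 + X$3$1 *\<^sub>R e_m1_1 + X$3$2 *\<^sub>R e_m1_2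
    + ((X$1$1 - X$2$2)/2) *\<^sub>R e_0_1 + ((X$1$2 + X$2$1)/2) *\<^sub>R e_0_2
    + ((X$1$1 + X$2$2)/2) *\<^sub>R E_0_1 + ((X$1$2 - X$2$1)/2) *\<^sub>R E_0_2
    + X$1$3 *\<^sub>R E_1_1 + X$2$3 *\<^sub>R E_1_2 + X$1$4 *\<^sub>R E_2"
  using assms unfolding so32_iff antisym_rel_def
  by (simp add: vec_eq_iff forall_5 so32_basis_defs elem_nth field_simps)

lemma mat_nth: "map_matrix f X $ i $ j = f (X $ i $ j)"
  by (simp add: map_matrix_def)

lemmas cmat_nth = mat_nth cmat_of_def re_mat_def im_mat_def cmat_scale_def holo_def antiholo_def

text \<open>The dual coordinates of the CR basis. As a e + b f = (a + i b) (e - i f)/2 + (a - i b)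
  (e + i f)/2, the (10)-coordinate carries the sign opposite to that in the basis vector.\<close>

primrec tcoord :: "tidx \<Rightarrow> cmat \<Rightarrow> complex" where
  "tcoord Tm2 Z = Z$4$1"
| "tcoord Tm1_10 Z = Z$3$1 + \<i> * Z$3$2"
| "tcoord Tm1_01 Z = Z$3$1 - \<i> * Z$3$2"
| "tcoord T0_10 Z = (Z$1$1 - Z$2$2) / 2 + \<i> * ((Z$1$2 + Z$2$1) / 2)"
| "tcoord T0_01 Z = (Z$1$1 - Z$2$2) / 2 - \<i> * ((Z$1$2 + Z$2$1) / 2)"

primrec rcoord :: "ridx \<Rightarrow> cmat \<Rightarrow> complex" where
  "rcoord R0_10 Z = (Z$1$1 + Z$2$2) / 2 + \<i> * ((Z$1$2 - Z$2$1) / 2)"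
| "rcoord R0_01 Z = (Z$1$1 + Z$2$2) / 2 - \<i> * ((Z$1$2 - Z$2$1) / 2)"
| "rcoord R1_10 Z = Z$1$3 + \<i> * Z$2$3"
| "rcoord R1_01 Z = Z$1$3 - \<i> * Z$2$3"
| "rcoord R2 Z = Z$1$4"

lemma tcoord_linear:
  "tcoord A (Z + W) = tcoord A Z + tcoord A W" "tcoord A (cmat_scale c Z) = c * tcoord A Z"
  by (cases A; simp add: cmat_nth add_divide_distrib diff_divide_distrib algebra_simps)+

lemma rcoord_linear:
  "rcoord A (Z + W) = rcoord A Z + rcoord A W" "rcoord A (cmat_scale c Z) = c * rcoord A Z"
  by (cases A; simp add: cmat_nth add_divide_distrib diff_divide_distrib algebra_simps)+

lemma coord_basis:
  "tcoord A (eo B) = (if A = B then 1 else 0)" "tcoord A (Eo C) = 0"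
  "rcoord D (eo B) = 0" "rcoord D (Eo C) = (if D = C then 1 else 0)"
proof -
  show "tcoord A (eo B) = (if A = B then 1 else 0)"
    by (cases A; cases B; simp add: cmat_nth so32_basis_defs elem_nth complex_eq_iff)
  show "tcoord A (Eo C) = 0"
    by (cases A; cases C; simp add: cmat_nth so32_basis_defs elem_nth complex_eq_iff)
  show "rcoord D (eo B) = 0"
    by (cases D; cases B; simp add: cmat_nth so32_basis_defs elem_nth complex_eq_iff)
  show "rcoord D (Eo C) = (if D = C then 1 else 0)"
    by (cases D; cases C; simp add: cmat_nth so32_basis_defs elem_nth complex_eq_iff)
qed

lemma cmat_expand:
  assumes "antisym_rel Z"
  shows "Z = (\<Sum>A\<in>{Tm2, Tm1_10, Tm1_01, T0_10, T0_01}. cmat_scale (tcoord A Z) (eo A))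
       + (\<Sum>B\<in>{R0_10, R0_01, R1_10, R1_01, R2}. cmat_scale (rcoord B Z) (Eo B))"
  using assms unfolding antisym_rel_def
  by (simp add: vec_eq_iff forall_5 cmat_nth so32_basis_defs elem_nth complex_eq_iff field_simps)

text \<open>The definite description in \<open>cr_coords\<close> is meaningful because the
  coordinate functionals are linear and dual to the basis: applied to any expansion of Z they return
  its coefficients.\<close>

lemma cr_coords_eq:
  assumes "antisym_rel Z"
  shows "cr_coords Z = (\<lambda>A. tcoord A Z, \<lambda>B. rcoord B Z)"
  unfolding cr_coords_def
proof (rule the_equality)
  show "case (\<lambda>A. tcoord A Z, \<lambda>B. rcoord B Z) of (a, b) \<Rightarrow>
     Z = (\<Sum>A\<in>{Tm2, Tm1_10, Tm1_01, T0_10, T0_01}. cmat_scale (a A) (eo A))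
       + (\<Sum>B\<in>{R0_10, R0_01, R1_10, R1_01, R2}. cmat_scale (b B) (Eo B))"
    using cmat_expand[OF assms] by simp
next
  fix ab :: "(tidx \<Rightarrow> complex) \<times> (ridx \<Rightarrow> complex)"
  assume "case ab of (a, b) \<Rightarrow>
     Z = (\<Sum>A\<in>{Tm2, Tm1_10, Tm1_01, T0_10, T0_01}. cmat_scale (a A) (eo A))
       + (\<Sum>B\<in>{R0_10, R0_01, R1_10, R1_01, R2}. cmat_scale (b B) (Eo B))"
  moreover obtain a b where ab: "ab = (a, b)" by (cases ab)
  ultimately have Z: "Z = (\<Sum>A\<in>{Tm2, Tm1_10, Tm1_01, T0_10, T0_01}. cmat_scale (a A) (eo A))
       + (\<Sum>B\<in>{R0_10, R0_01, R1_10, R1_01, R2}. cmat_scale (b B) (Eo B))" by simp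
  have "tcoord A Z = a A" for A
    unfolding Z by (cases A; simp add: tcoord_linear coord_basis del: eo.simps Eo.simps tcoord.simps)
  moreover have "rcoord B Z = b B" for B
    unfolding Z by (cases B; simp add: rcoord_linear coord_basis del: eo.simps Eo.simps rcoord.simps)
  ultimately show "ab = (\<lambda>A. tcoord A Z, \<lambda>B. rcoord B Z)" using ab by auto
qed

lemma antisym_rel_cmat_of: "X \<in> so32 \<Longrightarrow> antisym_rel (cmat_of X)"
  by (simp add: so32_iff antisym_rel_def cmat_nth)

lemma antisym_rel_add: "antisym_rel Z \<Longrightarrow> antisym_rel W \<Longrightarrow> antisym_rel (Z + W)"
  by (simp add: antisym_rel_def)

lemma antisym_rel_cmat_scale: "antisym_rel Z \<Longrightarrow> antisym_rel (cmat_scale c Z)"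
  by (simp add: antisym_rel_def cmat_nth)


section \<open>The grading\<close>

text \<open>\<open>E_0_1\<close> is diagonal with these entries, so bracketing with it multiplies
  the entry (i, j) by \<open>weight i - weight j\<close>. Each grade is therefore given by a set of
  matrix positions, and the projection to it is a mask.\<close>

definition weight :: "5 \<Rightarrow> int" where
  "weight i = (if i = 1 \<or> i = 2 then 1 else if i = 3 then 0 else -1)"

definition grade_mask :: "int \<Rightarrow> rmat \<Rightarrow> rmat" where
  "grade_mask k X = (\<chi> i j. if weight i - weight j = k then X$i$j else 0)"

lemma E_0_1_nth: "E_0_1 $ i $ j = (if i = j then of_int (weight i) else 0)"
  using exhaust_5[of i] exhaust_5[of j]
  by (elim disjE; simp add: E_0_1_def elem_nth weight_def)

lemma mbracket_E_0_1: "mbracket E_0_1 X $ i $ j = of_int (weight i - weight j) * X $ i $ j"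
proof -
  have "mbracket E_0_1 X $ i $ j = (\<Sum>k\<in>UNIV. E_0_1 $ i $ k * X $ k $ j) - (\<Sum>k\<in>UNIV. X $ i $ k * E_0_1 $ k $ j)"
    by (simp add: mbracket_nth sum_subtractf)
  also have "\<dots> = of_int (weight i) * X $ i $ j - X $ i $ j * of_int (weight j)"
    by (simp add: E_0_1_nth if_distrib[of "\<lambda>a. a * _"] if_distrib[of "\<lambda>a. _ * a"] cong: if_cong)
  finally show ?thesis by (simp add: algebra_simps)
qed

lemma grade_iff:
  "X \<in> grade k \<longleftrightarrow> X \<in> so32 \<and> (\<forall>i j. weight i - weight j \<noteq> k \<longrightarrow> X $ i $ j = 0)"
proof -
  have "mbracket E_0_1 X = of_int k *\<^sub>R X \<longleftrightarrow> (\<forall>i j. weight i - weight j \<noteq> k \<longrightarrow> X $ i $ j = 0)"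
    unfolding vec_eq_iff mbracket_E_0_1 by (auto simp flip: of_int_diff)
  then show ?thesis by (simp add: grade_def)
qed

lemma grade_mask_nth: "grade_mask k X $ i $ j = (if weight i - weight j = k then X$i$j else 0)"
  by (simp add: grade_mask_def)

lemma grade_mask_in_so32: "X \<in> so32 \<Longrightarrow> grade_mask k X \<in> so32"
  by (simp add: so32_iff antisym_rel_def grade_mask_nth weight_def)

lemma grade_mask_in_grade: "X \<in> so32 \<Longrightarrow> grade_mask k X \<in> grade k"
  by (simp add: grade_iff grade_mask_in_so32 grade_mask_nth)

lemma weight_diff_range: "weight i - weight j \<in> {-2..2}"
  by (simp add: weight_def)

text \<open>At each position only the summand whose degree is the weight difference can contribute,
  which determines f. This also covers degrees outside -2..2, which the sum does not see: no
  position has such a weight difference, so f vanishes there.\<close>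

lemma grade_proj_eq:
  assumes X: "X \<in> so32"
  shows "grade_proj k X = grade_mask k X"
proof -
  have "(THE f. (\<forall>j. f j \<in> grade j) \<and> X = (\<Sum>j\<in>{-2..2}. f j)) = (\<lambda>k. grade_mask k X)"
  proof (rule the_equality)
    have "X = (\<Sum>k\<in>{-2..2}. grade_mask k X)"
      using weight_diff_range by (simp add: vec_eq_iff grade_mask_nth)
    then show "(\<forall>k. grade_mask k X \<in> grade k) \<and> X = (\<Sum>k\<in>{-2..2}. grade_mask k X)"
      using grade_mask_in_grade[OF X] by blast
  next
    fix f assume f: "(\<forall>j. f j \<in> grade j) \<and> X = (\<Sum>j\<in>{-2..2}. f j)"
    show "f = (\<lambda>k. grade_mask k X)"
    proof
      fix k
      have "f k $ i $ j = grade_mask k X $ i $ j" for i j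
      proof -
        let ?w = "weight i - weight j"
        have z: "f l $ i $ j = 0" if "l \<noteq> ?w" for l
          using f that by (metis grade_iff)
        have "X $ i $ j = (\<Sum>l\<in>{-2..2}. f l $ i $ j)" using f by simp
        also have "\<dots> = (\<Sum>l\<in>{-2..2}. if l = ?w then f ?w $ i $ j else 0)"
          using z by (intro sum.cong) auto
        also have "\<dots> = f ?w $ i $ j" using weight_diff_range[of i j] by simp
        finally show ?thesis using z[of k] by (auto simp: grade_mask_nth)
      qed
      then show "f k = grade_mask k X" by (simp add: vec_eq_iff)
    qed
  qed
  then show ?thesis by (simp add: grade_proj_def)
qed


section \<open>The Killing form\<close>

text \<open>The numbering turns the sum over the set \<open>so32_basis\<close> in
  \<open>killing\<close> into one over indices, once distinctness of the elements is known.\<close>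

definition basis_elem :: "nat \<Rightarrow> rmat" where
  "basis_elem i = [e_m2, e_m1_1, e_m1_2, e_0_1, e_0_2, E_0_1, E_0_2, E_1_1, E_1_2, E_2] ! i"

definition basis_coord :: "nat \<Rightarrow> rmat \<Rightarrow> real" where
  "basis_coord i X = [X$4$1, X$3$1, X$3$2, (X$1$1 - X$2$2)/2, (X$1$2 + X$2$1)/2,
    (X$1$1 + X$2$2)/2, (X$1$2 - X$2$1)/2, X$1$3, X$2$3, X$1$4] ! i"

lemma lessThan_10: "{..<10} = {0, 1, 2, 3, 4, 5, 6, 7, 8, 9::nat}"
  by auto

lemma linear_basis_coord: "i < 10 \<Longrightarrow> linear (basis_coord i)"
proof -
  assume "i < 10"
  then have "i \<in> {0, 1, 2, 3, 4, 5, 6, 7, 8, 9::nat}" using lessThan_10 by blast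
  then show ?thesis
    by (elim insertE; simp add: basis_coord_def linear_iff field_simps)
qed

lemma basis_coord_basis_elem:
  assumes "i < 10" "j < 10"
  shows "basis_coord i (basis_elem j) = (if i = j then 1 else 0)"
proof -
  have i: "i \<in> {0, 1, 2, 3, 4, 5, 6, 7, 8, 9::nat}" and j: "j \<in> {0, 1, 2, 3, 4, 5, 6, 7, 8, 9::nat}"
    using assms lessThan_10 by blast+
  have "basis_coord i X = (if i = 0 then X$4$1 else if i = 1 then X$3$1 else if i = 2 then X$3$2
      else if i = 3 then (X$1$1 - X$2$2)/2 else if i = 4 then (X$1$2 + X$2$1)/2
      else if i = 5 then (X$1$1 + X$2$2)/2 else if i = 6 then (X$1$2 - X$2$1)/2
      else if i = 7 then X$1$3 else if i = 8 then X$2$3 else X$1$4)" for X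
    using i by (elim insertE; simp add: basis_coord_def)
  then show ?thesis using j
    by (elim insertE; simp add: basis_elem_def so32_basis_defs elem_nth) (use i in auto)
qed

lemma so32_basis_image: "so32_basis = basis_elem ` {..<10}"
  unfolding lessThan_10 by (simp add: so32_basis_def basis_elem_def)

lemma inj_basis_elem: "inj_on basis_elem {..<10}"
  by (rule inj_onI) (metis basis_coord_basis_elem lessThan_iff zero_neq_one)

lemma sum_so32_basis: "(\<Sum>b\<in>so32_basis. f b) = (\<Sum>i<10. f (basis_elem i))"
  unfolding so32_basis_image by (simp add: sum.reindex[OF inj_basis_elem])

lemma basis_coord_sum:
  assumes "i < 10"
  shows "basis_coord i (\<Sum>j<10. c j *\<^sub>R basis_elem j) = c i"
proof -
  have "basis_coord i (\<Sum>j<10. c j *\<^sub>R basis_elem j) = (\<Sum>j<10. c j * basis_coord i (basis_elem j))"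
    using linear_basis_coord[OF assms] by (simp add: linear_sum linear_cmul)
  also have "\<dots> = (\<Sum>j<10. if i = j then c j else 0)"
    using assms by (intro sum.cong) (auto simp: basis_coord_basis_elem)
  finally show ?thesis using assms by simp
qed

lemma independent_so32_basis: "independent so32_basis"
proof (rule independent_if_scalars_zero)
  show "finite so32_basis" by (simp add: so32_basis_def)
  fix f b assume f: "(\<Sum>x\<in>so32_basis. f x *\<^sub>R x) = 0" and "b \<in> so32_basis"
  then obtain i where i: "i < 10" "b = basis_elem i" by (auto simp: so32_basis_image)
  have "f (basis_elem i) = basis_coord i (\<Sum>j<10. f (basis_elem j) *\<^sub>R basis_elem j)"
    by (rule basis_coord_sum[OF i(1), symmetric])
  also have "\<dots> = 0" using f linear_0[OF linear_basis_coord[OF i(1)]] by (simp add: sum_so32_basis)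
  finally show "f b = 0" using i by simp
qed

lemma so32_expand_basis: "X \<in> so32 \<Longrightarrow> X = (\<Sum>i<10. basis_coord i X *\<^sub>R basis_elem i)"
  using so32_expand[of X] unfolding lessThan_10
  by (simp add: basis_coord_def basis_elem_def add.assoc)

lemma so32_eq_span: "so32 = span so32_basis"
proof
  show "span so32_basis \<subseteq> so32"
    by (rule span_minimal[OF _ subspace_so32]) (auto simp: so32_basis_def basis_in_so32)
  show "so32 \<subseteq> span so32_basis"
  proof
    fix X assume "X \<in> so32"
    then have "X = (\<Sum>i<10. basis_coord i X *\<^sub>R basis_elem i)" by (rule so32_expand_basis)
    also have "\<dots> \<in> span so32_basis"
      by (intro span_sum span_scale span_base) (auto simp: so32_basis_image)
    finally show "X \<in> span so32_basis" .
  qed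
qed

lemma representation_so32_basis:
  assumes X: "X \<in> so32" and i: "i < 10"
  shows "representation so32_basis X (basis_elem i) = basis_coord i X"
proof -
  have "X = (\<Sum>b\<in>so32_basis. representation so32_basis X b *\<^sub>R b)"
    using sum_representation_eq[OF independent_so32_basis, of X so32_basis] X
    by (simp add: so32_eq_span) (simp add: so32_basis_def)
  then have "basis_coord i X
      = basis_coord i (\<Sum>j<10. representation so32_basis X (basis_elem j) *\<^sub>R basis_elem j)"
    by (simp add: sum_so32_basis)
  also have "\<dots> = representation so32_basis X (basis_elem i)" by (rule basis_coord_sum[OF i])
  finally show ?thesis by simp
qed

text \<open>These are the diagonal entries of ad X ad Y in the basis; their sum is the Killing
  form.\<close>

lemma killing_summands:
  assumes X: "X \<in> so32" and Y: "Y \<in> so32"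
  shows
    "basis_coord 0 (mbracket X (mbracket Y (basis_elem 0))) = X$1$1 * Y$1$1 + X$1$1 * Y$2$2 +
      X$2$2 * Y$1$1 + X$2$2 * Y$2$2 + X$3$1 * Y$1$3 + X$3$2 * Y$2$3 + 2 * X$4$1 * Y$1$4"
    "basis_coord 1 (mbracket X (mbracket Y (basis_elem 1))) = X$1$1 * Y$1$1 + X$2$1 * Y$1$2 +
      X$3$1 * Y$1$3 + X$2$3 * Y$3$2 + X$3$2 * Y$2$3 + X$4$1 * Y$1$4"
    "basis_coord 2 (mbracket X (mbracket Y (basis_elem 2))) = X$2$2 * Y$2$2 + X$1$2 * Y$2$1 +
      X$1$3 * Y$3$1 + X$3$1 * Y$1$3 + X$3$2 * Y$2$3 + X$4$1 * Y$1$4"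
    "basis_coord 3 (mbracket X (mbracket Y (basis_elem 3))) = 2 * X$1$2 * Y$2$1 + 2 * X$2$1 *
      Y$1$2 + 1/2 * X$1$3 * Y$3$1 + 1/2 * X$3$1 * Y$1$3 + 1/2 * X$2$3 * Y$3$2 + 1/2 * X$3$2 *
      Y$2$3"
    "basis_coord 4 (mbracket X (mbracket Y (basis_elem 4))) = X$1$1 * Y$1$1 - X$1$1 * Y$2$2 -
      X$2$2 * Y$1$1 + X$2$2 * Y$2$2 - X$1$2 * Y$1$2 + X$1$2 * Y$2$1 + X$2$1 * Y$1$2 - X$2$1 *
      Y$2$1 + 1/2 * X$1$3 * Y$3$1 + 1/2 * X$3$1 * Y$1$3 + 1/2 * X$2$3 * Y$3$2 + 1/2 * X$3$2 *
      Y$2$3"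
    "basis_coord 5 (mbracket X (mbracket Y (basis_elem 5))) = 1/2 * X$1$3 * Y$3$1 + 1/2 * X$3$1
      * Y$1$3 + 1/2 * X$2$3 * Y$3$2 + 1/2 * X$3$2 * Y$2$3 + 2 * X$1$4 * Y$4$1 + 2 * X$4$1 *
      Y$1$4"
    "basis_coord 6 (mbracket X (mbracket Y (basis_elem 6))) = X$1$1 * Y$1$1 - X$1$1 * Y$2$2 -
      X$2$2 * Y$1$1 + X$2$2 * Y$2$2 + X$1$2 * Y$1$2 + X$1$2 * Y$2$1 + X$2$1 * Y$1$2 + X$2$1 *
      Y$2$1 + 1/2 * X$1$3 * Y$3$1 + 1/2 * X$3$1 * Y$1$3 + 1/2 * X$2$3 * Y$3$2 + 1/2 * X$3$2 *
      Y$2$3"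
    "basis_coord 7 (mbracket X (mbracket Y (basis_elem 7))) = X$1$1 * Y$1$1 + X$1$2 * Y$2$1 +
      X$1$3 * Y$3$1 + X$2$3 * Y$3$2 + X$3$2 * Y$2$3 + X$1$4 * Y$4$1"
    "basis_coord 8 (mbracket X (mbracket Y (basis_elem 8))) = X$2$2 * Y$2$2 + X$2$1 * Y$1$2 +
      X$1$3 * Y$3$1 + X$3$1 * Y$1$3 + X$2$3 * Y$3$2 + X$1$4 * Y$4$1"
    "basis_coord 9 (mbracket X (mbracket Y (basis_elem 9))) = X$1$1 * Y$1$1 + X$1$1 * Y$2$2 +
      X$2$2 * Y$1$1 + X$2$2 * Y$2$2 + X$1$3 * Y$3$1 + X$2$3 * Y$3$2 + 2 * X$1$4 * Y$4$1"
  by (simp_all add: basis_coord_def basis_elem_def mbracket_nth sum_5 so32_entries[OF X] so32_entries[OF Y]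
      so32_basis_defs elem_nth field_simps)

text \<open>The right-hand side is 3 tr(XY), in accordance with the factor n - 2 for the orthogonal
  algebra of dimension n = 5. The ten products make up half the trace, since the entries (i, j) and
  (6 - j, 6 - i) of an element of \<open>so32\<close> are opposite.\<close>

lemma killing_eq:
  assumes X: "X \<in> so32" and Y: "Y \<in> so32"
  shows "killing X Y = 6 * (X$1$1 * Y$1$1 + X$2$2 * Y$2$2 + X$1$2 * Y$2$1 + X$2$1 * Y$1$2
    + X$1$3 * Y$3$1 + X$3$1 * Y$1$3 + X$2$3 * Y$3$2 + X$3$2 * Y$2$3 + X$1$4 * Y$4$1 + X$4$1 * Y$1$4)"
proof -
  have b: "basis_elem i \<in> so32" if "i < 10" for i
    using that so32_eq_span so32_basis_image span_base by blast
  have "killing X Y = (\<Sum>i<10. basis_coord i (mbracket X (mbracket Y (basis_elem i))))"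
    unfolding killing_def sum_so32_basis
    by (intro sum.cong refl) (simp add: representation_so32_basis mbracket_in_so32 X Y b)
  then show ?thesis
    unfolding lessThan_10 by (simp add: killing_summands[OF X Y] field_simps del: One_nat_def)
qed

section \<open>The codifferential\<close>

lemma subspace_grade: "subspace (grade k)"
  using subspace_so32 by (auto simp: subspace_def grade_iff)

lemma basis_in_grade:
  "e_m2 \<in> grade (-2)" "e_m1_1 \<in> grade (-1)" "e_m1_2 \<in> grade (-1)"
  "E_1_1 \<in> grade 1" "E_1_2 \<in> grade 1" "E_2 \<in> grade 2"
  by (simp_all add: grade_iff basis_in_so32)
    (simp_all add: forall_5 weight_def so32_basis_defs elem_nth)

lemma zero_in_grade: "0 \<in> grade k"
  using subspace_grade subspace_0 by blast

lemma m_minus_eq_span: "m_minus = span {e_m2, e_m1_1, e_m1_2}"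
proof
  show "m_minus \<subseteq> span {e_m2, e_m1_1, e_m1_2}"
  proof
    fix Z assume "Z \<in> m_minus"
    then obtain X Y where Z: "Z = X + Y" and X: "X \<in> grade (-2)" and Y: "Y \<in> grade (-1)"
      by (auto simp: m_minus_def)
    have "X = X$4$1 *\<^sub>R e_m2"
      using so32_expand[of X] X by (simp add: grade_iff forall_5 weight_def)
    moreover have "Y = Y$3$1 *\<^sub>R e_m1_1 + Y$3$2 *\<^sub>R e_m1_2"
      using so32_expand[of Y] Y by (simp add: grade_iff forall_5 weight_def)
    ultimately have "Z = X$4$1 *\<^sub>R e_m2 + (Y$3$1 *\<^sub>R e_m1_1 + Y$3$2 *\<^sub>R e_m1_2)" using Z by metis
    also have "\<dots> \<in> span {e_m2, e_m1_1, e_m1_2}"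
      by (intro span_add span_scale span_base) auto
    finally show "Z \<in> span {e_m2, e_m1_1, e_m1_2}" .
  qed
next
  have z: "e_m2 = e_m2 + 0" "e_m1_1 = 0 + e_m1_1" "e_m1_2 = 0 + e_m1_2" by simp_all
  have "{e_m2, e_m1_1, e_m1_2} \<subseteq> m_minus"
    unfolding m_minus_def using basis_in_grade zero_in_grade z by blast
  moreover have "subspace m_minus"
    unfolding m_minus_def by (rule subspace_sums[OF subspace_grade subspace_grade])
  ultimately show "span {e_m2, e_m1_1, e_m1_2} \<subseteq> m_minus" by (rule span_minimal)
qed

text \<open>Each of the elements \<open>e_m2\<close>, \<open>e_m1_1\<close>, \<open>e_m1_2\<close>
  has Killing product 6 with its partner in \<open>g_plus\<close>, hence the factor 1/6.\<close>

definition dual_elem :: "nat \<Rightarrow> rmat" where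
  "dual_elem i = (1/6) *\<^sub>R ([E_2, E_1_1, E_1_2] ! i)"

lemma lessThan_3: "{..<3} = {0, 1, 2::nat}"
  by auto

lemma basis_elem_012: "basis_elem 0 = e_m2" "basis_elem (Suc 0) = e_m1_1" "basis_elem 2 = e_m1_2"
  by (simp_all add: basis_elem_def)

lemma dual_elem_012: "dual_elem 0 = (1/6) *\<^sub>R E_2" "dual_elem (Suc 0) = (1/6) *\<^sub>R E_1_1"
  "dual_elem 2 = (1/6) *\<^sub>R E_1_2"
  by (simp_all add: dual_elem_def)

lemma E_in_g_plus: "E_2 \<in> g_plus" "E_1_1 \<in> g_plus" "E_1_2 \<in> g_plus"
proof -
  have "E_2 = 0 + E_2" "E_1_1 = E_1_1 + 0" "E_1_2 = E_1_2 + 0" by simp_all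
  then show "E_2 \<in> g_plus" "E_1_1 \<in> g_plus" "E_1_2 \<in> g_plus"
    unfolding g_plus_def using basis_in_grade zero_in_grade by blast+
qed

lemma subspace_g_plus: "subspace g_plus"
  unfolding g_plus_def by (rule subspace_sums[OF subspace_grade subspace_grade])

lemma scaleR_in_so32: "X \<in> so32 \<Longrightarrow> c *\<^sub>R X \<in> so32"
  using subspace_so32 subspace_scale by blast

lemma dual_bases_basis_elem: "dual_bases basis_elem dual_elem"
  unfolding dual_bases_def
proof (intro conjI allI impI)
  show "inj_on basis_elem {..<3}"
    by (rule inj_on_subset[OF inj_basis_elem]) auto
  have "basis_elem ` {..<3} \<subseteq> so32_basis" unfolding so32_basis_image by auto
  then show "independent (basis_elem ` {..<3})"
    by (rule independent_mono[OF independent_so32_basis])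
  show "span (basis_elem ` {..<3}) = m_minus"
    unfolding lessThan_3 m_minus_eq_span by (simp add: basis_elem_012)
next
  fix i :: nat assume "i < 3"
  then have "i \<in> {0, 1, 2}" using lessThan_3 by blast
  then show "dual_elem i \<in> g_plus"
    using E_in_g_plus subspace_scale[OF subspace_g_plus] by (elim insertE; simp add: dual_elem_012)
next
  fix i j :: nat assume "i < 3" "j < 3"
  then have "i \<in> {0, 1, 2}" "j \<in> {0, 1, 2}" using lessThan_3 by blast+
  then show "killing (basis_elem i) (dual_elem j) = (if i = j then 1 else 0)"
    by (elim insertE; simp add: basis_elem_012 dual_elem_012 killing_eq basis_in_so32
        scaleR_in_so32; simp add: so32_basis_defs elem_nth)
qed

text \<open>Maps of rank one span the linear maps on \<open>g_plus\<close>, and on them the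
  coboundary is explicit. The factor a stands for the common scale 1/6 of the dual basis.\<close>

lemma bdry_rank_one:
  assumes "linear \<phi>"
  shows "bdry (\<lambda>X. \<phi> X *\<^sub>R Z) (a *\<^sub>R X) (a *\<^sub>R Y)
    = (a * a) *\<^sub>R (\<phi> Y *\<^sub>R mbracket X Z - \<phi> X *\<^sub>R mbracket Y Z - \<phi> (mbracket X Y) *\<^sub>R Z)"
proof -
  have "mbracket (a *\<^sub>R X) (b *\<^sub>R Y) = (a * b) *\<^sub>R mbracket X Y" for a b X Y
    by (simp add: vec_eq_iff mbracket_nth sum_distrib_left algebra_simps)
  note b = this this[of 1, simplified] this[of _ _ 1, simplified]
  show ?thesis
    by (simp add: bdry_def b linear_cmul[OF assms] scaleR_diff_right mult.commute mult.left_commute)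
qed

lemma mbracket_g_plus:
  "mbracket E_2 E_1_1 = 0" "mbracket E_2 E_1_2 = 0" "mbracket E_1_1 E_1_2 = - E_2"
  by (simp_all add: vec_eq_iff forall_5 mbracket_nth sum_5 so32_basis_defs elem_nth)

lemma killing_scaleR_right:
  "X \<in> so32 \<Longrightarrow> Y \<in> so32 \<Longrightarrow> killing X (c *\<^sub>R Y) = c * killing X Y"
  by (simp add: killing_eq scaleR_in_so32 algebra_simps)

text \<open>The test map sends X to \<phi>(X) Z. Among the basis elements of \<open>g_plus\<close>
  the only nontrivial bracket is [E_1_1, E_1_2] = -E_2, which accounts for the last summand; the
  overall factor 1/36 cancels.\<close>

lemma ker_codiffD:
  assumes \<tau>: "in_ker_codiff \<tau>" and \<phi>: "linear \<phi>" and Z: "Z \<in> so32"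
    and so: "\<tau> e_m2 e_m1_1 \<in> so32" "\<tau> e_m2 e_m1_2 \<in> so32" "\<tau> e_m1_1 e_m1_2 \<in> so32"
  shows "killing (\<tau> e_m2 e_m1_1) (\<phi> E_1_1 *\<^sub>R mbracket E_2 Z - \<phi> E_2 *\<^sub>R mbracket E_1_1 Z)
    + killing (\<tau> e_m2 e_m1_2) (\<phi> E_1_2 *\<^sub>R mbracket E_2 Z - \<phi> E_2 *\<^sub>R mbracket E_1_2 Z)
    + killing (\<tau> e_m1_1 e_m1_2) (\<phi> E_1_2 *\<^sub>R mbracket E_1_1 Z - \<phi> E_1_1 *\<^sub>R mbracket E_1_2 Z + \<phi> E_2 *\<^sub>R Z) = 0"
proof -
  let ?A = "\<lambda>X. \<phi> X *\<^sub>R Z"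
  have A: "linear ?A"
    using \<phi> by (simp add: linear_iff algebra_simps)
  have ij: "{(i, j). i < j \<and> j < (3::nat)} = {(0, 1), (0, 2), (1, 2)}" by auto
  have "(\<Sum>(i, j)\<in>{(i, j). i < j \<and> j < 3}.
      killing (\<tau> (basis_elem i) (basis_elem j)) (bdry ?A (dual_elem i) (dual_elem j))) = 0"
    using \<tau> A dual_bases_basis_elem scaleR_in_so32[OF Z] unfolding in_ker_codiff_def by blast
  moreover have W: "\<phi> Y *\<^sub>R mbracket X Z - \<phi> X *\<^sub>R mbracket Y Z - \<phi> (mbracket X Y) *\<^sub>R Z \<in> so32"
    if "X \<in> so32" "Y \<in> so32" for X Y
    by (intro subspace_diff[OF subspace_so32] scaleR_in_so32 mbracket_in_so32 that Z)
  ultimately show ?thesis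
    using W[OF basis_in_so32(10) basis_in_so32(8)] W[OF basis_in_so32(10) basis_in_so32(9)]
      W[OF basis_in_so32(8) basis_in_so32(9)]
    by (simp add: ij basis_elem_012 dual_elem_012 bdry_rank_one[OF \<phi>] mbracket_g_plus
        killing_scaleR_right so linear_0[OF \<phi>] linear_neg[OF \<phi>])
qed

section \<open>The codifferential condition, degree by degree\<close>

locale two_form =
  fixes \<tau> :: "rmat \<Rightarrow> rmat \<Rightarrow> rmat"
  assumes in_so32: "X \<in> so32 \<Longrightarrow> Y \<in> so32 \<Longrightarrow> \<tau> X Y \<in> so32"
    and zero_left: "\<tau> 0 Y = 0" and zero_right: "\<tau> X 0 = 0"
begin

text \<open>On homogeneous arguments a single pair (i, j) of the double sum survives, with i + j =
  -3 or -2; hence the offsets.\<close>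

lemma degree_comp_basis:
  "degree_comp d \<tau> e_m2 e_m1_1 = grade_mask (d - 3) (\<tau> e_m2 e_m1_1)"
  "degree_comp d \<tau> e_m2 e_m1_2 = grade_mask (d - 3) (\<tau> e_m2 e_m1_2)"
  "degree_comp d \<tau> e_m1_1 e_m1_2 = grade_mask (d - 2) (\<tau> e_m1_1 e_m1_2)"
proof -
  have m: "grade_proj k X = (if k = l then X else 0)" if "X \<in> grade l" for k l X
    using that by (auto simp: grade_proj_eq grade_iff vec_eq_iff grade_mask_nth)
  have z: "grade_proj k 0 = 0" for k
    using grade_proj_eq[of 0 k] subspace_0[OF subspace_so32] by (simp add: vec_eq_iff grade_mask_nth)
  show "degree_comp d \<tau> e_m2 e_m1_1 = grade_mask (d - 3) (\<tau> e_m2 e_m1_1)"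
    "degree_comp d \<tau> e_m2 e_m1_2 = grade_mask (d - 3) (\<tau> e_m2 e_m1_2)"
    "degree_comp d \<tau> e_m1_1 e_m1_2 = grade_mask (d - 2) (\<tau> e_m1_1 e_m1_2)"
    by (simp_all add: degree_comp_def m[OF basis_in_grade(1)] m[OF basis_in_grade(2)]
        m[OF basis_in_grade(3)] zero_left zero_right z)
      (simp_all add: grade_proj_eq in_so32 basis_in_so32 algebra_simps)
qed

lemma codiff_eq:
  assumes "in_ker_codiff (degree_comp d \<tau>)" and "linear \<phi>" and Z: "Z \<in> so32"
  defines "V \<equiv> grade_mask (d - 3) (\<tau> e_m2 e_m1_1)" and "W \<equiv> grade_mask (d - 3) (\<tau> e_m2 e_m1_2)"
    and "U \<equiv> grade_mask (d - 2) (\<tau> e_m1_1 e_m1_2)"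
  shows "killing V (\<phi> E_1_1 *\<^sub>R mbracket E_2 Z - \<phi> E_2 *\<^sub>R mbracket E_1_1 Z)
    + killing W (\<phi> E_1_2 *\<^sub>R mbracket E_2 Z - \<phi> E_2 *\<^sub>R mbracket E_1_2 Z)
    + killing U (\<phi> E_1_2 *\<^sub>R mbracket E_1_1 Z - \<phi> E_1_1 *\<^sub>R mbracket E_1_2 Z + \<phi> E_2 *\<^sub>R Z) = 0"
  using ker_codiffD[OF assms(1-3)] unfolding degree_comp_basis V_def W_def U_def
  by (simp add: grade_mask_in_so32 in_so32 basis_in_so32)

text \<open>The functionals \<phi> reading the entries (1,4), (1,3) and (2,3) are dual to
  \<open>E_2\<close>, \<open>E_1_1\<close>, \<open>E_1_2\<close>, and each isolates one equation.
  Since the Killing form pairs grade k only with grade -k, the first equation carries information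
  only for Z of grade 2 - d, the other two only for Z of grade 1 - d. This dictates the choices of Z
  below.\<close>

lemma codiff_killing_eqs:
  assumes \<tau>: "in_ker_codiff (degree_comp d \<tau>)" and Z: "Z \<in> so32"
  defines "V \<equiv> grade_mask (d - 3) (\<tau> e_m2 e_m1_1)" and "W \<equiv> grade_mask (d - 3) (\<tau> e_m2 e_m1_2)"
    and "U \<equiv> grade_mask (d - 2) (\<tau> e_m1_1 e_m1_2)"
  shows "killing U Z = killing V (mbracket E_1_1 Z) + killing W (mbracket E_1_2 Z)"
    "killing V (mbracket E_2 Z) = killing U (mbracket E_1_2 Z)"
    "killing W (mbracket E_2 Z) = - killing U (mbracket E_1_1 Z)"
proof -
  have so: "U \<in> so32" "V \<in> so32" "W \<in> so32"
    by (simp_all add: U_def V_def W_def grade_mask_in_so32 in_so32 basis_in_so32)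
  have n: "killing X (- Y) = - killing X Y" if "X \<in> so32" "Y \<in> so32" for X Y
    using killing_scaleR_right[OF that, of "-1"] by simp
  have k0: "killing X 0 = 0" if "X \<in> so32" for X
    using killing_scaleR_right[OF that subspace_0[OF subspace_so32], of 0] by simp
  note b = mbracket_in_so32[OF basis_in_so32(8) Z] mbracket_in_so32[OF basis_in_so32(9) Z]
    mbracket_in_so32[OF basis_in_so32(10) Z]
  have l: "linear (\<lambda>X::rmat. X $ i $ j)" for i j by (simp add: linear_iff)
  note c = codiff_eq[OF \<tau> l Z, folded U_def V_def W_def]
  have e: "E_2$1$4 = 1" "E_1_1$1$4 = 0" "E_1_2$1$4 = 0" "E_2$1$3 = 0" "E_1_1$1$3 = 1"
    "E_1_2$1$3 = 0" "E_2$2$3 = 0" "E_1_1$2$3 = 0" "E_1_2$2$3 = 1"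
    by (simp_all add: E_2_def E_1_1_def E_1_2_def elem_nth)
  show "killing U Z = killing V (mbracket E_1_1 Z) + killing W (mbracket E_1_2 Z)"
    using c[of 1 4] by (simp add: e n k0 so b)
  show "killing V (mbracket E_2 Z) = killing U (mbracket E_1_2 Z)"
    using c[of 1 3] by (simp add: e n k0 so b)
  show "killing W (mbracket E_2 Z) = - killing U (mbracket E_1_1 Z)"
    using c[of 2 3] by (simp add: e n k0 so b)
qed

text \<open>Both \<open>e_0_1\<close> and \<open>e_0_2\<close> commute with \<open>E_2\<close>, so
  with them the second equation sees only the value on (e_m1_1, e_m1_2). Then Z =
  \<open>E_0_1\<close>, for which [E_2, E_0_1] = -2 E_2, gives the other two entries.\<close>

lemma degree_1_vanishing:
  assumes "in_ker_codiff (degree_comp 1 \<tau>)"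
  shows "\<tau> e_m1_1 e_m1_2 $3$1 = 0" "\<tau> e_m1_1 e_m1_2 $3$2 = 0"
    "\<tau> e_m2 e_m1_1 $4$1 = 0" "\<tau> e_m2 e_m1_2 $4$1 = 0"
proof -
  note k = killing_eq in_so32 basis_in_so32 grade_mask_in_so32 mbracket_in_so32
  note e = grade_mask_nth weight_def mbracket_nth sum_5 so32_basis_defs elem_nth
    so32_entries[OF in_so32[OF basis_in_so32(1) basis_in_so32(2)]]
    so32_entries[OF in_so32[OF basis_in_so32(1) basis_in_so32(3)]]
    so32_entries[OF in_so32[OF basis_in_so32(2) basis_in_so32(3)]]
  note c = codiff_killing_eqs[OF assms]
  show "\<tau> e_m1_1 e_m1_2 $3$1 = 0"
    using c(2)[OF basis_in_so32(5)] by (simp add: k) (simp add: e)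
  show "\<tau> e_m1_1 e_m1_2 $3$2 = 0"
    using c(2)[OF basis_in_so32(4)] by (simp add: k) (simp add: e)
  show "\<tau> e_m2 e_m1_1 $4$1 = 0"
    using c(2)[OF basis_in_so32(6)] \<open>\<tau> e_m1_1 e_m1_2 $3$2 = 0\<close> by (simp add: k) (simp add: e)
  show "\<tau> e_m2 e_m1_2 $4$1 = 0"
    using c(3)[OF basis_in_so32(6)] \<open>\<tau> e_m1_1 e_m1_2 $3$1 = 0\<close> by (simp add: k) (simp add: e)
qed

text \<open>The solutions in degree 2 are the multiples of one form: it maps (e_m1_1, e_m1_2) to a
  \<open>E_0_1\<close> and (e_m2, e_m1_j) to -a e_m1_j, j = 1, 2, where a is the entry (1,1) of the
  first value and remains free here.\<close>

lemma degree_2_relations: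
  assumes "in_ker_codiff (degree_comp 2 \<tau>)"
  shows "\<tau> e_m2 e_m1_1 $3$2 = 0" "\<tau> e_m2 e_m1_2 $3$1 = 0"
    "\<tau> e_m1_1 e_m1_2 $1$2 = 0" "\<tau> e_m1_1 e_m1_2 $2$1 = 0"
    "\<tau> e_m1_1 e_m1_2 $1$1 = \<tau> e_m1_1 e_m1_2 $2$2"
    "\<tau> e_m2 e_m1_1 $3$1 = - \<tau> e_m1_1 e_m1_2 $1$1"
    "\<tau> e_m2 e_m1_2 $3$2 = - \<tau> e_m1_1 e_m1_2 $1$1"
proof -
  note k = killing_eq in_so32 basis_in_so32 grade_mask_in_so32 mbracket_in_so32
  note e = grade_mask_nth weight_def mbracket_nth sum_5 so32_basis_defs elem_nth
    so32_entries[OF in_so32[OF basis_in_so32(1) basis_in_so32(2)]]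
    so32_entries[OF in_so32[OF basis_in_so32(1) basis_in_so32(3)]]
    so32_entries[OF in_so32[OF basis_in_so32(2) basis_in_so32(3)]]
  note c = codiff_killing_eqs[OF assms]
  let ?U = "\<tau> e_m1_1 e_m1_2" and ?V = "\<tau> e_m2 e_m1_1" and ?W = "\<tau> e_m2 e_m1_2"
  have eqs: "?V$3$1 - ?W$3$2 + ?U$1$1 - ?U$2$2 = 0" "?V$3$2 + ?W$3$1 + ?U$1$2 + ?U$2$1 = 0"
    "?V$3$1 + ?W$3$2 + ?U$1$1 + ?U$2$2 = 0" "?W$3$1 - ?V$3$2 - ?U$1$2 + ?U$2$1 = 0"
    using c(1)[OF basis_in_so32(4)] c(1)[OF basis_in_so32(5)] c(1)[OF basis_in_so32(6)]
      c(1)[OF basis_in_so32(7)]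
    by (simp_all add: k) (simp_all add: e)
  have eqs': "?V$3$2 = ?U$1$2" "?V$3$1 = - ?U$2$2" "?W$3$2 = - ?U$1$1" "?W$3$1 = ?U$2$1"
    using c(2)[OF basis_in_so32(2)] c(2)[OF basis_in_so32(3)] c(3)[OF basis_in_so32(2)]
      c(3)[OF basis_in_so32(3)]
    by (simp_all add: k) (simp_all add: e)
  show "?V$3$2 = 0" "?W$3$1 = 0" "?U$1$2 = 0" "?U$2$1 = 0" "?U$1$1 = ?U$2$2"
    "?V$3$1 = - ?U$1$1" "?W$3$2 = - ?U$1$1"
    using eqs eqs' by argo+
qed

text \<open>The entries (1,3) and (2,3) of the value on (e_m1_1, e_m1_2) are each found twice: once
  with Z of grade -1 in the first equation, once with Z = \<open>e_m2\<close> in the other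
  two.\<close>

lemma degree_3_relations:
  assumes "in_ker_codiff (degree_comp 3 \<tau>)"
  shows "\<tau> e_m1_1 e_m1_2 $1$3 = \<tau> e_m2 e_m1_1 $1$1 + \<tau> e_m2 e_m1_2 $1$2"
    "\<tau> e_m1_1 e_m1_2 $2$3 = \<tau> e_m2 e_m1_1 $2$1 + \<tau> e_m2 e_m1_2 $2$2"
    "\<tau> e_m1_1 e_m1_2 $1$3 = - (\<tau> e_m2 e_m1_1 $1$1 + \<tau> e_m2 e_m1_1 $2$2)"
    "\<tau> e_m1_1 e_m1_2 $2$3 = - (\<tau> e_m2 e_m1_2 $1$1 + \<tau> e_m2 e_m1_2 $2$2)"
proof -
  note k = killing_eq in_so32 basis_in_so32 grade_mask_in_so32 mbracket_in_so32
  note e = grade_mask_nth weight_def mbracket_nth sum_5 so32_basis_defs elem_nth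
    so32_entries[OF in_so32[OF basis_in_so32(1) basis_in_so32(2)]]
    so32_entries[OF in_so32[OF basis_in_so32(1) basis_in_so32(3)]]
    so32_entries[OF in_so32[OF basis_in_so32(2) basis_in_so32(3)]]
  note c = codiff_killing_eqs[OF assms]
  show "\<tau> e_m1_1 e_m1_2 $1$3 = \<tau> e_m2 e_m1_1 $1$1 + \<tau> e_m2 e_m1_2 $1$2"
    using c(1)[OF basis_in_so32(2)] by (simp add: k) (simp add: e)
  show "\<tau> e_m1_1 e_m1_2 $2$3 = \<tau> e_m2 e_m1_1 $2$1 + \<tau> e_m2 e_m1_2 $2$2"
    using c(1)[OF basis_in_so32(3)] by (simp add: k) (simp add: e)
  show "\<tau> e_m1_1 e_m1_2 $1$3 = - (\<tau> e_m2 e_m1_1 $1$1 + \<tau> e_m2 e_m1_1 $2$2)"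
    using c(2)[OF basis_in_so32(1)] by (simp add: k) (simp add: e)
  show "\<tau> e_m1_1 e_m1_2 $2$3 = - (\<tau> e_m2 e_m1_2 $1$1 + \<tau> e_m2 e_m1_2 $2$2)"
    using c(3)[OF basis_in_so32(1)] by (simp add: k) (simp add: e)
qed

end

section \<open>The matrix exponential\<close>

definition mpow :: "rmat \<Rightarrow> nat \<Rightarrow> rmat" where
  "mpow X n = (((**) X) ^^ n) (mat 1)"

lemma mpow_simps: "mpow X 0 = mat 1" "mpow X (Suc n) = X ** mpow X n"
  by (simp_all add: mpow_def)

lemma mpow_scaleR: "mpow (t *\<^sub>R X) n = t ^ n *\<^sub>R mpow X n"
  by (induction n) (simp_all add: mpow_simps scalar_matrix_assoc matrix_scalar_ac vec_eq_iff
      matrix_matrix_mult_def sum_distrib_left mult_ac)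

lemma mpow_bound: "\<bar>mpow X n $ i $ j\<bar> \<le> (\<Sum>i\<in>UNIV. \<Sum>k\<in>UNIV. \<bar>X $ i $ k\<bar>) ^ n"
proof (induction n arbitrary: i j)
  case 0
  then show ?case by (simp add: mpow_simps mat_def)
next
  case (Suc n)
  let ?K = "\<Sum>i\<in>UNIV. \<Sum>k\<in>UNIV. \<bar>X $ i $ k\<bar>"
  have "\<bar>mpow X (Suc n) $ i $ j\<bar> \<le> (\<Sum>k\<in>UNIV. \<bar>X $ i $ k\<bar> * \<bar>mpow X n $ k $ j\<bar>)"
    by (simp add: mpow_simps matrix_matrix_mult_def abs_mult[symmetric] sum_abs)
  also have "\<dots> \<le> (\<Sum>k\<in>UNIV. \<bar>X $ i $ k\<bar> * ?K ^ n)"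
    by (intro sum_mono mult_left_mono Suc) auto
  also have "\<dots> = (\<Sum>k\<in>UNIV. \<bar>X $ i $ k\<bar>) * ?K ^ n" by (simp add: sum_distrib_right)
  also have "\<dots> \<le> ?K * ?K ^ n"
    by (intro mult_right_mono member_le_sum[of i UNIV "\<lambda>i. \<Sum>k\<in>UNIV. \<bar>X $ i $ k\<bar>"] zero_le_power sum_nonneg) (auto intro: sum_nonneg)
  finally show ?case by simp
qed

lemma mpow_summable: "summable (\<lambda>n. mpow X n $ i $ j / fact n * t ^ n)"
proof (rule summable_comparison_test)
  let ?K = "\<Sum>i\<in>UNIV. \<Sum>k\<in>UNIV. \<bar>X $ i $ k\<bar>"
  show "summable (\<lambda>n. inverse (fact n) * (?K * \<bar>t\<bar>) ^ n)" by (rule summable_exp)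
  have "norm (mpow X n $ i $ j / fact n * t ^ n) \<le> inverse (fact n) * (?K * \<bar>t\<bar>) ^ n" for n
    using mult_right_mono[OF mpow_bound[of X n i j], of "\<bar>t\<bar> ^ n / fact n"]
    by (simp add: abs_mult power_abs power_mult_distrib field_simps)
  then show "\<exists>N. \<forall>n\<ge>N. norm (mpow X n $ i $ j / fact n * t ^ n) \<le> inverse (fact n) * (?K * \<bar>t\<bar>) ^ n"
    by blast
qed

lemma mexp_nth: "mexp (t *\<^sub>R X) $ i $ j = (\<Sum>n. mpow X n $ i $ j / fact n * t ^ n)"
proof -
  define L :: rmat where "L = (\<chi> i j. \<Sum>n. mpow X n $ i $ j / fact n * t ^ n)"
  have "(\<lambda>n. (1 / fact n) *\<^sub>R (((**) (t *\<^sub>R X)) ^^ n) (mat 1)) sums L"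
    unfolding sums_def
  proof (intro vec_tendstoI)
    fix i j
    have "(\<lambda>n. mpow X n $ i $ j / fact n * t ^ n) sums (L $ i $ j)"
      using summable_sums[OF mpow_summable[of X i j t]] by (simp add: L_def)
    then show "(\<lambda>m. (\<Sum>n<m. (1 / fact n) *\<^sub>R (((**) (t *\<^sub>R X)) ^^ n) (mat 1)) $ i $ j) \<longlonglongrightarrow> L $ i $ j"
      by (simp add: sums_def mpow_def[symmetric] mpow_scaleR mult_ac)
  qed
  then have "mexp (t *\<^sub>R X) = L" unfolding mexp_def by (rule sums_unique[symmetric])
  then show ?thesis by (simp add: L_def)
qed

lemma mexp_0: "mexp 0 = mat 1"
  using mexp_nth[of 0 0] powser_zero[of "\<lambda>n. mpow 0 n $ _ $ _ / fact n"]
  by (simp add: vec_eq_iff mpow_simps)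

lemma mexp_has_derivative_nth:
  "((\<lambda>t. mexp (t *\<^sub>R X) $ i $ j) has_real_derivative (X ** mexp (t *\<^sub>R X)) $ i $ j) (at t)"
proof -
  let ?c = "\<lambda>n. mpow X n $ i $ j / fact n"
  have "((\<lambda>t. \<Sum>n. ?c n * t ^ n) has_real_derivative (\<Sum>n. diffs ?c n * t ^ n)) (at t)"
    by (rule termdiffs_strong_converges_everywhere) (rule mpow_summable)
  \<comment> \<open>The factor n + 1 in \<open>diffs\<close> cancels against the factorial, and one
    factor X splits off the power.\<close>
  also have "(\<Sum>n. diffs ?c n * t ^ n) = (\<Sum>n. \<Sum>k\<in>UNIV. X $ i $ k * (mpow X n $ k $ j / fact n * t ^ n))"
    by (intro suminf_cong) (simp add: diffs_def mpow_simps matrix_matrix_mult_def sum_distrib_right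
        sum_divide_distrib sum_distrib_left field_simps del: of_nat_Suc)
  also have "\<dots> = (\<Sum>k\<in>UNIV. X $ i $ k * (\<Sum>n. mpow X n $ k $ j / fact n * t ^ n))"
    by (simp only: suminf_sum[OF summable_mult[OF mpow_summable]] suminf_mult[OF mpow_summable])
  also have "\<dots> = (X ** mexp (t *\<^sub>R X)) $ i $ j"
    by (simp add: matrix_matrix_mult_def mexp_nth)
  finally show ?thesis by (simp add: mexp_nth)
qed

lemma mexp_has_vector_derivative:
  "((\<lambda>t. mexp (t *\<^sub>R X)) has_vector_derivative X ** mexp (t *\<^sub>R X)) (at t)"
proof -
  have expand: "(\<Sum>i\<in>UNIV. \<Sum>j\<in>UNIV. A$i$j *\<^sub>R \<epsilon> i j) = A" for A :: rmat
    by (simp add: vec_eq_iff forall_5 sum_5 elem_nth)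
  have "((\<lambda>t. \<Sum>i\<in>UNIV. \<Sum>j\<in>UNIV. mexp (t *\<^sub>R X) $i$j *\<^sub>R \<epsilon> i j) has_vector_derivative
    (\<Sum>i\<in>UNIV. \<Sum>j\<in>UNIV. (X ** mexp (t *\<^sub>R X)) $i$j *\<^sub>R \<epsilon> i j)) (at t)"
    using mexp_has_derivative_nth
    by (intro has_vector_derivative_sum bounded_linear.has_vector_derivative[OF bounded_linear_scaleR_left])
      (simp add: has_real_derivative_iff_has_vector_derivative)
  then show ?thesis by (simp only: expand)
qed

lemma continuous_on_mexp: "continuous_on S (\<lambda>t. mexp (t *\<^sub>R X))"
  using mexp_has_vector_derivative has_vector_derivative_continuous
  by (blast intro: continuous_at_imp_continuous_on)

section \<open>One-parameter subgroups of the isotropy group\<close>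

lemma bounded_bilinear_matrix_mult: "bounded_bilinear ((**) :: rmat \<Rightarrow> rmat \<Rightarrow> rmat)"
  by (rule bilinear_conv_bounded_bilinear[THEN iffD1])
    (simp add: bilinear_def linear_iff vec_eq_iff matrix_matrix_mult_def sum.distrib sum_distrib_left
      algebra_simps)

lemma has_vector_derivative_matrix_mult:
  fixes F G :: "real \<Rightarrow> rmat"
  assumes "(F has_vector_derivative F') (at t)" "(G has_vector_derivative G') (at t)"
  shows "((\<lambda>t. F t ** G t) has_vector_derivative F t ** G' + F' ** G t) (at t)"
  by (rule bounded_bilinear.has_vector_derivative[OF bounded_bilinear_matrix_mult assms])

text \<open>With E = exp(tX) and S the antidiagonal matrix, the derivative of E^T S E is E^T (X^T S
  + S X) E, which vanishes on \<open>so32\<close>; the constant is found at t = 0.\<close>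

lemma mexp_preserves_antidiag:
  assumes X: "X \<in> so32"
  shows "transpose (mexp (t *\<^sub>R X)) ** antidiag ** mexp (t *\<^sub>R X) = antidiag"
proof -
  let ?E = "\<lambda>t. mexp (t *\<^sub>R X)"
  have tr: "bounded_linear (transpose :: rmat \<Rightarrow> rmat)"
    by (rule linear_conv_bounded_linear[THEN iffD1]) (simp add: linear_iff transpose_def vec_eq_iff)
  have 1: "((\<lambda>t. transpose (?E t)) has_vector_derivative transpose (X ** ?E t)) (at t)" for t
    by (rule bounded_linear.has_vector_derivative[OF tr mexp_has_vector_derivative])
  have 2: "((\<lambda>t. antidiag ** ?E t) has_vector_derivative antidiag ** (X ** ?E t)) (at t)" for t
    using has_vector_derivative_matrix_mult[OF has_vector_derivative_const mexp_has_vector_derivative]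
    by simp
  have 3: "((\<lambda>t. transpose (?E t) ** (antidiag ** ?E t)) has_vector_derivative 0) (at t)" for t
  proof -
    have "transpose X ** antidiag + antidiag ** X = 0" using X by (simp add: so32_def)
    then have "transpose (?E t) ** ((transpose X ** antidiag + antidiag ** X) ** ?E t) = 0"
      by simp
    then have "transpose (?E t) ** (antidiag ** (X ** ?E t)) + transpose (X ** ?E t) ** (antidiag ** ?E t) = 0"
      by (simp add: matrix_transpose_mul matrix_mul_assoc add.commute
          bounded_bilinear.add_left[OF bounded_bilinear_matrix_mult]
          bounded_bilinear.add_right[OF bounded_bilinear_matrix_mult])
    then show ?thesis using has_vector_derivative_matrix_mult[OF 1 2, of t] by simp
  qed
  obtain c where c: "\<And>t. t \<in> UNIV \<Longrightarrow> transpose (?E t) ** (antidiag ** ?E t) = c"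
    using has_vector_derivative_zero_constant[OF convex_UNIV 3] by metis
  from c[of 0, OF UNIV_I] have "c = antidiag" by (simp add: mexp_0)
  then show ?thesis using c by (simp add: matrix_mul_assoc)
qed

text \<open>Invariance of the quadratic form only gives determinant 1 or -1. The determinant is
  continuous in t and equals 1 at t = 0, so the value -1 would force the value 0 in between.\<close>

lemma det_mexp:
  assumes X: "X \<in> so32"
  shows "det (mexp (t *\<^sub>R X)) = 1"
proof -
  let ?d = "\<lambda>t. det (mexp (t *\<^sub>R X))"
  have "antidiag ** antidiag = mat 1"
    by (simp add: vec_eq_iff forall_5 matrix_matrix_mult_def sum_5 antidiag_def elem_nth mat_def)
  then have "det antidiag * det antidiag = 1" using det_mul[of antidiag antidiag] by simp
  then have d0: "det antidiag \<noteq> 0" by auto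
  have pm: "?d t = 1 \<or> ?d t = -1" for t
  proof -
    have "?d t * det antidiag * ?d t = det antidiag"
      using arg_cong[OF mexp_preserves_antidiag[OF X, of t], of det] by (simp add: det_mul det_transpose)
    then have "?d t ^ 2 = 1" using d0 by (simp add: power2_eq_square)
    then show ?thesis by (simp add: power2_eq_1_iff)
  qed
  have "continuous_on UNIV ?d"
    unfolding det_def
    by (intro continuous_intros continuous_on_mexp)
  then have conn: "connected (range ?d)" by (rule connected_continuous_image) simp
  show ?thesis
  proof (rule ccontr)
    assume "?d t \<noteq> 1"
    then have "-1 \<in> range ?d" using pm[of t] by (metis rangeI)
    moreover have "1 \<in> range ?d" using rangeI[of ?d 0] by (simp add: mexp_0)
    ultimately have "{-1..1} \<subseteq> range ?d" by (rule connected_contains_Icc[OF conn])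
    then have "0 \<in> range ?d" by (rule subsetD) simp
    then obtain s where "0 = ?d s" by (rule rangeE)
    then show False using pm[of s] by simp
  qed
qed

text \<open>For a real matrix A these are the conditions that (1, i, 0, 0, 0) is an eigenvector,
  split into real and imaginary parts; the eigenvalue is A11 + i A12. They are linear and stable
  under products, and so pass to the exponential series.\<close>

definition parabolic_rel :: "rmat \<Rightarrow> bool" where
  "parabolic_rel A \<longleftrightarrow> A$3$1 = 0 \<and> A$3$2 = 0 \<and> A$4$1 = 0 \<and> A$4$2 = 0 \<and> A$5$1 = 0 \<and> A$5$2 = 0
    \<and> A$2$1 = - A$1$2 \<and> A$2$2 = A$1$1"

lemma parabolic_rel_base_point:
  assumes "parabolic_rel A"
  shows "cmat_of A *v base_point = Complex (A$1$1) (A$1$2) *s base_point"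
  using assms
  by (simp add: parabolic_rel_def vec_eq_iff forall_5 matrix_vector_mult_def sum_5 cmat_nth base_point_def
      vector_scalar_mult_def complex_eq_iff)

lemma parabolic_rel_mpow: "parabolic_rel X \<Longrightarrow> parabolic_rel (mpow X n)"
proof (induction n)
  case 0
  then show ?case by (simp add: parabolic_rel_def mpow_simps mat_def)
next
  case (Suc n)
  then show ?case by (simp add: parabolic_rel_def mpow_simps matrix_matrix_mult_def sum_5)
qed

lemma parabolic_rel_mexp: "parabolic_rel X \<Longrightarrow> parabolic_rel (mexp (t *\<^sub>R X))"
  using parabolic_rel_mpow[of X] mpow_summable[of X 1 2 t]
  by (simp add: parabolic_rel_def mexp_nth suminf_minus)

lemma lie_H_iff: "X \<in> lie_H \<longleftrightarrow> X \<in> so32 \<and> parabolic_rel X"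
proof
  assume X: "X \<in> lie_H"
  have "subspace {X. X \<in> so32 \<and> parabolic_rel X}"
    using subspace_so32 by (auto simp: subspace_def parabolic_rel_def)
  moreover have "{E_0_1, E_0_2, E_1_1, E_1_2, E_2} \<subseteq> {X. X \<in> so32 \<and> parabolic_rel X}"
    by (simp add: basis_in_so32) (simp add: parabolic_rel_def so32_basis_defs elem_nth)
  ultimately show "X \<in> so32 \<and> parabolic_rel X"
    using X span_minimal unfolding lie_H_def by blast
next
  assume X: "X \<in> so32 \<and> parabolic_rel X"
  then have "X = ((X$1$1 + X$2$2)/2) *\<^sub>R E_0_1 + ((X$1$2 - X$2$1)/2) *\<^sub>R E_0_2
      + X$1$3 *\<^sub>R E_1_1 + X$2$3 *\<^sub>R E_1_2 + X$1$4 *\<^sub>R E_2"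
    using so32_expand[of X] by (simp add: parabolic_rel_def)
  also have "\<dots> \<in> lie_H"
    unfolding lie_H_def by (intro span_add span_scale span_base) auto
  finally show "X \<in> lie_H" .
qed

text \<open>The image of the line under the exponential is a connected set through the identity
  matrix, which puts the whole curve into the identity component.\<close>

lemma mexp_in_grp_H:
  assumes "X \<in> lie_H"
  shows "mexp (t *\<^sub>R X) \<in> grp_H"
proof -
  have X: "X \<in> so32" "parabolic_rel X" using assms lie_H_iff by auto
  let ?E = "\<lambda>t. mexp (t *\<^sub>R X)" and ?S = "{X. det X = 1 \<and> transpose X ** antidiag ** X = antidiag}"
  have "connected (range ?E)" by (rule connected_continuous_image[OF continuous_on_mexp]) simp
  moreover have "range ?E \<subseteq> ?S" using det_mexp[OF X(1)] mexp_preserves_antidiag[OF X(1)] by auto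
  moreover have "mat 1 \<in> range ?E" using rangeI[of ?E 0] by (simp add: mexp_0)
  ultimately have "connected_component ?S (mat 1) (?E t)"
    unfolding connected_component_def by (intro exI[of _ "range ?E"]) simp
  then have "?E t \<in> SO32o" by (simp add: SO32o_def)
  then show ?thesis
    using parabolic_rel_base_point[OF parabolic_rel_mexp[OF X(2)]] unfolding grp_H_def by blast
qed

section \<open>Horizontality of the curvature\<close>

locale cartan =
  fixes A :: "('m::{t2_space, second_countable_topology}, real^5) chart set"
    and B :: "('q::{t2_space, second_countable_topology}, real^10) chart set"
    and \<pi> :: "'q \<Rightarrow> 'm" and act :: "'q \<Rightarrow> rmat \<Rightarrow> 'q" and \<omega> :: "'q \<Rightarrow> real^10 \<Rightarrow> rmat"
  assumes cartan: "cartan_connection A B \<pi> act \<omega>"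
begin

lemma atlas: "smooth_atlas B"
  using cartan unfolding cartan_connection_def principal_H_bundle_def by blast

lemma smooth_omega: "smooth_form_on B UNIV \<omega>"
  using cartan unfolding cartan_connection_def by blast

lemma linear_omega: "linear (\<omega> u)"
  using smooth_omega unfolding smooth_form_on_def by blast

lemma bij_omega: "bij_betw (\<omega> u) UNIV so32"
  using cartan unfolding cartan_connection_def by blast

lemma omega_in_so32: "\<omega> u v \<in> so32"
  using bij_omega[of u] by (auto simp: bij_betw_def)

lemma inj_omega: "inj (\<omega> u)"
  using bij_omega[of u] by (simp add: bij_betw_def)

lemma omega_inv: "X \<in> so32 \<Longrightarrow> \<omega> u (inv (\<omega> u) X) = X"
  using bij_omega[of u] by (metis bij_betw_def f_inv_into_f)

lemma inv_omega: "inv (\<omega> u) (\<omega> u v) = v"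
  using inj_omega by (rule inv_f_f)

lemma act_one: "act u (mat 1) = u"
  using cartan unfolding cartan_connection_def principal_H_bundle_def by blast

text \<open>The action in the chart c is replaced by a smooth function G on an open set of pairs of
  a coordinate and an arbitrary matrix. By continuity there is a product neighbourhood
  \<open>U \<times> V\<close> of the coordinate of u and t = 0 on which (p, exp(tX)) stays in the
  domain of G and the action does not leave the chart.\<close>

lemma local_action:
  assumes X: "X \<in> lie_H" and c: "c \<in> B" "u \<in> fst c"
  obtains W G U V where "open W" "smooth_on W G" "open U" "snd c u \<in> U" "U \<subseteq> snd c ` fst c"
    "open V" "(0::real) \<in> V"
    "\<And>p t. p \<in> U \<Longrightarrow> t \<in> V \<Longrightarrow> (p, mexp (t *\<^sub>R X)) \<in> W
      \<and> act (inv_chart c p) (mexp (t *\<^sub>R X)) \<in> fst c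
      \<and> G (p, mexp (t *\<^sub>R X)) = snd c (act (inv_chart c p) (mexp (t *\<^sub>R X)))"
proof -
  let ?P = "snd c ` fst c" and ?h = "\<lambda>t. mexp (t *\<^sub>R X)"
  define S where "S = {(p, h). p \<in> ?P \<and> h \<in> grp_H \<and> act (inv_chart c p) h \<in> fst c}"
  have h: "?h t \<in> grp_H" for t by (rule mexp_in_grp_H[OF X])
  have one: "mat 1 \<in> grp_H" using h[of 0] by (simp add: mexp_0)
  have "smooth_on S (\<lambda>(p, h). snd c (act (inv_chart c p) h))"
    using cartan c(1) unfolding cartan_connection_def principal_H_bundle_def S_def by blast
  moreover have "(snd c u, mat 1) \<in> S"
    using c one by (simp add: S_def act_one inv_chart_chart[OF atlas])
  ultimately obtain W G where W: "open W" "(snd c u, mat 1) \<in> W" "\<forall>k. Ck_on k G W"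
    "\<forall>q\<in>S \<inter> W. G q = (case q of (p, h) \<Rightarrow> snd c (act (inv_chart c p) h))"
    unfolding smooth_on_def by meson
  have G: "smooth_on W G" unfolding smooth_on_def using W by blast
  have act: "continuous_on (UNIV \<times> grp_H) (\<lambda>(u, h). act u h)"
    using cartan unfolding cartan_connection_def principal_H_bundle_def by blast
  have P: "open ?P" by (rule smooth_atlas_chartD(2)[OF atlas c(1)])
  have hcont: "continuous_on S' (\<lambda>q. ?h (snd q))" for S' :: "((real^10) \<times> real) set"
    by (rule continuous_on_compose2[OF continuous_on_mexp[of UNIV]]) (auto intro!: continuous_intros)
  have inv: "continuous_on ?P (inv_chart c)"
    using smooth_atlas_chartD(3)[OF atlas c(1)] homeomorphism_cont2 by blast
  have "continuous_on (?P \<times> UNIV) (\<lambda>q. inv_chart c (fst q))"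
    by (rule continuous_on_compose2[OF inv]) (auto intro!: continuous_intros)
  then have "continuous_on (?P \<times> UNIV) (\<lambda>q. (\<lambda>(u, h). act u h) (inv_chart c (fst q), ?h (snd q)))"
    by (intro continuous_on_compose2[OF act] continuous_on_Pair hcont) (use h in auto)
  then have "open ((?P \<times> UNIV) \<inter> (\<lambda>q. (\<lambda>(u, h). act u h) (inv_chart c (fst q), ?h (snd q))) -` fst c)"
    using smooth_atlas_chartD(1)[OF atlas c(1)] P by (intro continuous_open_preimage open_Times) auto
  moreover have "open ((\<lambda>q. (fst q, ?h (snd q))) -` W)"
    by (rule open_vimage[OF W(1)]) (intro continuous_on_Pair hcont continuous_intros)
  ultimately have "open ((?P \<times> UNIV) \<inter> (\<lambda>q. (\<lambda>(u, h). act u h) (inv_chart c (fst q), ?h (snd q))) -` fst c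
      \<inter> (\<lambda>q. (fst q, ?h (snd q))) -` W)" (is "open ?N")
    by (rule open_Int)
  moreover have "(snd c u, 0) \<in> ?N"
    using c W(2) by (simp add: mexp_0 act_one inv_chart_chart[OF atlas])
  ultimately obtain U V where UV: "open U" "open V" "(snd c u, 0) \<in> U \<times> V" "U \<times> V \<subseteq> ?N"
    by (rule open_prod_elim)
  show thesis
  proof (rule that[OF W(1) G UV(1) _ _ UV(2)])
    show "snd c u \<in> U" "0 \<in> V" using UV(3) by auto
    show "U \<subseteq> ?P" using UV(3,4) by blast
    fix p t assume "p \<in> U" "t \<in> V"
    then have "(p, t) \<in> ?N" using UV(4) by blast
    then have "(p, ?h t) \<in> W" "act (inv_chart c p) (?h t) \<in> fst c" "p \<in> ?P" by auto
    then show "(p, ?h t) \<in> W \<and> act (inv_chart c p) (?h t) \<in> fst c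
      \<and> G (p, ?h t) = snd c (act (inv_chart c p) (?h t))"
      using W(4) h[of t] by (auto simp: S_def)
  qed
qed

text \<open>Two identities are differentiated. That the fundamental vector field of X has constant
  value X under the form holds near u and is differentiated in the direction v; equivariance along
  exp(tX) is differentiated at t = 0. Both results contain the same mixed second derivative of G,
  and eliminating it leaves the exterior derivative.\<close>

lemma ext_d_vertical:
  assumes X: "X \<in> lie_H" and \<xi>: "\<omega> u \<xi> = X"
  shows "ext_d B \<omega> u \<xi> v = - mbracket X (\<omega> u v)"
proof -
  define c where "c = chart_at B u"
  note c = chart_at_in_atlas[OF atlas, of u, folded c_def]
  let ?h = "\<lambda>t. mexp (t *\<^sub>R X)" and ?P = "snd c ` fst c" and ?F = "form_rep B c \<omega>"
  define p where "p = snd c u"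
  obtain W G U V where W: "open W" and G: "smooth_on W G" and U: "open U" "p \<in> U" "U \<subseteq> ?P"
    and V: "open V" "0 \<in> V" and UV: "\<And>p t. p \<in> U \<Longrightarrow> t \<in> V \<Longrightarrow> (p, ?h t) \<in> W
      \<and> act (inv_chart c p) (?h t) \<in> fst c \<and> G (p, ?h t) = snd c (act (inv_chart c p) (?h t))"
    unfolding p_def using local_action[OF X c] by metis
  define D where "D q = frechet_derivative G (at q)" for q
  have GD: "(G has_derivative D q) (at q)" if "q \<in> W" for q
    unfolding D_def by (rule smooth_on_has_derivative[OF W G that])
  have lin: "linear (D q)" if "q \<in> W" for q using has_derivative_linear[OF GD[OF that]] .
  have P: "open ?P" by (rule smooth_atlas_chartD(2)[OF atlas c(1)])
  have UW: "(q, mat 1) \<in> W" if "q \<in> U" for q using UV[OF that V(2)] by (simp add: mexp_0)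
  have G1: "G (q, mat 1) = q" if "q \<in> U" for q
    using UV[OF that V(2)] U(3) that chart_inv_chart(1)[OF atlas c(1)] by (auto simp: mexp_0 act_one)
  have Glift: "inv_chart c (G (q, ?h t)) = act (inv_chart c q) (?h t)" if "q \<in> U" "t \<in> V" for q t
    using UV[OF that] inv_chart_chart[OF atlas c(1)] by simp
  have hD: "(?h has_derivative (\<lambda>s. s *\<^sub>R (X ** ?h t))) (at t)" for t
    using mexp_has_vector_derivative by (simp add: has_vector_derivative_def)
  have hD0: "(?h has_derivative (\<lambda>s. s *\<^sub>R X)) (at 0)"
    using hD[of 0] by (simp add: mexp_0)
  have curve: "((\<lambda>t. (q, ?h t)) has_derivative (\<lambda>s. (0, s *\<^sub>R X))) (at 0)" for q :: "real^10"
    by (intro has_derivative_Pair has_derivative_const hD0)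
  have slice: "((\<lambda>q. (q, k)) has_derivative (\<lambda>z. (z, 0))) (at q)" for q :: "real^10" and k :: rmat
    by (intro has_derivative_Pair has_derivative_const has_derivative_ident)

  \<comment> \<open>In the chart the fundamental vector field at q is the derivative of G at (q, 1)
    in the group direction X.\<close>
  have fundamental: "?F q (D (q, mat 1) (0, X)) = X" if q: "q \<in> U" for q
  proof -
    define w where "w = inv_chart c q"
    have w: "w \<in> fst c" "snd c w = q"
      using U(3) q chart_inv_chart[OF atlas c(1)] by (auto simp: w_def)
    let ?k = "snd (chart_at B w)"
    have "((\<lambda>t. G (q, ?h t)) has_derivative (\<lambda>s. D (q, mat 1) (0, s *\<^sub>R X))) (at 0)"
      by (rule has_derivative_compose[OF curve]) (simp add: mexp_0 GD UW q)
    moreover have "(?k \<circ> inv_chart c has_derivative from_coord B c w) (at (G (q, ?h 0)))"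
      using from_coord_has_derivative[OF atlas c(1) w(1)] by (simp add: mexp_0 G1[OF q] w(2))
    ultimately have "((\<lambda>t. (?k \<circ> inv_chart c) (G (q, ?h t))) has_derivative
        (\<lambda>s. from_coord B c w (D (q, mat 1) (0, s *\<^sub>R X)))) (at 0)"
      by (rule has_derivative_compose)
    then have "(?k \<circ> (\<lambda>t. act w (?h t)) has_derivative
        (\<lambda>s. from_coord B c w (D (q, mat 1) (0, s *\<^sub>R X)))) (at 0)"
      by (rule has_derivative_transform_within_open[OF _ V]) (simp add: Glift[OF q] w_def)
    moreover have "from_coord B c w (D (q, mat 1) (0, s *\<^sub>R X))
        = s *\<^sub>R from_coord B c w (D (q, mat 1) (0, X))" for s
      using linear_cmul[OF lin[OF UW[OF q]], of s "(0, X)"]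
        linear_cmul[OF linear_from_coord[OF atlas c(1) w(1)]] by simp
    ultimately have "(?k \<circ> (\<lambda>t. act w (?h t)) has_vector_derivative
        from_coord B c w (D (q, mat 1) (0, X))) (at 0)"
      by (simp add: has_vector_derivative_def)
    then have "velocity B (\<lambda>t. act w (?h t)) = from_coord B c w (D (q, mat 1) (0, X))"
      unfolding velocity_def by (simp add: mexp_0 act_one vector_derivative_at)
    moreover have "\<omega> w (velocity B (\<lambda>t. act w (?h t))) = X"
      using cartan X unfolding cartan_connection_def by blast
    ultimately show ?thesis by (simp add: form_rep_def w_def)
  qed

  \<comment> \<open>The inverse in the adjoint action is moved to the other side, so that no inverse
    has to be differentiated.\<close>
  have equivariance: "?h t ** ?F (G (p, ?h t)) (D (p, ?h t) (v, 0)) = \<omega> u v ** ?h t" if t: "t \<in> V" for t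
  proof -
    have inv_p: "inv_chart c p = u" unfolding p_def by (rule inv_chart_chart[OF atlas c])
    define w where "w = act u (?h t)"
    have w: "w \<in> fst c" "G (p, ?h t) = snd c w" "(p, ?h t) \<in> W"
      using UV[OF U(2) t] by (auto simp: w_def inv_p)
    let ?k = "snd (chart_at B w)"
    have "((\<lambda>q. G (q, ?h t)) has_derivative (\<lambda>z. D (p, ?h t) (z, 0))) (at p)"
      by (rule has_derivative_compose[OF slice]) (simp add: GD w(3))
    moreover have "(?k \<circ> inv_chart c has_derivative from_coord B c w) (at (G (p, ?h t)))"
      using from_coord_has_derivative[OF atlas c(1) w(1)] by (simp add: w(2))
    ultimately have "((\<lambda>q. (?k \<circ> inv_chart c) (G (q, ?h t))) has_derivative
        (\<lambda>z. from_coord B c w (D (p, ?h t) (z, 0)))) (at p)"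
      by (rule has_derivative_compose)
    then have "(?k \<circ> (\<lambda>w. act w (?h t)) \<circ> inv_chart c has_derivative
        (\<lambda>z. from_coord B c w (D (p, ?h t) (z, 0)))) (at p)"
      by (rule has_derivative_transform_within_open[OF _ U(1,2)]) (simp add: Glift[OF _ t])
    from fun_cong[OF frechet_derivative_at[OF this], of v]
    have "differential B B (\<lambda>w. act w (?h t)) u v = from_coord B c w (D (p, ?h t) (v, 0))"
      by (simp add: differential_def c_def[symmetric] p_def[symmetric] w_def[symmetric])
    moreover have "\<omega> (act u (?h t)) (differential B B (\<lambda>w. act w (?h t)) u v)
        = matrix_inv (?h t) ** \<omega> u v ** ?h t"
      using cartan mexp_in_grp_H[OF X] unfolding cartan_connection_def by blast
    ultimately have "?F (G (p, ?h t)) (D (p, ?h t) (v, 0)) = matrix_inv (?h t) ** \<omega> u v ** ?h t"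
      by (simp add: form_rep_def w(2) inv_chart_chart[OF atlas c(1) w(1), unfolded w_def] w_def)
    moreover have "?h t ** matrix_inv (?h t) = mat 1"
    proof -
      have "det (?h t) = 1" by (rule det_mexp) (use X lie_H_iff in auto)
      then have "invertible (?h t)" by (simp add: invertible_det_nz)
      then have "\<exists>k. ?h t ** k = mat 1 \<and> k ** ?h t = mat 1" by (simp add: invertible_def)
      from someI_ex[OF this] show ?thesis by (simp add: matrix_inv_def)
    qed
    ultimately show ?thesis by (simp add: matrix_mul_assoc)
  qed

  define F' where "F' v = frechet_derivative (\<lambda>q. ?F q v) (at p)" for v
  have F': "((\<lambda>q. ?F q v) has_derivative F' v) (at p)" for v
    unfolding F'_def by (rule form_rep_has_derivative[OF atlas c(1) smooth_omega]) (use U in auto)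
  have Flin: "linear (?F q)" if "q \<in> ?P" for q
    by (rule linear_form_rep[OF atlas c(1) that linear_omega])
  have Fp: "?F p z = \<omega> u z" for z
    unfolding p_def c_def by (rule form_rep_chart_at[OF atlas])
  define D2 where "D2 a b = frechet_derivative (\<lambda>q. D q a) (at (p, mat 1)) b" for a b
  have D2: "((\<lambda>q. D q a) has_derivative D2 a) (at (p, mat 1))" for a
    unfolding D2_def D_def
    by (rule smooth_on_has_derivative[OF W smooth_on_frechet_derivative[OF W G] UW[OF U(2)]])
  have sym: "D2 a b = D2 b a" for a b
    unfolding D2_def D_def by (rule smooth_on_symmetric_second_derivative[OF W UW[OF U(2)] G])
  have Dv: "D (p, mat 1) (z, 0) = z" for z
  proof -
    have "((\<lambda>q. G (q, mat 1)) has_derivative (\<lambda>z. D (p, mat 1) (z, 0))) (at p)"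
      by (rule has_derivative_compose[OF slice]) (rule GD[OF UW[OF U(2)]])
    then have "((\<lambda>q. q) has_derivative (\<lambda>z. D (p, mat 1) (z, 0))) (at p)"
      by (rule has_derivative_transform_within_open[OF _ U(1,2)]) (rule G1)
    from has_derivative_unique[OF this has_derivative_ident] show ?thesis by metis
  qed
  \<comment> \<open>The form is injective at u, so its value X determines the vector.\<close>
  have D\<xi>: "D (p, mat 1) (0, X) = \<xi>"
    using fundamental[OF U(2)] \<xi> inj_omega[of u] by (metis Fp injD)

  \<comment> \<open>The identity \<open>fundamental\<close> is differentiated in the direction v;
    its right-hand side is constant.\<close>
  have "((\<lambda>q. ?F q (D (q, mat 1) (0, X))) has_derivative
      (\<lambda>z. F' (D (p, mat 1) (0, X)) z + ?F p (D2 (0, X) (z, 0)))) (at p)"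
  proof (rule has_derivative_fibrewise_linear[where F = ?F and \<psi> = "\<lambda>q. q"
        and \<nu> = "\<lambda>q. D (q, mat 1) (0, X)", OF P])
    show "((\<lambda>q. D (q, mat 1) (0, X)) has_derivative (\<lambda>z. D2 (0, X) (z, 0))) (at p)"
      by (rule has_derivative_compose[OF slice D2])
  qed (use U Flin F' in auto)
  then have "((\<lambda>q. X) has_derivative
      (\<lambda>z. F' (D (p, mat 1) (0, X)) z + ?F p (D2 (0, X) (z, 0)))) (at p)"
    by (rule has_derivative_transform_within_open[OF _ U(1,2)]) (rule fundamental)
  from fun_cong[OF has_derivative_unique[OF this has_derivative_const], of v]
  have 1: "F' \<xi> v + \<omega> u (D2 (0, X) (v, 0)) = 0" by (simp add: D\<xi> Fp)

  \<comment> \<open>Now the identity \<open>equivariance\<close> is differentiated in t at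
    0.\<close>
  have "((\<lambda>t. ?F (G (p, ?h t)) (D (p, ?h t) (v, 0))) has_derivative
      (\<lambda>s. F' (D (p, ?h 0) (v, 0)) (D (p, mat 1) (0, s *\<^sub>R X))
        + ?F (G (p, ?h 0)) (D2 (v, 0) (0, s *\<^sub>R X)))) (at 0)"
  proof (rule has_derivative_fibrewise_linear[where F = ?F and \<psi> = "\<lambda>t. G (p, ?h t)"
        and \<nu> = "\<lambda>t. D (p, ?h t) (v, 0)", OF P])
    show "G (p, ?h 0) \<in> ?P" using U by (auto simp: mexp_0 G1)
    show "((\<lambda>q. ?F q v) has_derivative F' v) (at (G (p, ?h 0)))" for v
      using F' U(2) by (simp add: mexp_0 G1)
    show "((\<lambda>t. G (p, ?h t)) has_derivative (\<lambda>s. D (p, mat 1) (0, s *\<^sub>R X))) (at 0)"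
      by (rule has_derivative_compose[OF curve]) (simp add: mexp_0 GD UW U(2))
    show "((\<lambda>t. D (p, ?h t) (v, 0)) has_derivative (\<lambda>s. D2 (v, 0) (0, s *\<^sub>R X))) (at 0)"
      by (rule has_derivative_compose[OF curve]) (simp add: mexp_0 D2)
  qed (rule Flin)
  then have Lder: "((\<lambda>t. ?F (G (p, ?h t)) (D (p, ?h t) (v, 0))) has_vector_derivative
      F' v \<xi> + \<omega> u (D2 (v, 0) (0, X))) (at 0)"
  proof -
    have "D (p, mat 1) (0, s *\<^sub>R X) = s *\<^sub>R \<xi>" for s
      using linear_cmul[OF lin[OF UW[OF U(2)]], of s "(0, X)"] by (simp add: D\<xi>)
    moreover have "D2 (v, 0) (0, s *\<^sub>R X) = s *\<^sub>R D2 (v, 0) (0, X)" for s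
      using linear_cmul[OF has_derivative_linear[OF D2[of "(v, 0)"]], of s "(0, X)"] by simp
    moreover have "F' v (s *\<^sub>R \<xi>) = s *\<^sub>R F' v \<xi>" for s
      using linear_cmul[OF has_derivative_linear[OF F'[of v]]] by simp
    moreover assume "((\<lambda>t. ?F (G (p, ?h t)) (D (p, ?h t) (v, 0))) has_derivative
      (\<lambda>s. F' (D (p, ?h 0) (v, 0)) (D (p, mat 1) (0, s *\<^sub>R X))
        + ?F (G (p, ?h 0)) (D2 (v, 0) (0, s *\<^sub>R X)))) (at 0)"
    ultimately show ?thesis
      by (simp add: has_vector_derivative_def mexp_0 Dv G1[OF U(2)] Fp linear_cmul[OF linear_omega]
          scaleR_add_right)
  qed
  have hv: "(?h has_vector_derivative X) (at 0)"
    using hD0 by (simp add: has_vector_derivative_def)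
  have "((\<lambda>t. ?h t ** ?F (G (p, ?h t)) (D (p, ?h t) (v, 0))) has_vector_derivative
      ?h 0 ** (F' v \<xi> + \<omega> u (D2 (v, 0) (0, X))) + X ** ?F (G (p, ?h 0)) (D (p, ?h 0) (v, 0))) (at 0)"
    by (rule has_vector_derivative_matrix_mult[OF hv Lder])
  then have "((\<lambda>t. \<omega> u v ** ?h t) has_vector_derivative
      ?h 0 ** (F' v \<xi> + \<omega> u (D2 (v, 0) (0, X))) + X ** ?F (G (p, ?h 0)) (D (p, ?h 0) (v, 0))) (at 0)"
    by (rule has_vector_derivative_transform_within_open[OF _ V]) (rule equivariance)
  moreover have "((\<lambda>t. \<omega> u v ** ?h t) has_vector_derivative \<omega> u v ** X + 0 ** ?h 0) (at 0)"
    by (rule has_vector_derivative_matrix_mult[OF has_vector_derivative_const hv])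
  ultimately have "?h 0 ** (F' v \<xi> + \<omega> u (D2 (v, 0) (0, X))) + X ** ?F (G (p, ?h 0)) (D (p, ?h 0) (v, 0))
      = \<omega> u v ** X + 0 ** ?h 0"
    by (rule vector_derivative_unique_at)
  then have 2: "F' v \<xi> + \<omega> u (D2 (v, 0) (0, X)) + X ** \<omega> u v = \<omega> u v ** X"
    by (simp add: mexp_0 G1[OF U(2)] Fp Dv)
  \<comment> \<open>Symmetry of \<open>D2\<close> allows the mixed derivative to be replaced by its
    value from the first identity.\<close>
  have 3: "\<omega> u (D2 (v, 0) (0, X)) = - F' \<xi> v"
    using 1 sym[of "(v, 0)" "(0, X)"] by (simp add: eq_neg_iff_add_eq_0 add.commute)
  have "ext_d B \<omega> u \<xi> v = F' v \<xi> - F' \<xi> v"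
    by (simp add: ext_d_def Let_def F'_def c_def p_def)
  also have "\<dots> = \<omega> u v ** X - X ** \<omega> u v"
    unfolding 2[symmetric] 3 by simp
  finally show ?thesis by (simp add: mbracket_def)
qed

lemma curvature_vertical:
  assumes "\<omega> u \<xi> \<in> lie_H"
  shows "curvature B \<omega> u \<xi> v = 0"
  using ext_d_vertical[OF assms refl] by (simp add: curvature_def)

end

section \<open>Curvature components\<close>

context cartan
begin

text \<open>The curvature read on the Lie algebra through the frame. As
  \<open>inv (\<omega> u)\<close> is meaningful only on the image \<open>so32\<close> of
  \<open>\<omega> u\<close>, the algebraic laws below carry membership premises.\<close>

definition kappa :: "'q \<Rightarrow> rmat \<Rightarrow> rmat \<Rightarrow> rmat" where
  "kappa u X Y = curvature B \<omega> u (inv (\<omega> u) X) (inv (\<omega> u) Y)"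

lemma form_rep_omega_has_derivative:
  "((\<lambda>q. form_rep B (chart_at B u) \<omega> q v) has_derivative
    frechet_derivative (\<lambda>q. form_rep B (chart_at B u) \<omega> q v) (at (snd (chart_at B u) u)))
    (at (snd (chart_at B u) u))"
  by (rule form_rep_has_derivative[OF atlas _ smooth_omega]) (use chart_at_in_atlas[OF atlas, of u] in auto)

text \<open>A vector enters \<open>ext_d\<close> in one term as the argument of the form and in the
  other as the direction of differentiation. Linearity in the argument is obtained by
  differentiating the linearity of the form at nearby points.\<close>

lemma linear_form_rep_derivative:
  "linear (\<lambda>v. frechet_derivative (\<lambda>q. form_rep B (chart_at B u) \<omega> q v) (at (snd (chart_at B u) u)) w)"
proof -
  define c where "c = chart_at B u"
  note c = chart_at_in_atlas[OF atlas, of u, folded c_def]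
  define F where "F = form_rep B c \<omega>"
  define p where "p = snd c u"
  have D: "((\<lambda>q. F q v) has_derivative frechet_derivative (\<lambda>q. F q v) (at p)) (at p)" for v
    using form_rep_omega_has_derivative by (simp add: F_def p_def c_def)
  have P: "open (snd c ` fst c)" "p \<in> snd c ` fst c"
    using smooth_atlas_chartD(2)[OF atlas c(1)] c by (auto simp: p_def)
  have lin: "linear (F q)" if "q \<in> snd c ` fst c" for q
    unfolding F_def by (rule linear_form_rep[OF atlas c(1) that linear_omega])
  have "frechet_derivative (\<lambda>q. F q (v + v')) (at p) w
      = frechet_derivative (\<lambda>q. F q v) (at p) w + frechet_derivative (\<lambda>q. F q v') (at p) w" for v v'
  proof -
    have "((\<lambda>q. F q (v + v')) has_derivative
      (\<lambda>w. frechet_derivative (\<lambda>q. F q v) (at p) w + frechet_derivative (\<lambda>q. F q v') (at p) w)) (at p)"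
      by (rule has_derivative_transform_within_open[OF has_derivative_add[OF D D] P])
        (simp add: linear_add[OF lin])
    from fun_cong[OF frechet_derivative_at[OF this], of w] show ?thesis by (rule sym)
  qed
  moreover have "frechet_derivative (\<lambda>q. F q (r *\<^sub>R v)) (at p) w
      = r *\<^sub>R frechet_derivative (\<lambda>q. F q v) (at p) w" for r v
  proof -
    have "((\<lambda>q. F q (r *\<^sub>R v)) has_derivative (\<lambda>w. r *\<^sub>R frechet_derivative (\<lambda>q. F q v) (at p) w)) (at p)"
      by (rule has_derivative_transform_within_open[OF has_derivative_scaleR_right[OF D] P])
        (simp add: linear_cmul[OF lin])
    from fun_cong[OF frechet_derivative_at[OF this], of w] show ?thesis by (rule sym)
  qed
  ultimately show ?thesis unfolding F_def p_def c_def by (rule linearI)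
qed

lemma linear_form_rep_derivative':
  "linear (frechet_derivative (\<lambda>q. form_rep B (chart_at B u) \<omega> q v) (at (snd (chart_at B u) u)))"
  using has_derivative_linear[OF form_rep_omega_has_derivative] .

lemma linear_ext_d: "linear (\<lambda>v. ext_d B \<omega> u v w)"
  unfolding ext_d_def Let_def
  by (intro linear_compose_sub linear_form_rep_derivative linear_form_rep_derivative')

lemma curvature_antisym: "curvature B \<omega> u w v = - curvature B \<omega> u v w"
  by (simp add: curvature_def ext_d_def Let_def mbracket_def)

lemma linear_mbracket: "linear (\<lambda>X. mbracket X Y)"
  by (simp add: linear_iff vec_eq_iff mbracket_nth sum_distrib_left sum.distrib sum_subtractf algebra_simps)

lemma linear_curvature_left: "linear (\<lambda>v. curvature B \<omega> u v w)"
  unfolding curvature_def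
  by (intro linear_compose_add linear_ext_d linear_compose[OF linear_omega linear_mbracket, unfolded comp_def])

lemma linear_curvature_right: "linear (\<lambda>w. curvature B \<omega> u v w)"
  using linear_compose_neg[OF linear_curvature_left[of u v]] by (simp add: curvature_antisym[of u _ v])

lemma bilinear_curvature: "bilinear (curvature B \<omega> u)"
  unfolding bilinear_def using linear_curvature_left linear_curvature_right by blast

text \<open>The form takes values in \<open>so32\<close>, hence is fixed by the linear map
  \<open>Pr\<close> onto this subspace; its derivatives are then fixed by \<open>Pr\<close> as
  well.\<close>

lemma ext_d_in_so32: "ext_d B \<omega> u v w \<in> so32"
proof -
  define c where "c = chart_at B u"
  note c = chart_at_in_atlas[OF atlas, of u, folded c_def]
  define F where "F = form_rep B c \<omega>"
  define p where "p = snd c u"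
  define Pr where "Pr X = (\<Sum>i<10. basis_coord i X *\<^sub>R basis_elem i)" for X
  have Pr: "bounded_linear Pr"
    unfolding Pr_def
    by (intro bounded_linear_sum bounded_linear_compose[OF bounded_linear_scaleR_left]
        linear_conv_bounded_linear[THEN iffD1] linear_basis_coord) simp
  have Pr_so32: "Pr X \<in> so32" for X
    unfolding Pr_def so32_eq_span so32_basis_image by (intro span_sum span_scale span_base) auto
  have D: "((\<lambda>q. F q v) has_derivative frechet_derivative (\<lambda>q. F q v) (at p)) (at p)" for v
    using form_rep_omega_has_derivative by (simp add: F_def p_def c_def)
  have PrF: "Pr (F q v) = F q v" for q v
    unfolding Pr_def F_def form_rep_def by (rule so32_expand_basis[OF omega_in_so32, symmetric])
  have "((\<lambda>q. F q v) has_derivative (\<lambda>w. Pr (frechet_derivative (\<lambda>q. F q v) (at p) w))) (at p)" for v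
    using bounded_linear.has_derivative[OF Pr D, of v] by (simp add: PrF)
  from fun_cong[OF has_derivative_unique[OF D this]]
  have "frechet_derivative (\<lambda>q. F q v) (at p) w = Pr (frechet_derivative (\<lambda>q. F q v) (at p) w)" for v w .
  then have "frechet_derivative (\<lambda>q. F q v) (at p) w \<in> so32" for v w
    using Pr_so32 by metis
  then show ?thesis
    unfolding ext_d_def Let_def F_def p_def c_def by (intro subspace_diff[OF subspace_so32])
qed

lemma curvature_in_so32: "curvature B \<omega> u v w \<in> so32"
  unfolding curvature_def
  by (intro subspace_add[OF subspace_so32] ext_d_in_so32 mbracket_in_so32 omega_in_so32)

lemma inv_omega_add: "X \<in> so32 \<Longrightarrow> Y \<in> so32 \<Longrightarrow> inv (\<omega> u) (X + Y) = inv (\<omega> u) X + inv (\<omega> u) Y"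
  using inv_omega[of u "inv (\<omega> u) X + inv (\<omega> u) Y"] by (simp add: linear_add[OF linear_omega] omega_inv)

lemma inv_omega_scaleR: "X \<in> so32 \<Longrightarrow> inv (\<omega> u) (r *\<^sub>R X) = r *\<^sub>R inv (\<omega> u) X"
  using inv_omega[of u "r *\<^sub>R inv (\<omega> u) X"] by (simp add: linear_cmul[OF linear_omega] omega_inv)

lemma inv_omega_0: "inv (\<omega> u) 0 = 0"
  using inv_omega[of u 0] by (simp add: linear_0[OF linear_omega])

lemma kappa_in_so32: "kappa u X Y \<in> so32"
  unfolding kappa_def by (rule curvature_in_so32)

lemma two_form_kappa: "two_form (kappa u)"
proof
  show "kappa u X Y \<in> so32" for X Y by (rule kappa_in_so32)
  show "kappa u 0 Y = 0" for Y by (simp add: kappa_def inv_omega_0 bilinear_lzero[OF bilinear_curvature])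
  show "kappa u X 0 = 0" for X by (simp add: kappa_def inv_omega_0 bilinear_rzero[OF bilinear_curvature])
qed

lemma kappa_antisym: "kappa u Y X = - kappa u X Y"
  unfolding kappa_def by (rule curvature_antisym)

lemma kappa_self: "kappa u X X = 0"
proof -
  have "kappa u X X $ i $ j = 0" for i j
    using arg_cong[OF kappa_antisym[of u X X], of "\<lambda>M. M $ i $ j"] by simp
  then show ?thesis by (simp add: vec_eq_iff)
qed

lemma kappa_scaleR:
  "X \<in> so32 \<Longrightarrow> kappa u (r *\<^sub>R X) Y = r *\<^sub>R kappa u X Y"
  "Y \<in> so32 \<Longrightarrow> kappa u X (r *\<^sub>R Y) = r *\<^sub>R kappa u X Y"
  by (simp_all add: kappa_def inv_omega_scaleR bilinear_lmul[OF bilinear_curvature]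
      bilinear_rmul[OF bilinear_curvature])

lemma kappa_add:
  "X \<in> so32 \<Longrightarrow> X' \<in> so32 \<Longrightarrow> kappa u (X + X') Y = kappa u X Y + kappa u X' Y"
  "Y \<in> so32 \<Longrightarrow> Y' \<in> so32 \<Longrightarrow> kappa u X (Y + Y') = kappa u X Y + kappa u X Y'"
  by (simp_all add: kappa_def inv_omega_add bilinear_ladd[OF bilinear_curvature]
      bilinear_radd[OF bilinear_curvature])

lemma kappa_vertical: "X \<in> lie_H \<Longrightarrow> kappa u X Y = 0" "X \<in> lie_H \<Longrightarrow> kappa u Y X = 0"
proof -
  assume X: "X \<in> lie_H"
  then show "kappa u X Y = 0"
    unfolding kappa_def using lie_H_iff by (intro curvature_vertical) (simp add: omega_inv)
  then show "kappa u Y X = 0" using kappa_antisym[of u Y X] by simp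
qed

lemma so32_mod_lie_H:
  assumes "X \<in> so32"
  obtains X' where "X' \<in> lie_H" "X = X$4$1 *\<^sub>R e_m2 + X$3$1 *\<^sub>R e_m1_1 + X$3$2 *\<^sub>R e_m1_2
    + ((X$1$1 - X$2$2)/2) *\<^sub>R e_0_1 + ((X$1$2 + X$2$1)/2) *\<^sub>R e_0_2 + X'"
proof
  show "((X$1$1 + X$2$2)/2) *\<^sub>R E_0_1 + ((X$1$2 - X$2$1)/2) *\<^sub>R E_0_2
    + X$1$3 *\<^sub>R E_1_1 + X$2$3 *\<^sub>R E_1_2 + X$1$4 *\<^sub>R E_2 \<in> lie_H" (is "?X' \<in> _")
    unfolding lie_H_def by (intro span_add span_scale span_base) auto
  show "X = X$4$1 *\<^sub>R e_m2 + X$3$1 *\<^sub>R e_m1_1 + X$3$2 *\<^sub>R e_m1_2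
    + ((X$1$1 - X$2$2)/2) *\<^sub>R e_0_1 + ((X$1$2 + X$2$1)/2) *\<^sub>R e_0_2 + ?X'"
    using so32_expand[OF assms] by (simp add: add.assoc)
qed

text \<open>Horizontality removes the parts of X and Y in \<open>lie_H\<close>, so five vectors
  remain; by antisymmetry the coefficients \<open>w i j\<close> are the 2x2 minors of their
  coordinates.\<close>

lemma kappa_expand:
  assumes X: "X \<in> so32" and Y: "Y \<in> so32"
    and x: "x = (\<lambda>M::rmat. [M$4$1, M$3$1, M$3$2, (M$1$1 - M$2$2)/2, (M$1$2 + M$2$1)/2])"
  defines "w i j \<equiv> x X ! i * x Y ! j - x Y ! i * x X ! j"
  shows "kappa u X Y = w 0 1 *\<^sub>R kappa u e_m2 e_m1_1 + w 0 2 *\<^sub>R kappa u e_m2 e_m1_2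
    + w 0 3 *\<^sub>R kappa u e_m2 e_0_1 + w 0 4 *\<^sub>R kappa u e_m2 e_0_2
    + w 1 2 *\<^sub>R kappa u e_m1_1 e_m1_2 + w 1 3 *\<^sub>R kappa u e_m1_1 e_0_1
    + w 1 4 *\<^sub>R kappa u e_m1_1 e_0_2 + w 2 3 *\<^sub>R kappa u e_m1_2 e_0_1
    + w 2 4 *\<^sub>R kappa u e_m1_2 e_0_2 + w 3 4 *\<^sub>R kappa u e_0_1 e_0_2"
proof -
  obtain X' where X': "X' \<in> lie_H" "X = x X ! 0 *\<^sub>R e_m2 + x X ! 1 *\<^sub>R e_m1_1 + x X ! 2 *\<^sub>R e_m1_2
    + x X ! 3 *\<^sub>R e_0_1 + x X ! 4 *\<^sub>R e_0_2 + X'"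
    using so32_mod_lie_H[OF X] by (auto simp: x)
  obtain Y' where Y': "Y' \<in> lie_H" "Y = x Y ! 0 *\<^sub>R e_m2 + x Y ! 1 *\<^sub>R e_m1_1 + x Y ! 2 *\<^sub>R e_m1_2
    + x Y ! 3 *\<^sub>R e_0_1 + x Y ! 4 *\<^sub>R e_0_2 + Y'"
    using so32_mod_lie_H[OF Y] by (auto simp: x)
  define a where "a i = x X ! i" for i
  define b where "b i = x Y ! i" for i
  have so: "X' \<in> so32" "Y' \<in> so32" using X' Y' lie_H_iff by auto
  note mem = so basis_in_so32 scaleR_in_so32 subspace_add[OF subspace_so32]
  have "kappa u X Y = kappa u
    (a 0 *\<^sub>R e_m2 + a 1 *\<^sub>R e_m1_1 + a 2 *\<^sub>R e_m1_2 + a 3 *\<^sub>R e_0_1 + a 4 *\<^sub>R e_0_2 + X')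
    (b 0 *\<^sub>R e_m2 + b 1 *\<^sub>R e_m1_1 + b 2 *\<^sub>R e_m1_2 + b 3 *\<^sub>R e_0_1 + b 4 *\<^sub>R e_0_2 + Y')"
    using X'(2) Y'(2) by (simp add: a_def b_def)
  also have "\<dots> = (a 0 * b 1 - b 0 * a 1) *\<^sub>R kappa u e_m2 e_m1_1
    + (a 0 * b 2 - b 0 * a 2) *\<^sub>R kappa u e_m2 e_m1_2
    + (a 0 * b 3 - b 0 * a 3) *\<^sub>R kappa u e_m2 e_0_1 + (a 0 * b 4 - b 0 * a 4) *\<^sub>R kappa u e_m2 e_0_2
    + (a 1 * b 2 - b 1 * a 2) *\<^sub>R kappa u e_m1_1 e_m1_2 + (a 1 * b 3 - b 1 * a 3) *\<^sub>R kappa u e_m1_1 e_0_1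
    + (a 1 * b 4 - b 1 * a 4) *\<^sub>R kappa u e_m1_1 e_0_2 + (a 2 * b 3 - b 2 * a 3) *\<^sub>R kappa u e_m1_2 e_0_1
    + (a 2 * b 4 - b 2 * a 4) *\<^sub>R kappa u e_m1_2 e_0_2 + (a 3 * b 4 - b 3 * a 4) *\<^sub>R kappa u e_0_1 e_0_2"
    by (simp add: kappa_add kappa_scaleR mem kappa_vertical X'(1) Y'(1) kappa_self
        kappa_antisym[of u e_m1_1 e_m2] kappa_antisym[of u e_m1_2 e_m2] kappa_antisym[of u e_0_1 e_m2]
        kappa_antisym[of u e_0_2 e_m2] kappa_antisym[of u e_m1_2 e_m1_1] kappa_antisym[of u e_0_1 e_m1_1]
        kappa_antisym[of u e_0_2 e_m1_1] kappa_antisym[of u e_0_1 e_m1_2] kappa_antisym[of u e_0_2 e_m1_2]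
        kappa_antisym[of u e_0_2 e_0_1])
      (simp add: algebra_simps)
  finally show ?thesis by (simp add: w_def a_def b_def)
qed

section \<open>Curvature components in the complex frame\<close>

definition kappaC :: "'q \<Rightarrow> tidx \<Rightarrow> tidx \<Rightarrow> cmat" where
  "kappaC u b c = curvatureC B \<omega> u (frame_vec \<omega> u (eo b)) (frame_vec \<omega> u (eo c))"

lemma kappaC_alt:
  "kappaC u b c = cmat_of (kappa u (re_mat (eo b)) (re_mat (eo c)) - kappa u (im_mat (eo b)) (im_mat (eo c)))
    + cmat_scale \<i> (cmat_of (kappa u (re_mat (eo b)) (im_mat (eo c)) + kappa u (im_mat (eo b)) (re_mat (eo c))))"
  by (simp add: kappaC_def curvatureC_def frame_vec_def kappa_def)

lemma antisym_rel_kappaC: "antisym_rel (kappaC u b c)"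
  unfolding kappaC_alt
  by (intro antisym_rel_add antisym_rel_cmat_scale antisym_rel_cmat_of subspace_add[OF subspace_so32]
      subspace_diff[OF subspace_so32] kappa_in_so32)

lemma T_comp_eq: "T_comp B \<omega> a b c u = tcoord a (kappaC u b c)"
  unfolding T_comp_def kappaC_def[symmetric] by (simp add: cr_coords_eq[OF antisym_rel_kappaC])

lemma R_comp_eq: "R_comp B \<omega> d b c u = rcoord d (kappaC u b c)"
  unfolding R_comp_def kappaC_def[symmetric] by (simp add: cr_coords_eq[OF antisym_rel_kappaC])

lemma theta_comp_eq: "theta_comp \<omega> a u v = tcoord a (cmat_of (\<omega> u v))"
  unfolding theta_comp_def by (simp add: cr_coords_eq[OF antisym_rel_cmat_of[OF omega_in_so32]])

lemma omega_comp_eq: "omega_comp \<omega> d u v = rcoord d (cmat_of (\<omega> u v))"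
  unfolding omega_comp_def by (simp add: cr_coords_eq[OF antisym_rel_cmat_of[OF omega_in_so32]])

text \<open>All parts are written as scalar multiples of real basis elements, even
  \<open>0 *\<^sub>R e_m2\<close>, so that \<open>kappa_scaleR\<close> evaluates every case
  alike.\<close>

lemma re_im_eo:
  "re_mat (eo Tm2) = e_m2" "im_mat (eo Tm2) = 0 *\<^sub>R e_m2"
  "re_mat (eo Tm1_10) = (1/2) *\<^sub>R e_m1_1" "im_mat (eo Tm1_10) = (-1/2) *\<^sub>R e_m1_2"
  "re_mat (eo Tm1_01) = (1/2) *\<^sub>R e_m1_1" "im_mat (eo Tm1_01) = (1/2) *\<^sub>R e_m1_2"
  "re_mat (eo T0_10) = (1/2) *\<^sub>R e_0_1" "im_mat (eo T0_10) = (-1/2) *\<^sub>R e_0_2"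
  "re_mat (eo T0_01) = (1/2) *\<^sub>R e_0_1" "im_mat (eo T0_01) = (1/2) *\<^sub>R e_0_2"
  by (simp_all add: vec_eq_iff cmat_nth)

text \<open>Conjugating a frame vector only changes the sign of its imaginary part, and the
  curvature is real. All conjugate equations derive from this.\<close>

lemma kappaC_cnj: "kappaC u (tbar b) (tbar c) = map_matrix cnj (kappaC u b c)"
proof -
  have b: "re_mat (eo (tbar b)) = re_mat (eo b)" "im_mat (eo (tbar b)) = (-1) *\<^sub>R im_mat (eo b)" for b
    by (cases b; simp add: vec_eq_iff cmat_nth)+
  have so: "re_mat (eo b) \<in> so32" "im_mat (eo b) \<in> so32" for b
    by (cases b; simp only: re_im_eo basis_in_so32 scaleR_in_so32)+
  show ?thesis
    unfolding kappaC_alt b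
    by (simp only: kappa_scaleR so scaleR_in_so32) (simp add: vec_eq_iff cmat_nth algebra_simps)
qed

lemma tcoord_cnj: "tcoord (tbar a) (map_matrix cnj Z) = cnj (tcoord a Z)"
  by (cases a; simp add: cmat_nth)

lemma rcoord_cnj: "rcoord (rbar d) (map_matrix cnj Z) = cnj (rcoord d Z)"
  by (cases d; simp add: cmat_nth)

lemma T_comp_cnj: "T_comp B \<omega> (tbar a) (tbar b) (tbar c) u = cnj (T_comp B \<omega> a b c u)"
  by (simp add: T_comp_eq kappaC_cnj tcoord_cnj)

lemma R_comp_cnj: "R_comp B \<omega> (rbar d) (tbar b) (tbar c) u = cnj (R_comp B \<omega> d b c u)"
  by (simp add: R_comp_eq kappaC_cnj rcoord_cnj)

lemma cmat_of_cnj: "map_matrix cnj (cmat_of X) = cmat_of X"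
  by (simp add: vec_eq_iff cmat_nth)

lemma theta_comp_cnj: "theta_comp \<omega> (tbar a) u v = cnj (theta_comp \<omega> a u v)"
  using tcoord_cnj[of a "cmat_of (\<omega> u v)"] by (simp add: theta_comp_eq cmat_of_cnj)

lemma omega_comp_cnj: "omega_comp \<omega> (rbar d) u v = cnj (omega_comp \<omega> d u v)"
  using rcoord_cnj[of d "cmat_of (\<omega> u v)"] by (simp add: omega_comp_eq cmat_of_cnj)

section \<open>Exterior derivatives of the components of the connection form\<close>

lemma ext_d_linear_image:
  fixes L :: "rmat \<Rightarrow> complex"
  assumes "linear L"
  shows "ext_d B (\<lambda>u v. L (\<omega> u v)) u v w = L (ext_d B \<omega> u v w)"
proof -
  have L: "bounded_linear L" using assms linear_conv_bounded_linear by blast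
  have "frechet_derivative (\<lambda>q. form_rep B (chart_at B u) (\<lambda>u v. L (\<omega> u v)) q v) (at (snd (chart_at B u) u)) w
    = L (frechet_derivative (\<lambda>q. form_rep B (chart_at B u) \<omega> q v) (at (snd (chart_at B u) u)) w)" for v w
    using fun_cong[OF frechet_derivative_at[OF bounded_linear.has_derivative[OF L form_rep_omega_has_derivative]],
        of u v w]
    by (simp add: form_rep_def)
  then show ?thesis by (simp add: ext_d_def Let_def linear_diff[OF assms])
qed

lemma linear_tcoord_cmat_of: "linear (\<lambda>X. tcoord a (cmat_of X))"
proof (rule linearI)
  fix X Y :: rmat and r :: real
  have "cmat_of (X + Y) = cmat_of X + cmat_of Y" "cmat_of (r *\<^sub>R X) = cmat_scale (of_real r) (cmat_of X)"
    by (simp_all add: vec_eq_iff cmat_nth)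
  then show "tcoord a (cmat_of (X + Y)) = tcoord a (cmat_of X) + tcoord a (cmat_of Y)"
    "tcoord a (cmat_of (r *\<^sub>R X)) = r *\<^sub>R tcoord a (cmat_of X)"
    by (simp_all add: tcoord_linear scaleR_conv_of_real)
qed

lemma linear_rcoord_cmat_of: "linear (\<lambda>X. rcoord a (cmat_of X))"
proof (rule linearI)
  fix X Y :: rmat and r :: real
  have "cmat_of (X + Y) = cmat_of X + cmat_of Y" "cmat_of (r *\<^sub>R X) = cmat_scale (of_real r) (cmat_of X)"
    by (simp_all add: vec_eq_iff cmat_nth)
  then show "rcoord a (cmat_of (X + Y)) = rcoord a (cmat_of X) + rcoord a (cmat_of Y)"
    "rcoord a (cmat_of (r *\<^sub>R X)) = r *\<^sub>R rcoord a (cmat_of X)"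
    by (simp_all add: rcoord_linear scaleR_conv_of_real)
qed

lemma ext_d_eq_curvature: "ext_d B \<omega> u v w = curvature B \<omega> u v w - mbracket (\<omega> u v) (\<omega> u w)"
  by (simp add: curvature_def)

lemma tpairs_eq: "tpairs = {(Tm2, Tm1_10), (Tm2, Tm1_01), (Tm2, T0_10), (Tm2, T0_01), (Tm1_10, Tm1_01),
    (Tm1_10, T0_10), (Tm1_10, T0_01), (Tm1_01, T0_10), (Tm1_01, T0_01), (T0_10, T0_01)}"
proof -
  have len: "length tlist = 5" by (simp add: tlist_def)
  have "tpairs = (\<Union>j\<in>{..<5}. (\<lambda>i. (tlist ! i, tlist ! j)) ` {..<j})"
    unfolding tpairs_def by (force simp: len)
  also have "{..<5} = {0, 1, 2, 3, 4::nat}" by auto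
  finally have "tpairs = (\<Union>j\<in>{0, 1, 2, 3, 4}. (\<lambda>i. (tlist ! i, tlist ! j)) ` {..<j})" .
  then show ?thesis
    by (simp add: tlist_def lessThan_Suc numeral_eq_Suc) (simp add: insert_commute)
qed

lemma kappaC_pairs:
  "kappaC u Tm2 Tm1_10 = cmat_scale (1/2) (cmat_of (kappa u e_m2 e_m1_1)) + cmat_scale (-\<i>/2) (cmat_of (kappa u e_m2 e_m1_2))"
  "kappaC u Tm2 Tm1_01 = cmat_scale (1/2) (cmat_of (kappa u e_m2 e_m1_1)) + cmat_scale (\<i>/2) (cmat_of (kappa u e_m2 e_m1_2))"
  "kappaC u Tm2 T0_10 = cmat_scale (1/2) (cmat_of (kappa u e_m2 e_0_1)) + cmat_scale (-\<i>/2) (cmat_of (kappa u e_m2 e_0_2))"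
  "kappaC u Tm2 T0_01 = cmat_scale (1/2) (cmat_of (kappa u e_m2 e_0_1)) + cmat_scale (\<i>/2) (cmat_of (kappa u e_m2 e_0_2))"
  "kappaC u Tm1_10 Tm1_01 = cmat_scale (\<i>/2) (cmat_of (kappa u e_m1_1 e_m1_2))"
  "kappaC u Tm1_10 T0_10 = cmat_scale (1/4) (cmat_of (kappa u e_m1_1 e_0_1 - kappa u e_m1_2 e_0_2))
    + cmat_scale (-\<i>/4) (cmat_of (kappa u e_m1_1 e_0_2 + kappa u e_m1_2 e_0_1))"
  "kappaC u Tm1_10 T0_01 = cmat_scale (1/4) (cmat_of (kappa u e_m1_1 e_0_1 + kappa u e_m1_2 e_0_2))
    + cmat_scale (\<i>/4) (cmat_of (kappa u e_m1_1 e_0_2 - kappa u e_m1_2 e_0_1))"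
  "kappaC u Tm1_01 T0_10 = cmat_scale (1/4) (cmat_of (kappa u e_m1_1 e_0_1 + kappa u e_m1_2 e_0_2))
    + cmat_scale (-\<i>/4) (cmat_of (kappa u e_m1_1 e_0_2 - kappa u e_m1_2 e_0_1))"
  "kappaC u Tm1_01 T0_01 = cmat_scale (1/4) (cmat_of (kappa u e_m1_1 e_0_1 - kappa u e_m1_2 e_0_2))
    + cmat_scale (\<i>/4) (cmat_of (kappa u e_m1_1 e_0_2 + kappa u e_m1_2 e_0_1))"
  "kappaC u T0_10 T0_01 = cmat_scale (\<i>/2) (cmat_of (kappa u e_0_1 e_0_2))"
  unfolding kappaC_alt re_im_eo
  by (simp_all only: kappa_scaleR basis_in_so32 scaleR_in_so32 kappa_self
        kappa_antisym[of u e_m1_2 e_m1_1] kappa_antisym[of u e_0_2 e_0_1])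
    (simp_all add: vec_eq_iff cmat_nth complex_eq_iff field_simps)

text \<open>The real minors of \<open>kappa_expand\<close> are regrouped into complex wedge
  products. For a vector and its conjugate the wedge is -2i times a real minor, and this is
  compensated by the coefficient i/2 in \<open>kappaC_pairs\<close>.\<close>

lemma cmat_of_curvature:
  "cmat_of (curvature B \<omega> u v w) =
    (\<Sum>(b, c)\<in>tpairs. cmat_scale ((theta_comp \<omega> b \<curlywedge> theta_comp \<omega> c) u v w) (kappaC u b c))"
proof -
  define x where "x = (\<lambda>M::rmat. [M$4$1, M$3$1, M$3$2, (M$1$1 - M$2$2)/2, (M$1$2 + M$2$1)/2])"
  define W where "W i j = x (\<omega> u v) ! i * x (\<omega> u w) ! j - x (\<omega> u w) ! i * x (\<omega> u v) ! j" for i j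
  have t: "theta_comp \<omega> Tm2 u z = of_real (x (\<omega> u z) ! 0)"
    "theta_comp \<omega> Tm1_10 u z = Complex (x (\<omega> u z) ! 1) (x (\<omega> u z) ! 2)"
    "theta_comp \<omega> Tm1_01 u z = Complex (x (\<omega> u z) ! 1) (- x (\<omega> u z) ! 2)"
    "theta_comp \<omega> T0_10 u z = Complex (x (\<omega> u z) ! 3) (x (\<omega> u z) ! 4)"
    "theta_comp \<omega> T0_01 u z = Complex (x (\<omega> u z) ! 3) (- x (\<omega> u z) ! 4)" for z
    by (simp_all add: theta_comp_eq x_def cmat_nth complex_eq_iff)
  have wedges:
    "(theta_comp \<omega> Tm2 \<curlywedge> theta_comp \<omega> Tm1_10) u v w = Complex (W 0 1) (W 0 2)"
    "(theta_comp \<omega> Tm2 \<curlywedge> theta_comp \<omega> Tm1_01) u v w = Complex (W 0 1) (- W 0 2)"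
    "(theta_comp \<omega> Tm2 \<curlywedge> theta_comp \<omega> T0_10) u v w = Complex (W 0 3) (W 0 4)"
    "(theta_comp \<omega> Tm2 \<curlywedge> theta_comp \<omega> T0_01) u v w = Complex (W 0 3) (- W 0 4)"
    "(theta_comp \<omega> Tm1_10 \<curlywedge> theta_comp \<omega> Tm1_01) u v w = Complex 0 (- 2 * W 1 2)"
    "(theta_comp \<omega> Tm1_10 \<curlywedge> theta_comp \<omega> T0_10) u v w = Complex (W 1 3 - W 2 4) (W 1 4 + W 2 3)"
    "(theta_comp \<omega> Tm1_10 \<curlywedge> theta_comp \<omega> T0_01) u v w = Complex (W 1 3 + W 2 4) (W 2 3 - W 1 4)"
    "(theta_comp \<omega> Tm1_01 \<curlywedge> theta_comp \<omega> T0_10) u v w = Complex (W 1 3 + W 2 4) (W 1 4 - W 2 3)"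
    "(theta_comp \<omega> Tm1_01 \<curlywedge> theta_comp \<omega> T0_01) u v w = Complex (W 1 3 - W 2 4) (- W 1 4 - W 2 3)"
    "(theta_comp \<omega> T0_10 \<curlywedge> theta_comp \<omega> T0_01) u v w = Complex 0 (- 2 * W 3 4)"
    unfolding wedge_def t by (simp_all add: complex_eq_iff W_def algebra_simps)
  have "curvature B \<omega> u v w = kappa u (\<omega> u v) (\<omega> u w)"
    by (simp add: kappa_def inv_omega)
  also note kappa_expand[OF omega_in_so32 omega_in_so32 x_def]
  finally have K: "curvature B \<omega> u v w = W 0 1 *\<^sub>R kappa u e_m2 e_m1_1 + W 0 2 *\<^sub>R kappa u e_m2 e_m1_2
    + W 0 3 *\<^sub>R kappa u e_m2 e_0_1 + W 0 4 *\<^sub>R kappa u e_m2 e_0_2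
    + W 1 2 *\<^sub>R kappa u e_m1_1 e_m1_2 + W 1 3 *\<^sub>R kappa u e_m1_1 e_0_1
    + W 1 4 *\<^sub>R kappa u e_m1_1 e_0_2 + W 2 3 *\<^sub>R kappa u e_m1_2 e_0_1
    + W 2 4 *\<^sub>R kappa u e_m1_2 e_0_2 + W 3 4 *\<^sub>R kappa u e_0_1 e_0_2"
    unfolding W_def .
  have "cmat_of (curvature B \<omega> u v w) $ i $ j = (\<Sum>(b, c)\<in>tpairs.
      cmat_scale ((theta_comp \<omega> b \<curlywedge> theta_comp \<omega> c) u v w) (kappaC u b c)) $ i $ j" for i j
    unfolding K
    by (simp add: tpairs_eq kappaC_pairs wedges cmat_nth, simp add: complex_eq_iff)
      (simp add: algebra_simps add_divide_distrib diff_divide_distrib)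
  then show ?thesis by (simp add: vec_eq_iff)
qed

lemma ext_d_theta:
  "ext_d B (theta_comp \<omega> a) u v w =
    (\<Sum>(b, c)\<in>tpairs. T_comp B \<omega> a b c u * (theta_comp \<omega> b \<curlywedge> theta_comp \<omega> c) u v w)
      - tcoord a (cmat_of (mbracket (\<omega> u v) (\<omega> u w)))"
proof -
  have "ext_d B (theta_comp \<omega> a) u v w = ext_d B (\<lambda>u v. tcoord a (cmat_of (\<omega> u v))) u v w"
    by (simp add: theta_comp_eq[abs_def])
  also have "\<dots> = tcoord a (cmat_of (ext_d B \<omega> u v w))"
    by (rule ext_d_linear_image[OF linear_tcoord_cmat_of])
  also have "\<dots> = tcoord a (cmat_of (curvature B \<omega> u v w)) - tcoord a (cmat_of (mbracket (\<omega> u v) (\<omega> u w)))"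
    unfolding ext_d_eq_curvature by (rule linear_diff[OF linear_tcoord_cmat_of])
  finally show ?thesis
    unfolding cmat_of_curvature by (simp add: tpairs_eq tcoord_linear T_comp_eq mult.commute)
qed

lemma ext_d_omega:
  "ext_d B (omega_comp \<omega> a) u v w =
    (\<Sum>(b, c)\<in>tpairs. R_comp B \<omega> a b c u * (theta_comp \<omega> b \<curlywedge> theta_comp \<omega> c) u v w)
      - rcoord a (cmat_of (mbracket (\<omega> u v) (\<omega> u w)))"
proof -
  have "ext_d B (omega_comp \<omega> a) u v w = ext_d B (\<lambda>u v. rcoord a (cmat_of (\<omega> u v))) u v w"
    by (simp add: omega_comp_eq[abs_def])
  also have "\<dots> = rcoord a (cmat_of (ext_d B \<omega> u v w))"
    by (rule ext_d_linear_image[OF linear_rcoord_cmat_of])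
  also have "\<dots> = rcoord a (cmat_of (curvature B \<omega> u v w)) - rcoord a (cmat_of (mbracket (\<omega> u v) (\<omega> u w)))"
    unfolding ext_d_eq_curvature by (rule linear_diff[OF linear_rcoord_cmat_of])
  finally show ?thesis
    unfolding cmat_of_curvature by (simp add: tpairs_eq rcoord_linear R_comp_eq mult.commute)
qed

lemma ext_d_theta_cnj: "ext_d B (theta_comp \<omega> (tbar a)) u v w = cnj (ext_d B (theta_comp \<omega> a) u v w)"
  using ext_d_linear_image[OF linear_tcoord_cmat_of, of a u v w]
    ext_d_linear_image[OF linear_tcoord_cmat_of, of "tbar a" u v w]
    tcoord_cnj[of a "cmat_of (ext_d B \<omega> u v w)"]
  by (simp add: theta_comp_eq[abs_def] cmat_of_cnj)

lemma ext_d_omega_cnj: "ext_d B (omega_comp \<omega> (rbar a)) u v w = cnj (ext_d B (omega_comp \<omega> a) u v w)"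
  using ext_d_linear_image[OF linear_rcoord_cmat_of, of a u v w]
    ext_d_linear_image[OF linear_rcoord_cmat_of, of "rbar a" u v w]
    rcoord_cnj[of a "cmat_of (ext_d B \<omega> u v w)"]
  by (simp add: omega_comp_eq[abs_def] cmat_of_cnj)

end

section \<open>The structure equations\<close>

text \<open>These are the structure constants of \<open>so32\<close> in the CR basis; they produce
  the terms on the left-hand sides of the structure equations.\<close>

lemma mbracket_tcoord:
  assumes X: "X \<in> so32" and Y: "Y \<in> so32"
  defines "t a \<equiv> tcoord a (cmat_of X)" and "t' a \<equiv> tcoord a (cmat_of Y)"
    and "r b \<equiv> rcoord b (cmat_of X)" and "r' b \<equiv> rcoord b (cmat_of Y)"
  shows
    "tcoord Tm2 (cmat_of (mbracket X Y)) = (\<i>/2) * (t Tm1_10 * t' Tm1_01 - t' Tm1_10 * t Tm1_01)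
      - ((r R0_10 + r R0_01) * t' Tm2 - (r' R0_10 + r' R0_01) * t Tm2)"
    "tcoord Tm1_10 (cmat_of (mbracket X Y)) = - (t T0_10 * t' Tm1_01 - t' T0_10 * t Tm1_01)
      - (r R0_10 * t' Tm1_10 - r' R0_10 * t Tm1_10) + \<i> * (r R1_10 * t' Tm2 - r' R1_10 * t Tm2)"
    "tcoord T0_10 (cmat_of (mbracket X Y)) = - ((r R0_10 - r R0_01) * t' T0_10 - (r' R0_10 - r' R0_01) * t T0_10)
      + (1/2) * (r R1_10 * t' Tm1_10 - r' R1_10 * t Tm1_10)"
  unfolding t_def t'_def r_def r'_def
  by (simp_all add: cmat_nth mbracket_nth sum_5 so32_entries[OF X] so32_entries[OF Y], simp_all add: complex_eq_iff)
    (simp_all add: algebra_simps add_divide_distrib diff_divide_distrib)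

lemma mbracket_rcoord:
  assumes X: "X \<in> so32" and Y: "Y \<in> so32"
  defines "t a \<equiv> tcoord a (cmat_of X)" and "t' a \<equiv> tcoord a (cmat_of Y)"
    and "r b \<equiv> rcoord b (cmat_of X)" and "r' b \<equiv> rcoord b (cmat_of Y)"
  shows
    "rcoord R0_10 (cmat_of (mbracket X Y)) = - (t T0_10 * t' T0_01 - t' T0_10 * t T0_01)
      + (1/2) * (r R1_01 * t' Tm1_10 - r' R1_01 * t Tm1_10) + (r R2 * t' Tm2 - r' R2 * t Tm2)"
    "rcoord R1_10 (cmat_of (mbracket X Y)) = - (r R1_01 * t' T0_10 - r' R1_01 * t T0_10)
      - (r R1_10 * r' R0_01 - r' R1_10 * r R0_01) + \<i> * (r R2 * t' Tm1_10 - r' R2 * t Tm1_10)"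
    "rcoord R2 (cmat_of (mbracket X Y)) = - (\<i>/2) * (r R1_10 * r' R1_01 - r' R1_10 * r R1_01)
      + ((r R0_10 + r R0_01) * r' R2 - (r' R0_10 + r' R0_01) * r R2)"
  unfolding t_def t'_def r_def r'_def
  by (simp_all add: cmat_nth mbracket_nth sum_5 so32_entries[OF X] so32_entries[OF Y], simp_all add: complex_eq_iff)
    (simp_all add: algebra_simps add_divide_distrib diff_divide_distrib)

text \<open>On \<open>so32\<close> this is, up to sign, the -2 coordinate of the bracket. Once the
  torsion with upper index -2 vanishes, it expresses the exterior derivative of the contact form
  with constant coefficients in the connection form, ready to be differentiated again. The explicit
  formula is bilinear on all matrices.\<close>

definition contact_bracket :: "rmat \<Rightarrow> rmat \<Rightarrow> real" where
  "contact_bracket X Y = (X$1$1 + X$2$2) * Y$4$1 - (Y$1$1 + Y$2$2) * X$4$1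
    - (X$3$1 * Y$3$2 - Y$3$1 * X$3$2)"

lemma mbracket_41: "X \<in> so32 \<Longrightarrow> Y \<in> so32 \<Longrightarrow> mbracket X Y $ 4 $ 1 = - contact_bracket X Y"
  by (simp add: contact_bracket_def mbracket_nth sum_5 so32_entries algebra_simps)

lemma bounded_bilinear_contact_bracket: "bounded_bilinear contact_bracket"
  by (rule bilinear_conv_bounded_bilinear[THEN iffD1])
    (simp add: bilinear_def linear_iff contact_bracket_def algebra_simps)

lemma contact_bracket_antisym: "contact_bracket Y X = - contact_bracket X Y"
  by (simp add: contact_bracket_def)

section \<open>Consequences of the normalisation conditions\<close>

locale canonical_cartan = cartan A B \<pi> act \<omega>
  for A :: "('m::{t2_space, second_countable_topology}, real^5) chart set"
    and B :: "('q::{t2_space, second_countable_topology}, real^10) chart set"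
    and \<pi> act \<omega> +
  fixes D :: "'m \<Rightarrow> (real^5) set" and J :: "'m \<Rightarrow> real^5 \<Rightarrow> real^5"
  assumes canonical: "canonical_cartan_connection A D J B \<pi> act \<omega>"
begin

abbreviation "T \<equiv> T_comp B \<omega>"
abbreviation "R \<equiv> R_comp B \<omega>"
abbreviation "\<theta> \<equiv> theta_comp \<omega>"
abbreviation "\<Omega> \<equiv> omega_comp \<omega>"
abbreviation "d \<equiv> ext_d B"

lemma T_vanishes:
  assumes "(a, b, c) \<in> vanishing_T"
  shows "T a b c u = 0" "T (tbar a) (tbar b) (tbar c) u = 0"
  using canonical assms unfolding canonical_cartan_connection_def by fast+

lemma R_vanishes:
  assumes "(a, b, c) \<in> vanishing_R"
  shows "R a b c u = 0" "R (rbar a) (tbar b) (tbar c) u = 0"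
  using canonical assms unfolding canonical_cartan_connection_def by fast+

lemma ker_codiff: "k \<in> {1, 2, 3} \<Longrightarrow> in_ker_codiff (degree_comp k (kappa u))"
  using canonical unfolding canonical_cartan_connection_def kappa_def[abs_def] by blast

sublocale kappa: two_form "kappa u" for u
  by (rule two_form_kappa)

lemmas degree_1 = kappa.degree_1_vanishing[OF ker_codiff, simplified]
lemmas degree_2 = kappa.degree_2_relations[OF ker_codiff, simplified]
lemmas degree_3 = kappa.degree_3_relations[OF ker_codiff, simplified]

text \<open>The pairs of -2 with -1(10) and -1(01) are of shifting degree 1 and come from the
  codifferential; all other pairs are in the list of vanishing components, some only as
  conjugates.\<close>

lemma T_m2_vanishes: "(b, c) \<in> tpairs \<Longrightarrow> T Tm2 b c u = 0"
proof -
  have "T Tm2 Tm2 Tm1_10 u = 0" "T Tm2 Tm2 Tm1_01 u = 0"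
    by (simp_all add: T_comp_eq kappaC_pairs tcoord_linear) (simp_all add: cmat_nth degree_1)
  moreover have "T Tm2 Tm2 T0_10 u = 0" "T Tm2 Tm2 T0_01 u = 0"
    using T_vanishes[of Tm2 Tm2 T0_10 u] by (simp_all add: vanishing_T_def)
  moreover have "T Tm2 Tm1_10 Tm1_01 u = 0"
    using T_vanishes[of Tm2 Tm1_10 Tm1_01 u] by (simp_all add: vanishing_T_def)
  moreover have "T Tm2 Tm1_10 T0_10 u = 0" "T Tm2 Tm1_01 T0_01 u = 0"
    using T_vanishes[of Tm2 Tm1_10 T0_10 u] by (simp_all add: vanishing_T_def)
  moreover have "T Tm2 Tm1_01 T0_10 u = 0" "T Tm2 Tm1_10 T0_01 u = 0"
    using T_vanishes[of Tm2 Tm1_01 T0_10 u] by (simp_all add: vanishing_T_def)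
  moreover have "T Tm2 T0_10 T0_01 u = 0"
    using T_vanishes[of Tm2 T0_10 T0_01 u] by (simp_all add: vanishing_T_def)
  ultimately show "(b, c) \<in> tpairs \<Longrightarrow> T Tm2 b c u = 0"
    unfolding tpairs_eq by auto
qed

lemma curvature_41: "curvature B \<omega> u v w $ 4 $ 1 = 0"
proof -
  have "tcoord Tm2 (cmat_of (curvature B \<omega> u v w)) =
      (\<Sum>(b, c)\<in>tpairs. T Tm2 b c u * (\<theta> b \<curlywedge> \<theta> c) u v w)"
    unfolding cmat_of_curvature by (simp add: tpairs_eq tcoord_linear T_comp_eq mult.commute)
  also have "\<dots> = 0"
    by (rule sum.neutral) (auto simp: T_m2_vanishes)
  finally show ?thesis by (simp add: cmat_nth)
qed

lemma ext_d_41: "ext_d B \<omega> u v w $ 4 $ 1 = contact_bracket (\<omega> u v) (\<omega> u w)"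
  by (simp add: ext_d_eq_curvature curvature_41 mbracket_41 omega_in_so32)

text \<open>The identity \<open>d (d \<theta>) = 0\<close> for the \<open>-2\<close> component \<open>\<theta>\<close> of the connection form.\<close>

lemma bianchi_41:
  "contact_bracket (ext_d B \<omega> u z v) (\<omega> u w) + contact_bracket (ext_d B \<omega> u v w) (\<omega> u z)
    + contact_bracket (ext_d B \<omega> u w z) (\<omega> u v) = 0"
proof -
  define c where "c = chart_at B u"
  note c = chart_at_in_atlas[OF atlas, of u, folded c_def]
  define F where "F = form_rep B c \<omega>"
  define p where "p = snd c u"
  let ?P = "snd c ` fst c"
  have P: "open ?P" "p \<in> ?P" using smooth_atlas_chartD(2)[OF atlas c(1)] c by (auto simp: p_def)
  define F' where "F' v = frechet_derivative (\<lambda>q. F q v) (at p)" for v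
  define dF where "dF v w q = frechet_derivative (\<lambda>q. F q w) (at q) v - frechet_derivative (\<lambda>q. F q v) (at q) w" for v w q
  have F': "((\<lambda>q. F q v) has_derivative F' v) (at p)" for v
    using form_rep_omega_has_derivative unfolding F_def p_def c_def F'_def by simp
  have Fsmooth: "smooth_on ?P (\<lambda>q. F q v)" for v
    unfolding F_def by (rule smooth_on_form_rep[OF smooth_omega c(1)])
  have Fp: "F p v = \<omega> u v" for v unfolding F_def p_def c_def by (rule form_rep_chart_at[OF atlas])
  \<comment> \<open>The structure equation is needed near u in the single chart c, not just at u;
    naturality of the exterior derivative transports it there.\<close>
  have dF_41: "dF v w q $ 4 $ 1 = contact_bracket (F q v) (F q w)" if "q \<in> ?P" for v w q
  proof -
    obtain x where x: "x \<in> fst c" "q = snd c x" using \<open>q \<in> ?P\<close> by auto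
    have "dF v w q = chart_d B c \<omega> q v w" by (simp add: dF_def chart_d_def F_def)
    also have "\<dots> = ext_d B \<omega> x (from_coord B c x v) (from_coord B c x w)"
      unfolding x(2) by (rule chart_d_eq_ext_d[OF atlas c(1) x(1) smooth_omega])
    finally show ?thesis
      by (simp add: ext_d_41 F_def form_rep_def x(2) inv_chart_chart[OF atlas c(1) x(1)])
  qed
  have dF_p: "F' w v - F' v w = ext_d B \<omega> u v w" for v w
    by (simp add: F'_def ext_d_def Let_def F_def c_def p_def)
  \<comment> \<open>The entry (4,1) of the derivative of \<open>dF\<close> is computed a second time
    through the structure equation, by the product rule.\<close>
  have deriv: "frechet_derivative (dF v w) (at p) z $ 4 $ 1
      = contact_bracket (\<omega> u v) (F' w z) + contact_bracket (F' v z) (\<omega> u w)" for v w z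
  proof -
    have "dF v w differentiable (at p)"
      unfolding dF_def[abs_def]
      by (intro differentiable_diff smooth_on_differentiable[OF P(1) _ P(2)]
          smooth_on_frechet_derivative[OF P(1)] Fsmooth)
    then have "(dF v w has_derivative frechet_derivative (dF v w) (at p)) (at p)"
      by (simp add: frechet_derivative_works)
    then have "((\<lambda>q. dF v w q $ 4 $ 1) has_derivative (\<lambda>z. frechet_derivative (dF v w) (at p) z $ 4 $ 1)) (at p)"
      by (intro bounded_linear.has_derivative[OF bounded_linear_vec_nth])
    moreover have "((\<lambda>q. contact_bracket (F q v) (F q w)) has_derivative
        (\<lambda>z. contact_bracket (F p v) (F' w z) + contact_bracket (F' v z) (F p w))) (at p)"
      by (rule bounded_bilinear.FDERIV[OF bounded_bilinear_contact_bracket F' F'])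
    then have "((\<lambda>q. dF v w q $ 4 $ 1) has_derivative
        (\<lambda>z. contact_bracket (F p v) (F' w z) + contact_bracket (F' v z) (F p w))) (at p)"
      by (rule has_derivative_transform_within_open[OF _ P]) (rule dF_41[symmetric])
    ultimately show ?thesis
      using has_derivative_unique unfolding Fp by (metis (no_types, lifting))
  qed
  \<comment> \<open>In the cyclic sum, antisymmetry of \<open>contact_bracket\<close> pairs the
    first derivatives of the form into exterior derivatives.\<close>
  have "frechet_derivative (dF v w) (at p) z + frechet_derivative (dF w z) (at p) v
      + frechet_derivative (dF z v) (at p) w = 0"
    unfolding dF_def[abs_def]
    by (rule cyclic_sum_derivative_of_exterior_derivative[where F = F, OF P Fsmooth])
  from arg_cong[OF this, of "\<lambda>M. M $ 4 $ 1"]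
  show ?thesis
    unfolding dF_p[symmetric]
    by (simp add: deriv contact_bracket_antisym[of _ "\<omega> u _"]
        bounded_bilinear.diff_right[OF bounded_bilinear_contact_bracket])
qed

text \<open>On the triple \<open>e_m2\<close>, \<open>e_m1_1\<close>, \<open>e_m1_2\<close> the
  identity d d \<theta> = 0 involves only the trace of the upper left block and the two diagonal
  coefficients of degree 2. On the one-parameter family left by \<open>degree_2\<close> it reads 4a
  = 0.\<close>

lemma degree_2_bianchi: "kappa u e_m1_1 e_m1_2 $1$1 = 0" "kappa u e_m1_1 e_m1_2 $2$2 = 0"
proof -
  let ?f = "inv (\<omega> u)"
  have "contact_bracket (ext_d B \<omega> u (?f e_m2) (?f e_m1_1)) e_m1_2
    + contact_bracket (ext_d B \<omega> u (?f e_m1_1) (?f e_m1_2)) e_m2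
    + contact_bracket (ext_d B \<omega> u (?f e_m1_2) (?f e_m2)) e_m1_1 = 0"
    using bianchi_41[of u "?f e_m2" "?f e_m1_1" "?f e_m1_2"] by (simp add: omega_inv basis_in_so32)
  moreover have "ext_d B \<omega> u (?f X) (?f Y) = kappa u X Y - mbracket X Y" if "X \<in> so32" "Y \<in> so32" for X Y
    using that by (simp add: ext_d_eq_curvature kappa_def omega_inv)
  ultimately have "contact_bracket (kappa u e_m2 e_m1_1 - mbracket e_m2 e_m1_1) e_m1_2
    + contact_bracket (kappa u e_m1_1 e_m1_2 - mbracket e_m1_1 e_m1_2) e_m2
    + contact_bracket (- kappa u e_m2 e_m1_2 - mbracket e_m1_2 e_m2) e_m1_1 = 0"
    by (simp add: basis_in_so32 kappa_antisym[of u e_m1_2 e_m2])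
  then have "kappa u e_m1_1 e_m1_2 $1$1 + kappa u e_m1_1 e_m1_2 $2$2
      - kappa u e_m2 e_m1_1 $3$1 - kappa u e_m2 e_m1_2 $3$2 = 0"
    by (simp add: contact_bracket_def mbracket_nth sum_5 so32_basis_defs elem_nth)
  then show "kappa u e_m1_1 e_m1_2 $1$1 = 0" "kappa u e_m1_1 e_m1_2 $2$2 = 0"
    using degree_2(5,6,7)[of u] by simp_all
qed

text \<open>The component on (-1(10), -1(01)) has degree 1, those on (-2, -1(10)) and (-2, -1(01))
  have degree 2 and require the Bianchi identity; the rest are normalisations. Only the pairs of -2
  with 0(10) and 0(01) remain.\<close>

lemma T_m1_vanishes:
  "T Tm1_10 Tm2 Tm1_10 u = 0" "T Tm1_10 Tm2 Tm1_01 u = 0" "T Tm1_10 Tm1_10 Tm1_01 u = 0"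
  "T Tm1_10 Tm1_10 T0_10 u = 0" "T Tm1_10 Tm1_10 T0_01 u = 0" "T Tm1_10 Tm1_01 T0_10 u = 0"
  "T Tm1_10 Tm1_01 T0_01 u = 0" "T Tm1_10 T0_10 T0_01 u = 0"
proof -
  show "T Tm1_10 Tm2 Tm1_10 u = 0" "T Tm1_10 Tm2 Tm1_01 u = 0" "T Tm1_10 Tm1_10 Tm1_01 u = 0"
    by (simp_all add: T_comp_eq kappaC_pairs tcoord_linear)
      (simp_all add: cmat_nth degree_1 degree_2 degree_2_bianchi)
  show "T Tm1_10 Tm1_10 T0_10 u = 0" "T Tm1_10 Tm1_10 T0_01 u = 0" "T Tm1_10 Tm1_01 T0_10 u = 0"
    "T Tm1_10 T0_10 T0_01 u = 0"
    by (rule T_vanishes(1); simp add: vanishing_T_def)+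
  show "T Tm1_10 Tm1_01 T0_01 u = 0"
    using T_vanishes(2)[of Tm1_01 Tm1_10 T0_10 u] by (simp add: vanishing_T_def)
qed

lemma T_0_vanishes:
  "T T0_10 Tm1_10 Tm1_01 u = 0" "T T0_10 Tm1_10 T0_10 u = 0" "T T0_10 Tm1_10 T0_01 u = 0"
  "T T0_10 Tm1_01 T0_01 u = 0"
proof -
  show "T T0_10 Tm1_10 Tm1_01 u = 0"
    by (simp add: T_comp_eq kappaC_pairs tcoord_linear)
      (simp add: cmat_nth degree_2)
  show "T T0_10 Tm1_10 T0_10 u = 0" "T T0_10 Tm1_10 T0_01 u = 0" "T T0_10 Tm1_01 T0_01 u = 0"
    by (rule T_vanishes(1); simp add: vanishing_T_def)+
qed

text \<open>On (-1(10), -1(01)) this coordinate contains the entries (1,1) and (2,2) through their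
  sum, which the codifferential leaves free in degree 2; the Bianchi identity settles it.\<close>

lemma R_0_vanishes:
  "R R0_10 Tm1_10 Tm1_01 u = 0" "R R0_10 Tm2 T0_10 u = 0" "R R0_10 Tm2 T0_01 u = 0"
proof -
  show "R R0_10 Tm1_10 Tm1_01 u = 0"
    by (simp add: R_comp_eq kappaC_pairs rcoord_linear) (simp add: cmat_nth degree_2 degree_2_bianchi)
  show "R R0_10 Tm2 T0_10 u = 0" "R R0_10 Tm2 T0_01 u = 0"
    by (rule R_vanishes(1); simp add: vanishing_R_def)+
qed

section \<open>The structure equations and the curvature relations\<close>

lemmas bracket_at = mbracket_tcoord[OF omega_in_so32 omega_in_so32, folded theta_comp_eq omega_comp_eq]
  mbracket_rcoord[OF omega_in_so32 omega_in_so32, folded theta_comp_eq omega_comp_eq]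

lemma sum_tpairs:
  "(\<Sum>(b, c)\<in>tpairs. f b c) = f Tm2 Tm1_10 + f Tm2 Tm1_01 + f Tm2 T0_10 + f Tm2 T0_01
    + f Tm1_10 Tm1_01 + f Tm1_10 T0_10 + f Tm1_10 T0_01 + f Tm1_01 T0_10 + f Tm1_01 T0_01
    + f T0_10 T0_01" for f :: "tidx \<Rightarrow> tidx \<Rightarrow> complex"
  by (simp add: tpairs_eq add.assoc)

lemma structure_equation_m2:
  "d (\<theta> Tm2) u v w = - (\<i>/2) * (\<theta> Tm1_10 \<curlywedge> \<theta> Tm1_01) u v w + ((\<Omega> R0_10 + \<Omega> R0_01) \<curlywedge> \<theta> Tm2) u v w"
  unfolding ext_d_theta bracket_at sum_tpairs
  by (simp add: T_m2_vanishes tpairs_eq) (simp add: wedge_def algebra_simps)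

lemma structure_equation_m1:
  "d (\<theta> Tm1_10) u v w = (\<theta> T0_10 \<curlywedge> \<theta> Tm1_01) u v w + (\<Omega> R0_10 \<curlywedge> \<theta> Tm1_10) u v w
    - \<i> * (\<Omega> R1_10 \<curlywedge> \<theta> Tm2) u v w
    + T Tm1_10 Tm2 T0_10 u * (\<theta> Tm2 \<curlywedge> \<theta> T0_10) u v w + T Tm1_10 Tm2 T0_01 u * (\<theta> Tm2 \<curlywedge> \<theta> T0_01) u v w"
  unfolding ext_d_theta bracket_at sum_tpairs T_m1_vanishes by (simp add: wedge_def algebra_simps)

lemma structure_equation_0_theta:
  "d (\<theta> T0_10) u v w = ((\<Omega> R0_10 - \<Omega> R0_01) \<curlywedge> \<theta> T0_10) u v w - (1/2) * (\<Omega> R1_10 \<curlywedge> \<theta> Tm1_10) u v w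
    + T T0_10 Tm2 Tm1_10 u * (\<theta> Tm2 \<curlywedge> \<theta> Tm1_10) u v w + T T0_10 Tm2 Tm1_01 u * (\<theta> Tm2 \<curlywedge> \<theta> Tm1_01) u v w
    + T T0_10 Tm2 T0_10 u * (\<theta> Tm2 \<curlywedge> \<theta> T0_10) u v w + T T0_10 Tm2 T0_01 u * (\<theta> Tm2 \<curlywedge> \<theta> T0_01) u v w
    + T T0_10 Tm1_01 T0_10 u * (\<theta> Tm1_01 \<curlywedge> \<theta> T0_10) u v w
    + T T0_10 T0_10 T0_01 u * (\<theta> T0_10 \<curlywedge> \<theta> T0_01) u v w"
  unfolding ext_d_theta bracket_at sum_tpairs T_0_vanishes by (simp add: wedge_def algebra_simps)

lemma structure_equation_0_omega:
  "d (\<Omega> R0_10) u v w = (\<theta> T0_10 \<curlywedge> \<theta> T0_01) u v w - (1/2) * (\<Omega> R1_01 \<curlywedge> \<theta> Tm1_10) u v w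
    - (\<Omega> R2 \<curlywedge> \<theta> Tm2) u v w
    + R R0_10 Tm2 Tm1_10 u * (\<theta> Tm2 \<curlywedge> \<theta> Tm1_10) u v w + R R0_10 Tm2 Tm1_01 u * (\<theta> Tm2 \<curlywedge> \<theta> Tm1_01) u v w
    + R R0_10 Tm1_10 T0_10 u * (\<theta> Tm1_10 \<curlywedge> \<theta> T0_10) u v w
    + R R0_10 Tm1_10 T0_01 u * (\<theta> Tm1_10 \<curlywedge> \<theta> T0_01) u v w
    + R R0_10 Tm1_01 T0_10 u * (\<theta> Tm1_01 \<curlywedge> \<theta> T0_10) u v w
    + R R0_10 Tm1_01 T0_01 u * (\<theta> Tm1_01 \<curlywedge> \<theta> T0_01) u v w
    + R R0_10 T0_10 T0_01 u * (\<theta> T0_10 \<curlywedge> \<theta> T0_01) u v w"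
  unfolding ext_d_omega bracket_at sum_tpairs R_0_vanishes by (simp add: wedge_def algebra_simps)

lemma structure_equation_1:
  "d (\<Omega> R1_10) u v w = (\<Omega> R1_01 \<curlywedge> \<theta> T0_10) u v w + (\<Omega> R1_10 \<curlywedge> \<Omega> R0_01) u v w
    - \<i> * (\<Omega> R2 \<curlywedge> \<theta> Tm1_10) u v w + (\<Sum>(b, c)\<in>tpairs. R R1_10 b c u * (\<theta> b \<curlywedge> \<theta> c) u v w)"
  unfolding ext_d_omega bracket_at by (simp add: wedge_def algebra_simps)

lemma structure_equation_2:
  "d (\<Omega> R2) u v w = (\<i>/2) * (\<Omega> R1_10 \<curlywedge> \<Omega> R1_01) u v w - ((\<Omega> R0_10 + \<Omega> R0_01) \<curlywedge> \<Omega> R2) u v w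
    + (\<Sum>(b, c)\<in>tpairs. R R2 b c u * (\<theta> b \<curlywedge> \<theta> c) u v w)"
  unfolding ext_d_omega bracket_at by (simp add: wedge_def algebra_simps)

lemmas structure_equations_at = structure_equation_m2
  structure_equation_m1
  structure_equation_0_theta
  structure_equation_0_omega
  structure_equation_1
  structure_equation_2

text \<open>Degree 3 gives two expressions for each of the entries (1,3) and (2,3) of the curvature
  on (e_m1_1, e_m1_2). Equating them yields the real and imaginary parts of the first relation. The
  left-hand side of the second relation is i/2 times the (1,3) entry plus i times the (2,3) entry,
  and averaging the two expressions gives its right-hand side.\<close>

lemma curvature_relations:
  "cnj (R R0_10 Tm2 Tm1_10 u) = - (1/2) * T T0_10 Tm2 Tm1_10 u - (1/2) * R R0_10 Tm2 Tm1_01 u"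
  "R R1_10 Tm1_10 Tm1_01 u = (\<i>/2) * T T0_10 Tm2 Tm1_10 u - (\<i>/2) * R R0_10 Tm2 Tm1_01 u"
  using degree_3[of u]
  by (simp_all add: T_comp_eq R_comp_eq kappaC_pairs cmat_nth, simp_all add: complex_eq_iff)
    (simp_all add: field_simps)

end

theorem mainTheorem1:
  fixes A :: "('m::{t2_space, second_countable_topology}, real^5) chart set"
    and D :: "'m \<Rightarrow> (real^5) set"
    and J :: "'m \<Rightarrow> real^5 \<Rightarrow> real^5"
    and B :: "('q::{t2_space, second_countable_topology}, real^10) chart set"
    and \<pi> :: "'q \<Rightarrow> 'm"
    and act :: "'q \<Rightarrow> rmat \<Rightarrow> 'q"
    and varpi :: "'q \<Rightarrow> real^10 \<Rightarrow> rmat"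
  assumes "girdled_CR_manifold A D J"
    and "canonical_cartan_connection A D J B \<pi> act varpi"
  shows "let d = ext_d B; \<theta> = theta_comp varpi; \<omega> = omega_comp varpi;
             T = T_comp B varpi; R = R_comp B varpi in
    \<comment> \<open>the structure equations\<close>
    d (\<theta> Tm2) + (\<i>/2) \<cdot> (\<theta> Tm1_10 \<curlywedge> \<theta> Tm1_01) - (\<omega> R0_10 + \<omega> R0_01) \<curlywedge> \<theta> Tm2 = 0
  \<and> d (\<theta> Tm1_10) - \<theta> T0_10 \<curlywedge> \<theta> Tm1_01 - \<omega> R0_10 \<curlywedge> \<theta> Tm1_10 + \<i> \<cdot> (\<omega> R1_10 \<curlywedge> \<theta> Tm2)
    = T Tm1_10 Tm2 T0_10 \<odot> (\<theta> Tm2 \<curlywedge> \<theta> T0_10) + T Tm1_10 Tm2 T0_01 \<odot> (\<theta> Tm2 \<curlywedge> \<theta> T0_01)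
  \<and> d (\<theta> T0_10) - (\<omega> R0_10 - \<omega> R0_01) \<curlywedge> \<theta> T0_10 + (1/2) \<cdot> (\<omega> R1_10 \<curlywedge> \<theta> Tm1_10)
    = T T0_10 Tm2 Tm1_10 \<odot> (\<theta> Tm2 \<curlywedge> \<theta> Tm1_10) + T T0_10 Tm2 Tm1_01 \<odot> (\<theta> Tm2 \<curlywedge> \<theta> Tm1_01)
      + T T0_10 Tm2 T0_10 \<odot> (\<theta> Tm2 \<curlywedge> \<theta> T0_10) + T T0_10 Tm2 T0_01 \<odot> (\<theta> Tm2 \<curlywedge> \<theta> T0_01)
      + T T0_10 Tm1_01 T0_10 \<odot> (\<theta> Tm1_01 \<curlywedge> \<theta> T0_10)
      + T T0_10 T0_10 T0_01 \<odot> (\<theta> T0_10 \<curlywedge> \<theta> T0_01)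
  \<and> d (\<omega> R0_10) - \<theta> T0_10 \<curlywedge> \<theta> T0_01 + (1/2) \<cdot> (\<omega> R1_01 \<curlywedge> \<theta> Tm1_10) + \<omega> R2 \<curlywedge> \<theta> Tm2
    = R R0_10 Tm2 Tm1_10 \<odot> (\<theta> Tm2 \<curlywedge> \<theta> Tm1_10) + R R0_10 Tm2 Tm1_01 \<odot> (\<theta> Tm2 \<curlywedge> \<theta> Tm1_01)
      + R R0_10 Tm1_10 T0_10 \<odot> (\<theta> Tm1_10 \<curlywedge> \<theta> T0_10)
      + R R0_10 Tm1_10 T0_01 \<odot> (\<theta> Tm1_10 \<curlywedge> \<theta> T0_01)
      + R R0_10 Tm1_01 T0_10 \<odot> (\<theta> Tm1_01 \<curlywedge> \<theta> T0_10)
      + R R0_10 Tm1_01 T0_01 \<odot> (\<theta> Tm1_01 \<curlywedge> \<theta> T0_01)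
      + R R0_10 T0_10 T0_01 \<odot> (\<theta> T0_10 \<curlywedge> \<theta> T0_01)
  \<and> d (\<omega> R1_10) - \<omega> R1_01 \<curlywedge> \<theta> T0_10 - \<omega> R1_10 \<curlywedge> \<omega> R0_01 + \<i> \<cdot> (\<omega> R2 \<curlywedge> \<theta> Tm1_10)
    = (\<Sum>(b, c)\<in>tpairs. R R1_10 b c \<odot> (\<theta> b \<curlywedge> \<theta> c))
  \<and> d (\<omega> R2) - (\<i>/2) \<cdot> (\<omega> R1_10 \<curlywedge> \<omega> R1_01) + (\<omega> R0_10 + \<omega> R0_01) \<curlywedge> \<omega> R2
    = (\<Sum>(b, c)\<in>tpairs. R R2 b c \<odot> (\<theta> b \<curlywedge> \<theta> c))
    \<comment> \<open>their complex conjugates\<close>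
  \<and> d (\<theta> Tm2) - (\<i>/2) \<cdot> (\<theta> Tm1_01 \<curlywedge> \<theta> Tm1_10) - (\<omega> R0_01 + \<omega> R0_10) \<curlywedge> \<theta> Tm2 = 0
  \<and> d (\<theta> Tm1_01) - \<theta> T0_01 \<curlywedge> \<theta> Tm1_10 - \<omega> R0_01 \<curlywedge> \<theta> Tm1_01 - \<i> \<cdot> (\<omega> R1_01 \<curlywedge> \<theta> Tm2)
    = T Tm1_01 Tm2 T0_01 \<odot> (\<theta> Tm2 \<curlywedge> \<theta> T0_01) + T Tm1_01 Tm2 T0_10 \<odot> (\<theta> Tm2 \<curlywedge> \<theta> T0_10)
  \<and> d (\<theta> T0_01) - (\<omega> R0_01 - \<omega> R0_10) \<curlywedge> \<theta> T0_01 + (1/2) \<cdot> (\<omega> R1_01 \<curlywedge> \<theta> Tm1_01)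
    = T T0_01 Tm2 Tm1_01 \<odot> (\<theta> Tm2 \<curlywedge> \<theta> Tm1_01) + T T0_01 Tm2 Tm1_10 \<odot> (\<theta> Tm2 \<curlywedge> \<theta> Tm1_10)
      + T T0_01 Tm2 T0_01 \<odot> (\<theta> Tm2 \<curlywedge> \<theta> T0_01) + T T0_01 Tm2 T0_10 \<odot> (\<theta> Tm2 \<curlywedge> \<theta> T0_10)
      + T T0_01 Tm1_10 T0_01 \<odot> (\<theta> Tm1_10 \<curlywedge> \<theta> T0_01)
      + T T0_01 T0_01 T0_10 \<odot> (\<theta> T0_01 \<curlywedge> \<theta> T0_10)
  \<and> d (\<omega> R0_01) - \<theta> T0_01 \<curlywedge> \<theta> T0_10 + (1/2) \<cdot> (\<omega> R1_10 \<curlywedge> \<theta> Tm1_01) + \<omega> R2 \<curlywedge> \<theta> Tm2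
    = R R0_01 Tm2 Tm1_01 \<odot> (\<theta> Tm2 \<curlywedge> \<theta> Tm1_01) + R R0_01 Tm2 Tm1_10 \<odot> (\<theta> Tm2 \<curlywedge> \<theta> Tm1_10)
      + R R0_01 Tm1_01 T0_01 \<odot> (\<theta> Tm1_01 \<curlywedge> \<theta> T0_01)
      + R R0_01 Tm1_01 T0_10 \<odot> (\<theta> Tm1_01 \<curlywedge> \<theta> T0_10)
      + R R0_01 Tm1_10 T0_01 \<odot> (\<theta> Tm1_10 \<curlywedge> \<theta> T0_01)
      + R R0_01 Tm1_10 T0_10 \<odot> (\<theta> Tm1_10 \<curlywedge> \<theta> T0_10)
      + R R0_01 T0_01 T0_10 \<odot> (\<theta> T0_01 \<curlywedge> \<theta> T0_10)
  \<and> d (\<omega> R1_01) - \<omega> R1_10 \<curlywedge> \<theta> T0_01 - \<omega> R1_01 \<curlywedge> \<omega> R0_10 - \<i> \<cdot> (\<omega> R2 \<curlywedge> \<theta> Tm1_01)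
    = (\<Sum>(b, c)\<in>tpairs. R R1_01 (tbar b) (tbar c) \<odot> (\<theta> (tbar b) \<curlywedge> \<theta> (tbar c)))
  \<and> d (\<omega> R2) + (\<i>/2) \<cdot> (\<omega> R1_01 \<curlywedge> \<omega> R1_10) + (\<omega> R0_01 + \<omega> R0_10) \<curlywedge> \<omega> R2
    = (\<Sum>(b, c)\<in>tpairs. R R2 (tbar b) (tbar c) \<odot> (\<theta> (tbar b) \<curlywedge> \<theta> (tbar c)))
    \<comment> \<open>the relations between the curvature components\<close>
  \<and> (\<forall>u. cnj (R R0_10 Tm2 Tm1_10 u) = - (1/2) * T T0_10 Tm2 Tm1_10 u - (1/2) * R R0_10 Tm2 Tm1_01 u)
  \<and> (\<forall>u. R R1_10 Tm1_10 Tm1_01 u = (\<i>/2) * T T0_10 Tm2 Tm1_10 u - (\<i>/2) * R R0_10 Tm2 Tm1_01 u)"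
proof -
  interpret canonical_cartan A B \<pi> act varpi D J
    using assms(2) by unfold_locales (simp_all add: canonical_cartan_connection_def)
  note at = const_scale_def fun_scale_def tpairs_eq
  note cnj_comps = theta_comp_cnj[symmetric] omega_comp_cnj[symmetric]
    T_comp_cnj[symmetric] R_comp_cnj[symmetric]
  \<comment> \<open>Together with the conjugation rules for the components, this reduces each
    equation for a conjugate index to the one already known.\<close>
  have conj_at:
    "d (\<theta> Tm1_01) u v w = cnj (d (\<theta> Tm1_10) u v w)" "d (\<theta> T0_01) u v w = cnj (d (\<theta> T0_10) u v w)"
    "d (\<Omega> R0_01) u v w = cnj (d (\<Omega> R0_10) u v w)" "d (\<Omega> R1_01) u v w = cnj (d (\<Omega> R1_10) u v w)"
    for u v w
    using ext_d_theta_cnj[of Tm1_10] ext_d_theta_cnj[of T0_10] ext_d_omega_cnj[of R0_10]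
      ext_d_omega_cnj[of R1_10] by simp_all
  \<comment> \<open>As \<open>rbar\<close> fixes \<open>R2\<close>, conjugation relates the
    left-hand side to itself and would loop as a rewrite rule; here it is applied once by
    hand.\<close>
  have conj_R2: "d (\<Omega> R2) + (\<i>/2) \<cdot> (\<Omega> R1_01 \<curlywedge> \<Omega> R1_10) + (\<Omega> R0_01 + \<Omega> R0_10) \<curlywedge> \<Omega> R2
      = (\<Sum>(b, c)\<in>tpairs. R R2 (tbar b) (tbar c) \<odot> (\<theta> (tbar b) \<curlywedge> \<theta> (tbar c)))"
  proof (intro ext)
    fix u v w
    have "d (\<Omega> R2) u v w = cnj (d (\<Omega> R2) u v w)"
      using ext_d_omega_cnj[of R2] by simp
    then show "(d (\<Omega> R2) + (\<i>/2) \<cdot> (\<Omega> R1_01 \<curlywedge> \<Omega> R1_10) + (\<Omega> R0_01 + \<Omega> R0_10) \<curlywedge> \<Omega> R2) u v w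
        = (\<Sum>(b, c)\<in>tpairs. R R2 (tbar b) (tbar c) \<odot> (\<theta> (tbar b) \<curlywedge> \<theta> (tbar c))) u v w"
      unfolding structure_equations_at(6)
      by (simp add: structure_equations_at(6) at)
        (simp add: wedge_def cnj_comps algebra_simps add_divide_distrib diff_divide_distrib)
  qed
  show ?thesis
    unfolding Let_def
    by (intro conjI allI curvature_relations conj_R2; intro ext;
        simp add: conj_at structure_equations_at at cnj_comps;
        simp add: wedge_def cnj_comps algebra_simps add_divide_distrib diff_divide_distrib)
qed

end
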